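(* The Higson corona functor $\nu\colon \mathbf{TB}\to\mathbf{K}$ is an equivalence of categories. Here $\mathbf{TB}$ is the category whose objects are the totally bounded, locally compact metric spaces, each equipped with its $C_0$ coarse structure, and whose morphisms are the equivalence classes of (not necessarily continuous) coarse maps modulo closeness; and $\mathbf{K}$ is the category of compact metrizable spaces and continuous maps.
   Context: A coarse structure on a set $X$ is a collection $\mathcal{E}$ of subsets of $X\times X$, called controlled sets, that contains the diagonal $\Delta_X$ and is closed under taking subsets, inverses $E^{-1}=\{(x,y):(y,x)\in E\}$, compositions $E\circ F=\{(x,z): \exists y,\ (x,y)\in E,\ (y,z)\in F\}$, and finite unions. A subset $B\subset X$ is bounded if $B\times B$ is controlled. A map $f\colon X\to Y$ of coarse spaces is proper if $f^{-1}(B)$ is bounded for every bounded $B\subset Y$; bornologous if $(f\times f)(E)$ is controlled for every controlled $E$; coarse if it is proper and bornologous. Maps $f,g\colon S\to Y$ from a set to a coarse space are close if $\{(f(s),g(s)): s\in S\}$ is controlled. Closeness is compatible with composition of coarse maps. The $C_0$ coarse structure on a locally compact metric space $(X,d)$: $E\subset X\times X$ is controlled iff for every $\varepsilon>0$ there is a compact $K\subset X$ such that $d(x,y)<\varepsilon$ for all $(x,y)\in E\setminus (K\times K)$. In it, a set is bounded iff it has compact closure. A bounded (not necessarily continuous) function $\varphi\colon X\to\mathbb{R}$ on a coarse space is a Higson function if for every controlled $E$ and $\varepsilon>0$ there is a bounded $B\subset X$ with $|\varphi(x)-\varphi(y)|<\varepsilon$ for all $(x,y)\in E\setminus (B\times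 B)$. $B_h(X)$ denotes the algebra of Higson functions and $C_h(X)$ the subalgebra of continuous ones. The Higson compactification $hX$ is the closure of the image of $X$ under the embedding $e\colon X\to\mathbb{R}^{C_h(X)}$, $e(x)=(\varphi(x))_{\varphi\in C_h(X)}$; the Higson corona is $\nu X=hX\setminus X$. Let $B_0(X)$ be the algebra of bounded real functions on $X$ that vanish at infinity (for each $\varepsilon>0$ there is a compact $K$ with $|\varphi|<\varepsilon$ off $K$) and $C_0(X)$ its subalgebra of continuous functions. There are natural isomorphisms $C(\nu X)\cong C_h(X)/C_0(X)\cong B_h(X)/B_0(X)$ for objects $X$ of $\mathbf{TB}$. A coarse map $f\colon X\to Y$ induces $f^*\colon B_h(Y)\to B_h(X)$, $\varphi\mapsto\varphi\circ f$, with $f^*(B_0(Y))\subset B_0(X)$, hence a homomorphism $C(\nu Y)\to C(\nu X)$, and $\nu f\colon\nu X\to\nu Y$ is the continuous map corresponding to it by Gel'fand–Naimark duality; it depends only on the closeness class of $f$. For $X$ in $\mathbf{TB}$, the completion $\tilde X$ is compact and is (equivalent to) the Higson compactification, so $\nu X=\tilde X\setminus X$ is compact metrizable.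
   Formalization: The objects of TB are required to be nonempty: the empty space and a point both have empty Higson corona, but there is no map from the point to the empty space, so with the empty space allowed the functor would not be full. *)

theory Defs
  imports "HOL-Analysis.Analysis"
begin

section \<open>Categories, functors and equivalences\<close>

text \<open>
  Hom-sets of different pairs of objects need not be disjoint, so that composition and the
  arrow part of a functor also take the objects involved as arguments:
  \<open>cmp C X Y Z g f\<close> is the composite of \<open>f : X \<rightarrow> Y\<close> and \<open>g : Y \<rightarrow> Z\<close>.
\<close>

record ('o, 'm) cat =
  ob :: "'o set"
  hom :: "'o \<Rightarrow> 'o \<Rightarrow> 'm set"
  ident :: "'o \<Rightarrow> 'm"
  cmp :: "'o \<Rightarrow> 'o \<Rightarrow> 'o \<Rightarrow> 'm \<Rightarrow> 'm \<Rightarrow> 'm"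

definition category :: "('o, 'm) cat \<Rightarrow> bool" where
  "category C \<longleftrightarrow>
    (\<forall>X\<in>ob C. ident C X \<in> hom C X X) \<and>
    (\<forall>X\<in>ob C. \<forall>Y\<in>ob C. \<forall>Z\<in>ob C. \<forall>f\<in>hom C X Y. \<forall>g\<in>hom C Y Z.
        cmp C X Y Z g f \<in> hom C X Z) \<and>
    (\<forall>X\<in>ob C. \<forall>Y\<in>ob C. \<forall>f\<in>hom C X Y.
        cmp C X X Y f (ident C X) = f \<and> cmp C X Y Y (ident C Y) f = f) \<and>
    (\<forall>W\<in>ob C. \<forall>X\<in>ob C. \<forall>Y\<in>ob C. \<forall>Z\<in>ob C.
        \<forall>f\<in>hom C W X. \<forall>g\<in>hom C X Y. \<forall>h\<in>hom C Y Z.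
        cmp C W Y Z h (cmp C W X Y g f) = cmp C W X Z (cmp C X Y Z h g) f)"

record ('o1, 'm1, 'o2, 'm2) ftr =
  on_ob :: "'o1 \<Rightarrow> 'o2"
  on_hom :: "'o1 \<Rightarrow> 'o1 \<Rightarrow> 'm1 \<Rightarrow> 'm2"

definition is_functor ::
  "('o1, 'm1) cat \<Rightarrow> ('o2, 'm2) cat \<Rightarrow> ('o1, 'm1, 'o2, 'm2) ftr \<Rightarrow> bool" where
  "is_functor C D F \<longleftrightarrow>
    category C \<and> category D \<and>
    (\<forall>X\<in>ob C. on_ob F X \<in> ob D) \<and>
    (\<forall>X\<in>ob C. \<forall>Y\<in>ob C. \<forall>f\<in>hom C X Y. on_hom F X Y f \<in> hom D (on_ob F X) (on_ob F Y)) \<and>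
    (\<forall>X\<in>ob C. on_hom F X X (ident C X) = ident D (on_ob F X)) \<and>
    (\<forall>X\<in>ob C. \<forall>Y\<in>ob C. \<forall>Z\<in>ob C. \<forall>f\<in>hom C X Y. \<forall>g\<in>hom C Y Z.
        on_hom F X Z (cmp C X Y Z g f) =
        cmp D (on_ob F X) (on_ob F Y) (on_ob F Z) (on_hom F Y Z g) (on_hom F X Y f))"

definition id_functor :: "('o, 'm, 'o, 'm) ftr" where
  "id_functor = \<lparr>on_ob = (\<lambda>X. X), on_hom = (\<lambda>X Y f. f)\<rparr>"

definition comp_functor ::
  "('o2, 'm2, 'o3, 'm3) ftr \<Rightarrow> ('o1, 'm1, 'o2, 'm2) ftr \<Rightarrow> ('o1, 'm1, 'o3, 'm3) ftr" where
  "comp_functor G F =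
    \<lparr>on_ob = (\<lambda>X. on_ob G (on_ob F X)),
     on_hom = (\<lambda>X Y f. on_hom G (on_ob F X) (on_ob F Y) (on_hom F X Y f))\<rparr>"

definition is_iso :: "('o, 'm) cat \<Rightarrow> 'o \<Rightarrow> 'o \<Rightarrow> 'm \<Rightarrow> bool" where
  "is_iso C X Y f \<longleftrightarrow> f \<in> hom C X Y \<and>
    (\<exists>g\<in>hom C Y X. cmp C X Y X g f = ident C X \<and> cmp C Y X Y f g = ident C Y)"

definition natural_iso ::
  "('o1, 'm1) cat \<Rightarrow> ('o2, 'm2) cat \<Rightarrow>
   ('o1, 'm1, 'o2, 'm2) ftr \<Rightarrow> ('o1, 'm1, 'o2, 'm2) ftr \<Rightarrow> ('o1 \<Rightarrow> 'm2) \<Rightarrow> bool" where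
  "natural_iso C D F G \<eta> \<longleftrightarrow>
    (\<forall>X\<in>ob C. is_iso D (on_ob F X) (on_ob G X) (\<eta> X)) \<and>
    (\<forall>X\<in>ob C. \<forall>Y\<in>ob C. \<forall>f\<in>hom C X Y.
        cmp D (on_ob F X) (on_ob F Y) (on_ob G Y) (\<eta> Y) (on_hom F X Y f) =
        cmp D (on_ob F X) (on_ob G X) (on_ob G Y) (on_hom G X Y f) (\<eta> X))"

definition equivalence_of_categories ::
  "('o1, 'm1) cat \<Rightarrow> ('o2, 'm2) cat \<Rightarrow> ('o1, 'm1, 'o2, 'm2) ftr \<Rightarrow> bool" where
  "equivalence_of_categories C D F \<longleftrightarrow>
    is_functor C D F \<and>
    (\<exists>G. is_functor D C G \<and>
      (\<exists>\<eta>. natural_iso C C id_functor (comp_functor G F) \<eta>) \<and>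
      (\<exists>\<epsilon>. natural_iso D D (comp_functor F G) id_functor \<epsilon>))"


section \<open>Coarse spaces\<close>

text \<open>
  A coarse space is given by its carrier \<open>X\<close> and its set \<open>\<E>\<close> of controlled sets.  Maps between
  carriers are extensional (\<open>undefined\<close> off the carrier), so that equality of maps
  is equality on the carrier.
\<close>

definition coarse_structure :: "'a set \<Rightarrow> ('a \<times> 'a) set set \<Rightarrow> bool" where
  "coarse_structure X \<E> \<longleftrightarrow>
    \<E> \<subseteq> Pow (X \<times> X) \<and>
    Id_on X \<in> \<E> \<and>
    (\<forall>E\<in>\<E>. \<forall>D. D \<subseteq> E \<longrightarrow> D \<in> \<E>) \<and>
    (\<forall>E\<in>\<E>. E\<inverse> \<in> \<E>) \<and>
    (\<forall>E\<in>\<E>. \<forall>F\<in>\<E>. E O F \<in> \<E>) \<and>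
    (\<forall>E\<in>\<E>. \<forall>F\<in>\<E>. E \<union> F \<in> \<E>)"

definition coarse_bounded :: "('a \<times> 'a) set set \<Rightarrow> 'a set \<Rightarrow> bool" where
  "coarse_bounded \<E> B \<longleftrightarrow> B \<times> B \<in> \<E>"

definition coarse_proper ::
  "'a set \<Rightarrow> ('a \<times> 'a) set set \<Rightarrow> ('b \<times> 'b) set set \<Rightarrow> ('a \<Rightarrow> 'b) \<Rightarrow> bool" where
  "coarse_proper X \<E> \<F> f \<longleftrightarrow>
    (\<forall>B. coarse_bounded \<F> B \<longrightarrow> coarse_bounded \<E> (X \<inter> f -` B))"

definition bornologous :: "('a \<times> 'a) set set \<Rightarrow> ('b \<times> 'b) set set \<Rightarrow> ('a \<Rightarrow> 'b) \<Rightarrow> bool" where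
  "bornologous \<E> \<F> f \<longleftrightarrow> (\<forall>E\<in>\<E>. map_prod f f ` E \<in> \<F>)"

definition coarse_maps ::
  "'a set \<Rightarrow> ('a \<times> 'a) set set \<Rightarrow> 'b set \<Rightarrow> ('b \<times> 'b) set set \<Rightarrow> ('a \<Rightarrow> 'b) set" where
  "coarse_maps X \<E> Y \<F> = {f \<in> X \<rightarrow>\<^sub>E Y. coarse_proper X \<E> \<F> f \<and> bornologous \<E> \<F> f}"

definition close_maps :: "'s set \<Rightarrow> ('b \<times> 'b) set set \<Rightarrow> ('s \<Rightarrow> 'b) \<Rightarrow> ('s \<Rightarrow> 'b) \<Rightarrow> bool" where
  "close_maps S \<F> f g \<longleftrightarrow> (\<lambda>s. (f s, g s)) ` S \<in> \<F>"

definition higson_functions :: "'a set \<Rightarrow> ('a \<times> 'a) set set \<Rightarrow> ('a \<Rightarrow> real) set" where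
  "higson_functions X \<E> = {\<phi> \<in> extensional X. bounded (\<phi> ` X) \<and>
    (\<forall>E\<in>\<E>. \<forall>\<epsilon>>0. \<exists>B. B \<subseteq> X \<and> coarse_bounded \<E> B \<and>
      (\<forall>(x, y) \<in> E - B \<times> B. \<bar>\<phi> x - \<phi> y\<bar> < \<epsilon>))}"


section \<open>The \<open>C\<^sub>0\<close> coarse structure\<close>

definition C0_coarse :: "'a metric \<Rightarrow> ('a \<times> 'a) set set" where
  "C0_coarse X = {E. E \<subseteq> mspace X \<times> mspace X \<and>
    (\<forall>\<epsilon>>0. \<exists>K. compactin (mtopology_of X) K \<and> (\<forall>(x, y) \<in> E - K \<times> K. mdist X x y < \<epsilon>))}"

lemma C0_coarse_iff:
  "E \<in> C0_coarse X \<longleftrightarrow> E \<subseteq> mspace X \<times> mspace X \<and>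
    (\<forall>\<epsilon>>0. \<exists>K. compactin (mtopology_of X) K \<and>
      (\<forall>x y. (x, y) \<in> E \<longrightarrow> (x, y) \<notin> K \<times> K \<longrightarrow> mdist X x y < \<epsilon>))"
  unfolding C0_coarse_def mem_Collect_eq Ball_def split_paired_All prod.case Diff_iff imp_conjL ..

lemma C0_coarse_comp:
  assumes lc: "locally_compact_space (mtopology_of X)"
    and E: "E \<in> C0_coarse X" and F: "F \<in> C0_coarse X"
  shows "E O F \<in> C0_coarse X"
proof -
  interpret Metric_space "mspace X" "mdist X" by simp
  have top: "mtopology_of X = mtopology" by (simp add: mtopology_of_def)
  have sub: "E \<subseteq> mspace X \<times> mspace X" "F \<subseteq> mspace X \<times> mspace X"
    using E F unfolding C0_coarse_iff by blast+
  have EK: "\<exists>K. compactin mtopology K \<and>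
      (\<forall>x y. (x, y) \<in> E \<longrightarrow> (x, y) \<notin> K \<times> K \<longrightarrow> mdist X x y < \<epsilon>)"
    and FK: "\<exists>K. compactin mtopology K \<and>
      (\<forall>x y. (x, y) \<in> F \<longrightarrow> (x, y) \<notin> K \<times> K \<longrightarrow> mdist X x y < \<epsilon>)"
    if "\<epsilon> > 0" for \<epsilon>
    using E F that unfolding C0_coarse_iff top by blast+
  have "\<exists>K. compactin mtopology K \<and>
      (\<forall>x z. (x, z) \<in> E O F \<longrightarrow> (x, z) \<notin> K \<times> K \<longrightarrow> mdist X x z < \<epsilon>)"
    if "\<epsilon> > 0" for \<epsilon> :: real
  proof -
    obtain K1 where K1: "compactin mtopology K1" "\<And>x y. (x, y) \<in> E \<Longrightarrow> (x, y) \<notin> K1 \<times> K1 \<Longrightarrow> mdist X x y < \<epsilon>/2"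
      using EK[of "\<epsilon>/2"] \<open>\<epsilon> > 0\<close> half_gt_zero by blast
    obtain K2 where K2: "compactin mtopology K2" "\<And>x y. (x, y) \<in> F \<Longrightarrow> (x, y) \<notin> K2 \<times> K2 \<Longrightarrow> mdist X x y < \<epsilon>/2"
      using FK[of "\<epsilon>/2"] \<open>\<epsilon> > 0\<close> half_gt_zero by blast
    define L where "L = K1 \<union> K2"
    have L: "compactin mtopology L"
      unfolding L_def using K1 K2 by (simp add: compactin_Un)
    obtain U K3 where U: "openin mtopology U" "compactin mtopology K3" "L \<subseteq> U" "U \<subseteq> K3"
      using lc L locally_compact_space_compact_closed_compact[of mtopology] Hausdorff_space_mtopology
      unfolding top by blast
    obtain \<delta> where \<delta>: "\<delta> > 0" "\<And>x. x \<in> L \<Longrightarrow> mball x \<delta> \<subseteq> U"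
      using lebesgue_number[OF L, of "{U}"] U by auto
    obtain K4 where K4: "compactin mtopology K4" "\<And>x y. (x, y) \<in> E \<Longrightarrow> (x, y) \<notin> K4 \<times> K4 \<Longrightarrow> mdist X x y < \<delta>"
      using EK[OF \<open>\<delta> > 0\<close>] by blast
    obtain K5 where K5: "compactin mtopology K5" "\<And>x y. (x, y) \<in> F \<Longrightarrow> (x, y) \<notin> K5 \<times> K5 \<Longrightarrow> mdist X x y < \<delta>"
      using FK[OF \<open>\<delta> > 0\<close>] by blast
    define K where "K = L \<union> K3 \<union> K4 \<union> K5"
    have K: "compactin mtopology K"
      unfolding K_def using L U K4 K5 by (simp add: compactin_Un)
    have "mdist X x z < \<epsilon>" if xy: "(x, y) \<in> E" and yz: "(y, z) \<in> F" and "(x, z) \<notin> K \<times> K" for x y z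
    proof -
      have car: "x \<in> mspace X" "y \<in> mspace X" "z \<in> mspace X"
        using sub xy yz by auto
      have "(x, y) \<notin> K1 \<times> K1"
      proof
        assume A: "(x, y) \<in> K1 \<times> K1"
        then have "z \<notin> K" using \<open>(x, z) \<notin> K \<times> K\<close> by (auto simp: K_def L_def)
        then have "mdist X y z < \<delta>" using K5(2)[of y z] yz by (auto simp: K_def)
        then have "z \<in> U" using \<delta>(2)[of y] A car by (auto simp: L_def)
        then show False using \<open>z \<notin> K\<close> U by (auto simp: K_def)
      qed
      moreover have "(y, z) \<notin> K2 \<times> K2"
      proof
        assume A: "(y, z) \<in> K2 \<times> K2"
        then have "x \<notin> K" using \<open>(x, z) \<notin> K \<times> K\<close> by (auto simp: K_def L_def)
        then have "mdist X y x < \<delta>" using K4(2)[of x y] xy by (auto simp: K_def commute)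
        then have "x \<in> U" using \<delta>(2)[of y] A car by (auto simp: L_def)
        then show False using \<open>x \<notin> K\<close> U by (auto simp: K_def)
      qed
      ultimately have "mdist X x y < \<epsilon>/2" "mdist X y z < \<epsilon>/2"
        using K1(2)[of x y] K2(2)[of y z] xy yz by auto
      with triangle[OF car] show ?thesis by linarith
    qed
    then show ?thesis using K by (intro exI[of _ K]) blast
  qed
  moreover have "E O F \<subseteq> mspace X \<times> mspace X"
    using sub by blast
  ultimately show ?thesis
    unfolding C0_coarse_iff top by blast
qed

lemma coarse_structure_C0_coarse:
  assumes "locally_compact_space (mtopology_of X)"
  shows "coarse_structure (mspace X) (C0_coarse X)"
proof -
  interpret Metric_space "mspace X" "mdist X" by simp
  have top: "mtopology_of X = mtopology" by (simp add: mtopology_of_def)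
  have diag: "Id_on (mspace X) \<in> C0_coarse X"
    unfolding C0_coarse_iff using compactin_empty by fastforce
  have down: "D \<in> C0_coarse X" if "E \<in> C0_coarse X" "D \<subseteq> E" for D E
    using that unfolding C0_coarse_iff by (meson order_trans subsetD)
  have inv: "E\<inverse> \<in> C0_coarse X" if "E \<in> C0_coarse X" for E
  proof -
    have "\<exists>K. compactin (mtopology_of X) K \<and>
        (\<forall>x y. (x, y) \<in> E\<inverse> \<longrightarrow> (x, y) \<notin> K \<times> K \<longrightarrow> mdist X x y < \<epsilon>)"
      if "\<epsilon> > 0" for \<epsilon>
    proof -
      obtain K where "compactin (mtopology_of X) K"
        "\<And>x y. (x, y) \<in> E \<Longrightarrow> (x, y) \<notin> K \<times> K \<Longrightarrow> mdist X x y < \<epsilon>"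
        using \<open>E \<in> C0_coarse X\<close> \<open>\<epsilon> > 0\<close> unfolding C0_coarse_iff by blast
      then show ?thesis unfolding converse_iff
        using commute by (intro exI[of _ K]) (metis mem_Sigma_iff)
    qed
    then show ?thesis using \<open>E \<in> C0_coarse X\<close> unfolding C0_coarse_iff by blast
  qed
  have un: "E \<union> F \<in> C0_coarse X" if EF: "E \<in> C0_coarse X" "F \<in> C0_coarse X" for E F
  proof -
    have "\<exists>K. compactin (mtopology_of X) K \<and>
        (\<forall>x y. (x, y) \<in> E \<union> F \<longrightarrow> (x, y) \<notin> K \<times> K \<longrightarrow> mdist X x y < \<epsilon>)"
      if "\<epsilon> > 0" for \<epsilon>
    proof -
      obtain K where K: "compactin (mtopology_of X) K"
        "\<And>x y. (x, y) \<in> E \<Longrightarrow> (x, y) \<notin> K \<times> K \<Longrightarrow> mdist X x y < \<epsilon>"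
        using EF(1) \<open>\<epsilon> > 0\<close> unfolding C0_coarse_iff by blast
      obtain L where L: "compactin (mtopology_of X) L"
        "\<And>x y. (x, y) \<in> F \<Longrightarrow> (x, y) \<notin> L \<times> L \<Longrightarrow> mdist X x y < \<epsilon>"
        using EF(2) \<open>\<epsilon> > 0\<close> unfolding C0_coarse_iff by blast
      have "compactin (mtopology_of X) (K \<union> L)"
        using K L by (simp add: compactin_Un)
      then show ?thesis using K(2) L(2) by (intro exI[of _ "K \<union> L"]) blast
    qed
    moreover have "E \<union> F \<subseteq> mspace X \<times> mspace X"
      using EF unfolding C0_coarse_iff by blast
    ultimately show ?thesis unfolding C0_coarse_iff by blast
  qed
  have car: "C0_coarse X \<subseteq> Pow (mspace X \<times> mspace X)"
    unfolding C0_coarse_def by blast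
  show ?thesis
    unfolding coarse_structure_def
    by (intro conjI ballI allI impI;
        (rule car | rule diag | erule (1) down | erule inv | erule (1) C0_coarse_comp[OF assms] | erule (1) un))
qed


section \<open>The Higson corona\<close>

definition Bh :: "'a metric \<Rightarrow> ('a \<Rightarrow> real) set" where
  "Bh X = higson_functions (mspace X) (C0_coarse X)"

definition Ch :: "'a metric \<Rightarrow> ('a \<Rightarrow> real) set" where
  "Ch X = {\<phi> \<in> Bh X. continuous_map (mtopology_of X) euclideanreal \<phi>}"

definition B0 :: "'a metric \<Rightarrow> ('a \<Rightarrow> real) set" where
  "B0 X = {\<phi> \<in> extensional (mspace X). bounded (\<phi> ` mspace X) \<and>
    (\<forall>\<epsilon>>0. \<exists>K. compactin (mtopology_of X) K \<and> (\<forall>x \<in> mspace X - K. \<bar>\<phi> x\<bar> < \<epsilon>))}"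

definition higson_embedding :: "'a metric \<Rightarrow> 'a \<Rightarrow> (('a \<Rightarrow> real) \<Rightarrow> real)" where
  "higson_embedding X x = (\<lambda>\<phi>\<in>Ch X. \<phi> x)"

definition higson_ambient :: "'a metric \<Rightarrow> (('a \<Rightarrow> real) \<Rightarrow> real) topology" where
  "higson_ambient X = product_topology (\<lambda>\<phi>. euclideanreal) (Ch X)"

definition higson_compactification :: "'a metric \<Rightarrow> (('a \<Rightarrow> real) \<Rightarrow> real) topology" where
  "higson_compactification X =
    subtopology (higson_ambient X) (higson_ambient X closure_of (higson_embedding X ` mspace X))"

definition higson_corona :: "'a metric \<Rightarrow> (('a \<Rightarrow> real) \<Rightarrow> real) topology" where
  "higson_corona X = subtopology (higson_compactification X)
    (topspace (higson_compactification X) - higson_embedding X ` mspace X)"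

definition continuous_functions :: "'b topology \<Rightarrow> ('b \<Rightarrow> real) set" where
  "continuous_functions T = {h \<in> extensional (topspace T). continuous_map T euclideanreal h}"

text \<open>
  The epimorphism \<open>B\<^sub>h(X) \<rightarrow> B\<^sub>h(X)/B\<^sub>0(X) \<cong> C\<^sub>h(X)/C\<^sub>0(X) \<cong> C(\<nu>X)\<close>: a Higson function \<open>\<phi>\<close> is
  replaced by a continuous one \<open>\<psi>\<close> with the same class modulo \<open>B\<^sub>0(X)\<close>; the continuous
  extension of \<open>\<psi>\<close> to \<open>hX \<subseteq> \<real>\<^bsup>C\<^sub>h(X)\<^esup>\<close> is the \<open>\<psi>\<close>-th coordinate, which is then restricted to \<open>\<nu>X\<close>.
\<close>

definition corona_function :: "'a metric \<Rightarrow> ('a \<Rightarrow> real) \<Rightarrow> ((('a \<Rightarrow> real) \<Rightarrow> real) \<Rightarrow> real)" where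
  "corona_function X \<phi> = (THE h. \<exists>\<psi>\<in>Ch X. (\<lambda>x\<in>mspace X. \<phi> x - \<psi> x) \<in> B0 X \<and>
    h = (\<lambda>p\<in>topspace (higson_corona X). p \<psi>))"

text \<open>The homomorphism \<open>C(\<nu>Y) \<rightarrow> C(\<nu>X)\<close> induced by \<open>f\<^sup>* : B\<^sub>h(Y) \<rightarrow> B\<^sub>h(X)\<close>.\<close>

definition corona_hom ::
  "'a metric \<Rightarrow> 'b metric \<Rightarrow> ('a \<Rightarrow> 'b) \<Rightarrow>
   ((('b \<Rightarrow> real) \<Rightarrow> real) \<Rightarrow> real) \<Rightarrow> ((('a \<Rightarrow> real) \<Rightarrow> real) \<Rightarrow> real)" where
  "corona_hom X Y f = (THE T.
    T \<in> continuous_functions (higson_corona Y) \<rightarrow>\<^sub>E continuous_functions (higson_corona X) \<and>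
    (\<forall>\<phi>\<in>Bh Y. T (corona_function Y \<phi>) = corona_function X (compose (mspace X) \<phi> f)))"

definition continuous_maps :: "'a topology \<Rightarrow> 'b topology \<Rightarrow> ('a \<Rightarrow> 'b) set" where
  "continuous_maps S T = {f \<in> extensional (topspace S). continuous_map S T f}"

text \<open>The map \<open>\<nu>f\<close> is the Gel'fand dual of that homomorphism.\<close>

definition corona_map ::
  "'a metric \<Rightarrow> 'b metric \<Rightarrow> ('a \<Rightarrow> 'b) \<Rightarrow> (('a \<Rightarrow> real) \<Rightarrow> real) \<Rightarrow> (('b \<Rightarrow> real) \<Rightarrow> real)" where
  "corona_map X Y f = (THE g.
    g \<in> continuous_maps (higson_corona X) (higson_corona Y) \<and>
    (\<forall>h \<in> continuous_functions (higson_corona Y).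
      compose (topspace (higson_corona X)) h g = corona_hom X Y f h))"


section \<open>The categories \<open>TB\<close> and \<open>K\<close> and the Higson corona functor\<close>

definition closeness :: "'a metric \<Rightarrow> 'b metric \<Rightarrow> (('a \<Rightarrow> 'b) \<times> ('a \<Rightarrow> 'b)) set" where
  "closeness X Y = {(f, g).
    f \<in> coarse_maps (mspace X) (C0_coarse X) (mspace Y) (C0_coarse Y) \<and>
    g \<in> coarse_maps (mspace X) (C0_coarse X) (mspace Y) (C0_coarse Y) \<and>
    close_maps (mspace X) (C0_coarse Y) f g}"

text \<open>
  The type \<open>'a\<close> is the universe from which the carriers of the spaces are taken; it must be infinite
  for any space to have a nonempty corona, and since totally bounded spaces have at most the
  cardinality of the continuum, \<open>'a = real\<close> already gives all of them up to isometry.  Coronas live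
  on the type \<open>('a \<Rightarrow> real) \<Rightarrow> real\<close>, over which \<open>K\<close> is taken below; it too is large enough to contain
  a copy of every compact metrizable space.

  Spaces are nonempty: the empty space and a one-point space both have empty corona but are not
  isomorphic (there is no map from the point to the empty space), so the corona functor would not
  be full if the empty space were an object.  The empty topology is an object of \<open>K\<close>, being the
  corona of every compact space.
\<close>

definition TB_cat :: "('a metric, ('a \<Rightarrow> 'a) set) cat" where
  "TB_cat = \<lparr>
    ob = {X. mspace X \<noteq> {} \<and>
             Metric_space.mtotally_bounded (mspace X) (mdist X) (mspace X) \<and>
             locally_compact_space (mtopology_of X)},
    hom = (\<lambda>X Y. coarse_maps (mspace X) (C0_coarse X) (mspace Y) (C0_coarse Y) // closeness X Y),
    ident = (\<lambda>X. closeness X X `` {\<lambda>x\<in>mspace X. x}),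
    cmp = (\<lambda>X Y Z G F. \<Union>g\<in>G. \<Union>f\<in>F. closeness X Z `` {compose (mspace X) g f})\<rparr>"

definition K_cat :: "('b topology, 'b \<Rightarrow> 'b) cat" where
  "K_cat = \<lparr>
    ob = {T. compact_space T \<and> metrizable_space T},
    hom = continuous_maps,
    ident = (\<lambda>T. \<lambda>x\<in>topspace T. x),
    cmp = (\<lambda>S T U g f. compose (topspace S) g f)\<rparr>"

definition higson_corona_functor ::
  "('a metric, ('a \<Rightarrow> 'a) set,
    (('a \<Rightarrow> real) \<Rightarrow> real) topology, (('a \<Rightarrow> real) \<Rightarrow> real) \<Rightarrow> (('a \<Rightarrow> real) \<Rightarrow> real)) ftr" where
  "higson_corona_functor = \<lparr>
    on_ob = higson_corona,
    on_hom = (\<lambda>X Y F. THE g. \<forall>f\<in>F. corona_map X Y f = g)\<rparr>"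

end

theory Submission
  imports Defs
begin

text \<open>
  Let \<open>P\<close> be the completion of a totally bounded, locally compact metric space \<open>X\<close>.  It is compact
  and contains \<open>X\<close> as a dense open set; put \<open>\<partial>X = P - X\<close>.  A subset of \<open>X \<times> X\<close> is controlled iff its
  points \<open>(x, y)\<close> get close to each other as \<open>x\<close> or \<open>y\<close> approaches \<open>\<partial>X\<close>, and a set is bounded iff it
  stays away from \<open>\<partial>X\<close>.  Testing on countable controlled sets \<open>{(x\<^sub>n, y\<^sub>n)}\<close> with \<open>d(x\<^sub>n, y\<^sub>n) \<rightarrow> 0\<close>
  shows that Higson functions and coarse maps are Cauchy near \<open>\<partial>X\<close>, so they have uniform limits on
  \<open>\<partial>X\<close>.  Hence \<open>C\<^sub>h(X) = C(P)\<close>, which identifies \<open>hX\<close> with \<open>P\<close> and \<open>\<nu>X\<close> with \<open>\<partial>X\<close>, and \<open>\<nu>f\<close> is the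
  limit of \<open>f\<close> on \<open>\<partial>X\<close>.  Two coarse maps are close iff their limits agree, so \<open>\<nu>\<close> is faithful.
  It is full: given \<open>g : \<partial>X \<rightarrow> \<partial>Y\<close>, send \<open>x\<close> to a point of \<open>Y\<close> near \<open>g(p)\<close>, where \<open>p \<in> \<partial>X\<close> is close to
  \<open>x\<close>, chosen in a finite net of \<open>Y\<close> whose mesh shrinks with the distance of \<open>x\<close> from \<open>\<partial>X\<close>.  A compact
  metric space \<open>T\<close> is the corona of a countable discrete subset of \<open>T \<times> (0, 1]\<close> that accumulates
  exactly at \<open>T \<times> {0}\<close>.
\<close>

section \<open>Fully faithful and essentially surjective functors\<close>

text \<open>Coarse maps and the functions in \<open>Bh X\<close> need not be continuous, so what
  happens inside \<open>X\<close> carries no information; only values near the boundary matter. The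
  two halves of coarseness are the two directions of one dictionary: properness says that
  \<open>f x\<close> is near the boundary of \<open>Y\<close> when \<open>x\<close> is near that of
  \<open>X\<close>, and bornologous maps satisfy the converse. Both are needed, because controlled
  sets and closeness in \<open>Y\<close> constrain pairs according to the position of
  \<open>f x\<close>, whereas a limit constrains them according to the position of \<open>x\<close>.
  A second obstacle is that \<nu>f is reached through four definite descriptions:
  \<open>corona_function\<close>, \<open>corona_hom\<close>, \<open>corona_map\<close> and the arrow
  part of the functor. Each needs existence and uniqueness. Tietze extension from the boundary
  supplies continuous representatives and enough functions on the corona, and the coordinates of hX
  separate its points.\<close>

lemma category_ident: "category C \<Longrightarrow> X \<in> ob C \<Longrightarrow> ident C X \<in> hom C X X"
  unfolding category_def by blast

lemma category_cmp:
  "category C \<Longrightarrow> X \<in> ob C \<Longrightarrow> Y \<in> ob C \<Longrightarrow> Z \<in> ob C \<Longrightarrow> f \<in> hom C X Y \<Longrightarrow> g \<in> hom C Y Z \<Longrightarrow>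
    cmp C X Y Z g f \<in> hom C X Z"
  unfolding category_def by blast

lemma category_ident_right:
  "category C \<Longrightarrow> X \<in> ob C \<Longrightarrow> Y \<in> ob C \<Longrightarrow> f \<in> hom C X Y \<Longrightarrow> cmp C X X Y f (ident C X) = f"
  unfolding category_def by blast

lemma category_ident_left:
  "category C \<Longrightarrow> X \<in> ob C \<Longrightarrow> Y \<in> ob C \<Longrightarrow> f \<in> hom C X Y \<Longrightarrow> cmp C X Y Y (ident C Y) f = f"
  unfolding category_def by blast

lemma category_assoc:
  "category C \<Longrightarrow> W \<in> ob C \<Longrightarrow> X \<in> ob C \<Longrightarrow> Y \<in> ob C \<Longrightarrow> Z \<in> ob C \<Longrightarrow>
    f \<in> hom C W X \<Longrightarrow> g \<in> hom C X Y \<Longrightarrow> h \<in> hom C Y Z \<Longrightarrow>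
    cmp C W X Z (cmp C X Y Z h g) f = cmp C W Y Z h (cmp C W X Y g f)"
  unfolding category_def by metis

text \<open>A quasi-inverse chooses an object \<open>S T\<close> with an isomorphism
  \<open>e T\<close> onto \<open>T\<close>, conjugates morphisms by these isomorphisms and takes
  preimages under \<open>F\<close>. By faithfulness every identity in \<open>C\<close> may be
  checked after applying \<open>F\<close>, where it reduces to cancelling \<open>e\<close> against
  \<open>e'\<close>.\<close>

lemma equivalence_of_categoriesI:
  assumes F: "is_functor C D F"
    and full: "\<And>X Y g. X \<in> ob C \<Longrightarrow> Y \<in> ob C \<Longrightarrow> g \<in> hom D (on_ob F X) (on_ob F Y) \<Longrightarrow>
      \<exists>f\<in>hom C X Y. on_hom F X Y f = g"
    and faithful: "\<And>X Y f g. X \<in> ob C \<Longrightarrow> Y \<in> ob C \<Longrightarrow> f \<in> hom C X Y \<Longrightarrow> g \<in> hom C X Y \<Longrightarrow>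
      on_hom F X Y f = on_hom F X Y g \<Longrightarrow> f = g"
    and ess_surj: "\<And>T. T \<in> ob D \<Longrightarrow> \<exists>X\<in>ob C. \<exists>e. is_iso D (on_ob F X) T e"
  shows "equivalence_of_categories C D F"
proof -
  have cC: "category C" and cD: "category D"
    and Fob [simp]: "\<And>X. X \<in> ob C \<Longrightarrow> on_ob F X \<in> ob D"
    and Fhom [simp]: "\<And>X Y f. X \<in> ob C \<Longrightarrow> Y \<in> ob C \<Longrightarrow> f \<in> hom C X Y \<Longrightarrow>
      on_hom F X Y f \<in> hom D (on_ob F X) (on_ob F Y)"
    and Fid [simp]: "\<And>X. X \<in> ob C \<Longrightarrow> on_hom F X X (ident C X) = ident D (on_ob F X)"
    and Fcmp [simp]: "\<And>X Y Z f g. X \<in> ob C \<Longrightarrow> Y \<in> ob C \<Longrightarrow> Z \<in> ob C \<Longrightarrow>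
      f \<in> hom C X Y \<Longrightarrow> g \<in> hom C Y Z \<Longrightarrow> on_hom F X Z (cmp C X Y Z g f) =
        cmp D (on_ob F X) (on_ob F Y) (on_ob F Z) (on_hom F Y Z g) (on_hom F X Y f)"
    using F unfolding is_functor_def by blast+
  note [simp] = category_ident[OF cC] category_ident[OF cD] category_cmp[OF cC] category_cmp[OF cD]
    category_ident_right[OF cC] category_ident_right[OF cD]
    category_ident_left[OF cC] category_ident_left[OF cD]
    category_assoc[OF cC] category_assoc[OF cD]
  have "\<forall>T\<in>ob D. \<exists>X e e'. X \<in> ob C \<and> e \<in> hom D (on_ob F X) T \<and> e' \<in> hom D T (on_ob F X) \<and>
      cmp D (on_ob F X) T (on_ob F X) e' e = ident D (on_ob F X) \<and>
      cmp D T (on_ob F X) T e e' = ident D T"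
    using ess_surj unfolding is_iso_def by meson
  then obtain S e e' where "\<forall>T\<in>ob D. S T \<in> ob C \<and> e T \<in> hom D (on_ob F (S T)) T \<and>
      e' T \<in> hom D T (on_ob F (S T)) \<and>
      cmp D (on_ob F (S T)) T (on_ob F (S T)) (e' T) (e T) = ident D (on_ob F (S T)) \<and>
      cmp D T (on_ob F (S T)) T (e T) (e' T) = ident D T"
    by metis
  then have S [simp]: "\<And>T. T \<in> ob D \<Longrightarrow> S T \<in> ob C"
    and e [simp]: "\<And>T. T \<in> ob D \<Longrightarrow> e T \<in> hom D (on_ob F (S T)) T"
    and e' [simp]: "\<And>T. T \<in> ob D \<Longrightarrow> e' T \<in> hom D T (on_ob F (S T))"
    and e'e [simp]: "\<And>T. T \<in> ob D \<Longrightarrow>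
      cmp D (on_ob F (S T)) T (on_ob F (S T)) (e' T) (e T) = ident D (on_ob F (S T))"
    and ee' [simp]: "\<And>T. T \<in> ob D \<Longrightarrow> cmp D T (on_ob F (S T)) T (e T) (e' T) = ident D T"
    by blast+
  \<comment> \<open>Associativity is oriented to the right, which hides the composite of
    \<open>e T\<close> and \<open>e' T\<close> in longer chains; this is the cancellation rule for
    the nested form.\<close>
  have ee'_cancel [simp]: "cmp D U (on_ob F (S T)) T (e T) (cmp D U T (on_ob F (S T)) (e' T) h) = h"
    if "T \<in> ob D" "U \<in> ob D" "h \<in> hom D U T" for T U h
    using that category_assoc[OF cD, of U T "on_ob F (S T)" T h "e' T" "e T"] by simp
  define pre where "pre X Y g = (SOME f. f \<in> hom C X Y \<and> on_hom F X Y f = g)" for X Y g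
  have pre: "pre X Y g \<in> hom C X Y \<and> on_hom F X Y (pre X Y g) = g"
    if "X \<in> ob C" "Y \<in> ob C" "g \<in> hom D (on_ob F X) (on_ob F Y)" for X Y g
    unfolding pre_def by (rule someI_ex) (use full[OF that] in blast)
  then have pre_hom [simp]: "\<And>X Y g. X \<in> ob C \<Longrightarrow> Y \<in> ob C \<Longrightarrow>
      g \<in> hom D (on_ob F X) (on_ob F Y) \<Longrightarrow> pre X Y g \<in> hom C X Y"
    and F_pre [simp]: "\<And>X Y g. X \<in> ob C \<Longrightarrow> Y \<in> ob C \<Longrightarrow>
      g \<in> hom D (on_ob F X) (on_ob F Y) \<Longrightarrow> on_hom F X Y (pre X Y g) = g"
    by blast+
  define G where "G = \<lparr>on_ob = S, on_hom = (\<lambda>T U k. pre (S T) (S U)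
    (cmp D (on_ob F (S T)) U (on_ob F (S U)) (e' U) (cmp D (on_ob F (S T)) T U k (e T))))\<rparr>"
  have G_ob [simp]: "on_ob G = S"
    and G_hom [simp]: "on_hom G T U k = pre (S T) (S U)
      (cmp D (on_ob F (S T)) U (on_ob F (S U)) (e' U) (cmp D (on_ob F (S T)) T U k (e T)))" for T U k
    by (simp_all add: G_def)
  have "is_functor D C G"
    unfolding is_functor_def
  proof (intro conjI ballI cC cD)
    show "on_hom G T T (ident D T) = ident C (on_ob G T)" if "T \<in> ob D" for T
      by (rule faithful[of "S T" "S T"]) (use that in simp_all)
    show "on_hom G T V (cmp D T U V l k) =
        cmp C (on_ob G T) (on_ob G U) (on_ob G V) (on_hom G U V l) (on_hom G T U k)"
      if "T \<in> ob D" "U \<in> ob D" "V \<in> ob D" "k \<in> hom D T U" "l \<in> hom D U V" for T U V k l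
      by (rule faithful[of "S T" "S V"]) (use that in simp_all)
  qed simp_all
  moreover have "natural_iso C C id_functor (comp_functor G F)
      (\<lambda>X. pre X (S (on_ob F X)) (e' (on_ob F X)))"
    unfolding natural_iso_def
  proof (intro conjI ballI)
    show "is_iso C (on_ob id_functor X) (on_ob (comp_functor G F) X)
        (pre X (S (on_ob F X)) (e' (on_ob F X)))" if "X \<in> ob C" for X
    proof -
      let ?Y = "S (on_ob F X)"
      let ?u = "pre X ?Y (e' (on_ob F X))" and ?v = "pre ?Y X (e (on_ob F X))"
      have "cmp C X ?Y X ?v ?u = ident C X"
        by (rule faithful[of X X]) (use that in simp_all)
      moreover have "cmp C ?Y X ?Y ?u ?v = ident C ?Y"
        by (rule faithful[of ?Y ?Y]) (use that in simp_all)
      moreover have "?u \<in> hom C X ?Y" "?v \<in> hom C ?Y X"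
        using that by simp_all
      ultimately show ?thesis
        unfolding is_iso_def id_functor_def comp_functor_def by auto
    qed
    show "cmp C (on_ob id_functor X) (on_ob id_functor Y) (on_ob (comp_functor G F) Y)
         (pre Y (S (on_ob F Y)) (e' (on_ob F Y))) (on_hom id_functor X Y f) =
        cmp C (on_ob id_functor X) (on_ob (comp_functor G F) X) (on_ob (comp_functor G F) Y)
         (on_hom (comp_functor G F) X Y f) (pre X (S (on_ob F X)) (e' (on_ob F X)))"
      if "X \<in> ob C" "Y \<in> ob C" "f \<in> hom C X Y" for X Y f
      by (rule faithful[of X "S (on_ob F Y)"])
        (use that in \<open>simp_all add: id_functor_def comp_functor_def\<close>)
  qed
  moreover have "natural_iso D D (comp_functor F G) id_functor e"
    unfolding natural_iso_def
  proof (intro conjI ballI)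
    show "is_iso D (on_ob (comp_functor F G) T) (on_ob id_functor T) (e T)" if "T \<in> ob D" for T
      unfolding is_iso_def using that
      by (auto simp: id_functor_def comp_functor_def intro!: bexI[of _ "e' T"])
  qed (simp add: id_functor_def comp_functor_def)
  ultimately show ?thesis
    unfolding equivalence_of_categories_def using F by blast
qed

section \<open>Metric compactifications\<close>

lemma mtriangle_le:
  "x \<in> mspace m \<Longrightarrow> y \<in> mspace m \<Longrightarrow> z \<in> mspace m \<Longrightarrow> mdist m x z \<le> mdist m x y + mdist m z y"
  by (metis mdist_commute mdist_triangle)

text \<open>Transport of a metric along an injective \<open>h\<close>. It puts a metric on hX and
  moves spaces built elsewhere into the universe \<open>'a\<close>.\<close>

definition image_metric :: "'a metric \<Rightarrow> ('a \<Rightarrow> 'b) \<Rightarrow> 'b metric" where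
  "image_metric m h = metric (h ` mspace m,
    \<lambda>u v. mdist m (inv_into (mspace m) h u) (inv_into (mspace m) h v))"

lemma
  assumes "inj_on h (mspace m)"
  shows mspace_image_metric: "mspace (image_metric m h) = h ` mspace m"
    and mdist_image_metric: "p \<in> mspace m \<Longrightarrow> q \<in> mspace m \<Longrightarrow>
      mdist (image_metric m h) (h p) (h q) = mdist m p q"
proof -
  let ?i = "inv_into (mspace m) h"
  interpret Metric_space "h ` mspace m" "\<lambda>u v. mdist m (?i u) (?i v)"
  proof
    show "mdist m (?i u) (?i w) \<le> mdist m (?i u) (?i v) + mdist m (?i v) (?i w)"
      if "u \<in> h ` mspace m" "v \<in> h ` mspace m" "w \<in> h ` mspace m" for u v w
      using that by (intro mdist_triangle inv_into_into)
  qed (use assms in \<open>auto simp: mdist_commute\<close>)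
  show "mspace (image_metric m h) = h ` mspace m"
    by (simp add: image_metric_def)
  show "mdist (image_metric m h) (h p) (h q) = mdist m p q" if "p \<in> mspace m" "q \<in> mspace m"
    using that assms by (simp add: image_metric_def)
qed

text \<open>The completion is used only through these properties, so the same interface serves
  spaces built by hand. Total boundedness and local compactness of \<open>X\<close> are consequences
  (\<open>totally_bounded\<close>, \<open>locally_compact\<close>).\<close>

locale metric_compactification =
  fixes X :: "'a metric" and P :: "'b metric" and \<iota> :: "'a \<Rightarrow> 'b"
  assumes emb: "x \<in> mspace X \<Longrightarrow> \<iota> x \<in> mspace P"
    and isometric: "x \<in> mspace X \<Longrightarrow> y \<in> mspace X \<Longrightarrow> mdist P (\<iota> x) (\<iota> y) = mdist X x y"
    and compact: "compact_space (mtopology_of P)"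
    and dense: "p \<in> mspace P \<Longrightarrow> \<epsilon> > 0 \<Longrightarrow> \<exists>x\<in>mspace X. mdist P (\<iota> x) p < \<epsilon>"
    and open_image: "openin (mtopology_of P) (\<iota> ` mspace X)"
begin

section \<open>Nearness to the boundary, compact sets and controlled sets\<close>

definition bd :: "'b set" where
  "bd = mspace P - \<iota> ` mspace X"

text \<open>The existential form avoids the distance to a possibly empty set: no point is near when
  \<open>bd\<close> is empty, that is, when \<open>X\<close> is compact.\<close>

definition near :: "real \<Rightarrow> 'a \<Rightarrow> bool" where
  "near \<delta> x \<longleftrightarrow> (\<exists>p\<in>bd. mdist P (\<iota> x) p < \<delta>)"

lemma bd_mspace: "p \<in> bd \<Longrightarrow> p \<in> mspace P"
  by (simp add: bd_def)

lemma nearI: "p \<in> bd \<Longrightarrow> mdist P (\<iota> x) p < \<delta> \<Longrightarrow> near \<delta> x"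
  by (auto simp: near_def)

lemma near_mono: "near \<delta> x \<Longrightarrow> \<delta> \<le> \<delta>' \<Longrightarrow> near \<delta>' x"
  unfolding near_def by force

lemma near_dist:
  assumes "near \<delta> x" "x \<in> mspace X" "y \<in> mspace X" "mdist X x y < \<epsilon>"
  shows "near (\<delta> + \<epsilon>) y"
proof -
  obtain p where p: "p \<in> bd" "mdist P (\<iota> x) p < \<delta>"
    using assms(1) by (auto simp: near_def)
  have "mdist P (\<iota> y) p \<le> mdist P (\<iota> y) (\<iota> x) + mdist P (\<iota> x) p"
    using assms p by (intro mdist_triangle) (auto intro: emb bd_mspace)
  then show ?thesis
    using assms p by (intro nearI[of p]) (auto simp: isometric mdist_commute)
qed

lemma closedin_bd: "closedin (mtopology_of P) bd"
  unfolding bd_def using open_image by (metis closedin_def Diff_Diff_Int Diff_subset inf.absorb2 openin_subset topspace_mtopology_of)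

lemma embedding_map_iota: "embedding_map (mtopology_of X) (mtopology_of P) \<iota>"
proof -
  interpret Metric_space12 "mspace X" "mdist X" "mspace P" "mdist P"
    by (rule Metric_space12_mspace_mdist)
  show ?thesis
    unfolding mtopology_of_def
    by (rule isometry_imp_embedding_map) (auto simp: emb isometric)
qed

lemma continuous_map_iota: "continuous_map (mtopology_of X) (mtopology_of P) \<iota>"
  using embedding_map_iota unfolding embedding_map_def
  using continuous_map_in_subtopology homeomorphic_imp_continuous_map by blast

lemma compactin_image_iff:
  assumes "K \<subseteq> mspace X"
  shows "compactin (mtopology_of X) K \<longleftrightarrow> compactin (mtopology_of P) (\<iota> ` K)"
proof -
  have "compactin (mtopology_of X) K \<longleftrightarrow>
      compactin (subtopology (mtopology_of P) (\<iota> ` topspace (mtopology_of X))) (\<iota> ` K)"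
    using homeomorphic_map_compactness_eq[OF embedding_map_iota[unfolded embedding_map_def]] assms
      homeomorphic_map_compactness[OF embedding_map_iota[unfolded embedding_map_def], of K]
    by auto
  then show ?thesis
    using assms by (auto simp: compactin_subtopology)
qed

text \<open>The image of \<open>K\<close> is compact inside the open image of \<open>X\<close>; a
  Lebesgue number for the cover by this single set keeps balls around the image off
  \<open>bd\<close>.\<close>

lemma compactin_imp_far:
  assumes "compactin (mtopology_of X) K"
  shows "\<exists>\<delta>>0. \<forall>x\<in>K. \<not> near \<delta> x"
proof -
  interpret P: Metric_space "mspace P" "mdist P" by simp
  have K: "K \<subseteq> mspace X"
    using assms compactin_subset_topspace by fastforce
  have "compactin P.mtopology (\<iota> ` K)"
    using assms K compactin_image_iff by (simp add: mtopology_of_def)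
  then obtain \<delta> where \<delta>: "\<delta> > 0" "\<And>x. x \<in> K \<Longrightarrow> P.mball (\<iota> x) \<delta> \<subseteq> \<iota> ` mspace X"
    using P.lebesgue_number[of "\<iota> ` K" "{\<iota> ` mspace X}"] image_mono[OF K, of \<iota>] open_image
    unfolding mtopology_of_def by auto
  have "\<not> near \<delta> x" if "x \<in> K" for x
    using \<delta>(2)[OF that] that K emb by (force simp: near_def bd_def)
  then show ?thesis using \<delta>(1) by blast
qed

text \<open>Removing the open \<open>\<delta>\<close>-balls around \<open>bd\<close> from the
  compact space \<open>P\<close> leaves a closed, hence compact, set. By
  \<open>compactin_imp_far\<close> these sets are cofinal among the compact subsets of
  \<open>X\<close>, so a number \<open>\<delta>\<close> can replace the compact set in the
  conditions that define the \<open>C0\<close> structure.\<close>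

lemma compactin_far:
  assumes "\<delta> > 0"
  shows "compactin (mtopology_of X) {x \<in> mspace X. \<not> near \<delta> x}"
proof -
  interpret P: Metric_space "mspace P" "mdist P" by simp
  have "closedin P.mtopology (mspace P - (\<Union>p\<in>bd. P.mball p \<delta>))"
    by (intro closedin_diff P.closedin_mspace openin_Union) auto
  then have "compactin (mtopology_of P) (mspace P - (\<Union>p\<in>bd. P.mball p \<delta>))"
    using compact by (simp add: mtopology_of_def closedin_compact_space)
  moreover have "mspace P - (\<Union>p\<in>bd. P.mball p \<delta>) = \<iota> ` {x \<in> mspace X. \<not> near \<delta> x}"
  proof (intro equalityI subsetI)
    fix q assume q: "q \<in> mspace P - (\<Union>p\<in>bd. P.mball p \<delta>)"
    then have far: "\<not> mdist P q p < \<delta>" if "p \<in> bd" for p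
      using that bd_mspace by (auto simp: mdist_commute)
    then have "q \<notin> bd"
      using q assms by fastforce
    then show "q \<in> \<iota> ` {x \<in> mspace X. \<not> near \<delta> x}"
      using q far by (auto simp: bd_def near_def)
  next
    fix q assume "q \<in> \<iota> ` {x \<in> mspace X. \<not> near \<delta> x}"
    then obtain x where "q = \<iota> x" "x \<in> mspace X" "\<not> near \<delta> x" by blast
    then show "q \<in> mspace P - (\<Union>p\<in>bd. P.mball p \<delta>)"
      using emb by (auto simp: near_def mdist_commute)
  qed
  ultimately show ?thesis
    by (subst compactin_image_iff) auto
qed

lemma C0_coarse_iff_near:
  "E \<in> C0_coarse X \<longleftrightarrow> E \<subseteq> mspace X \<times> mspace X \<and>
    (\<forall>\<epsilon>>0. \<exists>\<delta>>0. \<forall>x y. (x, y) \<in> E \<longrightarrow> near \<delta> x \<or> near \<delta> y \<longrightarrow> mdist X x y < \<epsilon>)"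
    (is "_ \<longleftrightarrow> _ \<and> ?R")
proof -
  have "(\<forall>\<epsilon>>0. \<exists>K. compactin (mtopology_of X) K \<and>
      (\<forall>x y. (x, y) \<in> E \<longrightarrow> (x, y) \<notin> K \<times> K \<longrightarrow> mdist X x y < \<epsilon>)) \<longleftrightarrow> ?R"
    if E: "E \<subseteq> mspace X \<times> mspace X"
  proof (intro iffI allI impI)
    fix \<epsilon> :: real
    assume "\<forall>\<epsilon>>0. \<exists>K. compactin (mtopology_of X) K \<and>
      (\<forall>x y. (x, y) \<in> E \<longrightarrow> (x, y) \<notin> K \<times> K \<longrightarrow> mdist X x y < \<epsilon>)" and "\<epsilon> > 0"
    then obtain K where K: "compactin (mtopology_of X) K"
      "\<And>x y. (x, y) \<in> E \<Longrightarrow> (x, y) \<notin> K \<times> K \<Longrightarrow> mdist X x y < \<epsilon>"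
      by blast
    with compactin_imp_far[OF K(1)]
    show "\<exists>\<delta>>0. \<forall>x y. (x, y) \<in> E \<longrightarrow> near \<delta> x \<or> near \<delta> y \<longrightarrow> mdist X x y < \<epsilon>"
      by (metis mem_Sigma_iff)
  next
    fix \<epsilon> :: real
    assume ?R and "\<epsilon> > 0"
    then obtain \<delta> where \<delta>: "\<delta> > 0"
      "\<And>x y. (x, y) \<in> E \<Longrightarrow> near \<delta> x \<or> near \<delta> y \<Longrightarrow> mdist X x y < \<epsilon>"
      by blast
    show "\<exists>K. compactin (mtopology_of X) K \<and>
      (\<forall>x y. (x, y) \<in> E \<longrightarrow> (x, y) \<notin> K \<times> K \<longrightarrow> mdist X x y < \<epsilon>)"
    proof (intro exI conjI allI impI)
      show "compactin (mtopology_of X) {x \<in> mspace X. \<not> near \<delta> x}"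
        by (rule compactin_far[OF \<delta>(1)])
      show "mdist X x y < \<epsilon>"
        if "(x, y) \<in> E" "(x, y) \<notin> {x \<in> mspace X. \<not> near \<delta> x} \<times> {x \<in> mspace X. \<not> near \<delta> x}" for x y
        using that E \<delta>(2) by auto
    qed
  qed
  then show ?thesis
    unfolding C0_coarse_iff by blast
qed

lemma coarse_bounded_iff_far:
  "coarse_bounded (C0_coarse X) B \<longleftrightarrow> B \<subseteq> mspace X \<and> (\<exists>\<delta>>0. \<forall>x\<in>B. \<not> near \<delta> x)"
proof
  assume "coarse_bounded (C0_coarse X) B"
  then have sub: "B \<subseteq> mspace X"
    and B: "\<And>\<epsilon>. \<epsilon> > 0 \<Longrightarrow> \<exists>\<delta>>0. \<forall>x\<in>B. \<forall>y\<in>B. near \<delta> x \<longrightarrow> mdist X x y < \<epsilon>"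
    unfolding coarse_bounded_def C0_coarse_iff_near by (auto, meson)
  have "\<exists>\<delta>>0. \<forall>x\<in>B. \<not> near \<delta> x"
  proof (rule ccontr)
    assume neg: "\<not> (\<exists>\<delta>>0. \<forall>x\<in>B. \<not> near \<delta> x)"
    then obtain a where a: "a \<in> B"
      using zero_less_one by blast
    \<comment> \<open>Points of \<open>B\<close> close enough to \<open>bd\<close> are within
      \<open>\<epsilon>/2\<close> of every point of \<open>B\<close>. So the fixed point
      \<open>a\<close> would itself be arbitrarily near \<open>bd\<close>, against compactness of
      \<open>{a}\<close>.\<close>
    have "near \<epsilon> a" if "\<epsilon> > 0" for \<epsilon>
    proof -
      obtain \<delta> where \<delta>: "\<delta> > 0" "\<And>x y. x \<in> B \<Longrightarrow> y \<in> B \<Longrightarrow> near \<delta> x \<Longrightarrow> mdist X x y < \<epsilon>/2"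
        using B[OF half_gt_zero[OF \<open>\<epsilon> > 0\<close>]] by blast
      then have "min \<delta> (\<epsilon>/2) > 0" using that by simp
      then obtain x where "x \<in> B" "near (min \<delta> (\<epsilon>/2)) x"
        using neg by blast
      then show ?thesis
        using near_dist[of "\<epsilon>/2" x a "\<epsilon>/2"] \<delta>(2)[of x a] near_mono sub a
        by (metis field_sum_of_halves min.cobounded1 min.cobounded2 subsetD)
    qed
    moreover have "compactin (mtopology_of X) {a}"
      using a sub by (intro finite_imp_compactin) auto
    ultimately show False
      using compactin_imp_far by blast
  qed
  with sub show "B \<subseteq> mspace X \<and> (\<exists>\<delta>>0. \<forall>x\<in>B. \<not> near \<delta> x)" by blast
next
  assume "B \<subseteq> mspace X \<and> (\<exists>\<delta>>0. \<forall>x\<in>B. \<not> near \<delta> x)"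
  then show "coarse_bounded (C0_coarse X) B"
    unfolding coarse_bounded_def C0_coarse_iff_near by auto
qed

text \<open>For each \<open>\<epsilon>\<close> only finitely many pairs have distance at least
  \<open>\<epsilon>\<close>, and their points form a compact set.\<close>

lemma controlled_sequence:
  assumes "\<And>n::nat. x n \<in> mspace X" "\<And>n. y n \<in> mspace X" "\<And>n. mdist X (x n) (y n) < inverse (Suc n)"
  shows "range (\<lambda>n. (x n, y n)) \<in> C0_coarse X"
  unfolding C0_coarse_iff
proof (intro conjI allI impI)
  fix \<epsilon> :: real assume "\<epsilon> > 0"
  then obtain N where N: "inverse (Suc N) < \<epsilon>"
    using reals_Archimedean by blast
  have "compactin (mtopology_of X) (x ` {..N} \<union> y ` {..N})"
    using assms by (intro finite_imp_compactin) auto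
  moreover have "mdist X u v < \<epsilon>" if uv: "(u, v) \<in> range (\<lambda>n. (x n, y n))"
      "(u, v) \<notin> (x ` {..N} \<union> y ` {..N}) \<times> (x ` {..N} \<union> y ` {..N})" for u v
  proof -
    obtain n where n: "u = x n" "v = y n" using uv by auto
    have "n > N"
    proof (rule ccontr)
      assume "\<not> n > N"
      then have "n \<in> {..N}" by simp
      then show False using uv(2) n by blast
    qed
    then have "inverse (real (Suc n)) \<le> inverse (Suc N)" by (simp add: field_simps)
    then show ?thesis unfolding n using N assms(3)[of n] by linarith
  qed
  ultimately show "\<exists>K. compactin (mtopology_of X) K \<and> (\<forall>u v. (u, v) \<in> range (\<lambda>n. (x n, y n)) \<longrightarrow>
      (u, v) \<notin> K \<times> K \<longrightarrow> mdist X u v < \<epsilon>)"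
    by blast
qed (use assms in auto)

section \<open>Uniform limits at the boundary\<close>

definition boundary_limit :: "'c metric \<Rightarrow> ('a \<Rightarrow> 'c) \<Rightarrow> ('b \<Rightarrow> 'c) \<Rightarrow> bool" where
  "boundary_limit Q f g \<longleftrightarrow> (\<forall>\<epsilon>>0. \<exists>\<delta>>0. \<forall>x\<in>mspace X. \<forall>p\<in>bd.
    mdist P (\<iota> x) p < \<delta> \<longrightarrow> mdist Q (f x) (g p) < \<epsilon>)"

lemma boundary_limitD:
  assumes "boundary_limit Q f g" "\<epsilon> > 0"
  obtains \<delta> where "\<delta> > 0" "\<And>x p. x \<in> mspace X \<Longrightarrow> p \<in> bd \<Longrightarrow> mdist P (\<iota> x) p < \<delta> \<Longrightarrow> mdist Q (f x) (g p) < \<epsilon>"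
  using assms unfolding boundary_limit_def by meson

lemma boundary_limit_cong:
  assumes "boundary_limit Q f g" "\<And>x. x \<in> mspace X \<Longrightarrow> f' x = f x" "\<And>p. p \<in> bd \<Longrightarrow> g' p = g p"
  shows "boundary_limit Q f' g'"
  using assms unfolding boundary_limit_def by simp

text \<open>Each boundary point \<open>p\<close> is approached by a sequence \<open>s p\<close>, and
  completeness of \<open>Q\<close> gives \<open>g p\<close> as the limit of \<open>f\<close> along
  it. One \<open>\<delta>\<close> serves the whole boundary, which makes the limit uniform in
  \<open>p\<close>.\<close>

lemma boundary_limit_exists:
  assumes Q: "mcomplete_of Q" and f: "f \<in> mspace X \<rightarrow> mspace Q"
    and Cauchy: "\<And>\<epsilon>. \<epsilon> > 0 \<Longrightarrow> \<exists>\<delta>>0. \<forall>x\<in>mspace X. \<forall>y\<in>mspace X.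
      near \<delta> x \<longrightarrow> near \<delta> y \<longrightarrow> mdist X x y < \<delta> \<longrightarrow> mdist Q (f x) (f y) < \<epsilon>"
  shows "\<exists>g \<in> bd \<rightarrow> mspace Q. boundary_limit Q f g"
proof -
  interpret Q: Metric_space "mspace Q" "mdist Q" by simp
  have "\<forall>p\<in>bd. \<forall>n. \<exists>x. x \<in> mspace X \<and> mdist P (\<iota> x) p < inverse (Suc n)"
    using dense bd_mspace by (metis inverse_Suc)
  then obtain s where s: "\<And>p n. p \<in> bd \<Longrightarrow> s p n \<in> mspace X"
    "\<And>p n. p \<in> bd \<Longrightarrow> mdist P (\<iota> (s p n)) p < inverse (Suc n)"
    by metis
  \<comment> \<open>Two points within \<open>\<delta>/2\<close> of the same \<open>p\<close> are
    \<open>\<delta>\<close>-close to each other. This lets the Cauchy condition compare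
    \<open>s p m\<close> both with later terms of the sequence and with an arbitrary
    \<open>x\<close> close to \<open>p\<close>.\<close>
  have close: "mdist X (s p m) x < \<delta>" if p: "p \<in> bd" and x: "x \<in> mspace X" "mdist P (\<iota> x) p < \<delta>/2"
    and m: "inverse (Suc m) < \<delta>/2" for p x m \<delta>
  proof -
    have "mdist P (\<iota> (s p m)) (\<iota> x) \<le> mdist P (\<iota> (s p m)) p + mdist P (\<iota> x) p"
      using p s x by (intro mtriangle_le) (auto intro: emb bd_mspace)
    then show ?thesis
      using s(2)[OF p, of m] x m isometric[OF s(1)[OF p] x(1), of m] by linarith
  qed
  have near_s: "near \<delta> (s p m)" if "p \<in> bd" "inverse (Suc m) < \<delta>/2" for p m \<delta>
  proof (rule nearI)
    show "mdist P (\<iota> (s p m)) p < \<delta>"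
      using s(2)[OF that(1), of m] that(2) mdist_nonneg[of P "\<iota> (s p m)" p] by linarith
  qed (rule that)
  have inv_mono: "inverse (real (Suc m)) < e" if "inverse (Suc N) < e" "m \<ge> N" for m N e
  proof -
    have "inverse (real (Suc m)) \<le> inverse (Suc N)" using that(2) by (simp add: field_simps)
    then show ?thesis using that(1) by linarith
  qed
  have "\<exists>l. limitin Q.mtopology (f \<circ> s p) l sequentially" if p: "p \<in> bd" for p
  proof -
    have "Q.MCauchy (f \<circ> s p)"
      unfolding Q.MCauchy_def
    proof (intro conjI allI impI)
      show "range (f \<circ> s p) \<subseteq> mspace Q" using f s p by auto
      fix \<epsilon> :: real assume "\<epsilon> > 0"
      then obtain \<delta> where \<delta>: "\<delta> > 0" "\<And>x y. x \<in> mspace X \<Longrightarrow> y \<in> mspace X \<Longrightarrow>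
          near \<delta> x \<Longrightarrow> near \<delta> y \<Longrightarrow> mdist X x y < \<delta> \<Longrightarrow> mdist Q (f x) (f y) < \<epsilon>"
        using Cauchy by meson
      then obtain N where N: "inverse (Suc N) < \<delta>/2"
        using reals_Archimedean[of "\<delta>/2"] by auto
      have "mdist Q (f (s p m)) (f (s p n)) < \<epsilon>" if "m \<ge> N" "n \<ge> N" for m n
        using inv_mono[OF N that(1)] inv_mono[OF N that(2)] s(1)[OF p]
          less_trans[OF s(2)[OF p, of n] inv_mono[OF N that(2)]]
        by (intro \<delta>(2) near_s close p) auto
      then show "\<exists>N. \<forall>n n'. N \<le> n \<longrightarrow> N \<le> n' \<longrightarrow> mdist Q ((f \<circ> s p) n) ((f \<circ> s p) n') < \<epsilon>"
        by (intro exI[of _ N]) simp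
    qed
    then show ?thesis
      using Q by (simp add: mcomplete_of_def Q.mcomplete_def)
  qed
  then obtain g where g: "\<And>p. p \<in> bd \<Longrightarrow> limitin Q.mtopology (f \<circ> s p) (g p) sequentially"
    by metis
  have gQ: "g p \<in> mspace Q" if "p \<in> bd" for p
    using g[OF that] by (simp add: Q.limitin_mspace)
  have "boundary_limit Q f g"
    unfolding boundary_limit_def
  proof (intro allI impI)
    fix \<epsilon> :: real assume "\<epsilon> > 0"
    then obtain \<delta> where \<delta>: "\<delta> > 0" "\<And>x y. x \<in> mspace X \<Longrightarrow> y \<in> mspace X \<Longrightarrow>
        near \<delta> x \<Longrightarrow> near \<delta> y \<Longrightarrow> mdist X x y < \<delta> \<Longrightarrow> mdist Q (f x) (f y) < \<epsilon>/2"
      using Cauchy[of "\<epsilon>/2"] by auto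
    then obtain N where N: "inverse (Suc N) < \<delta>/2"
      using reals_Archimedean[of "\<delta>/2"] by auto
    have "mdist Q (f x) (g p) < \<epsilon>" if x: "x \<in> mspace X" and p: "p \<in> bd" and d: "mdist P (\<iota> x) p < \<delta>/2" for x p
    proof -
      have "\<forall>\<^sub>F n in sequentially. (f \<circ> s p) n \<in> mspace Q \<and> mdist Q ((f \<circ> s p) n) (g p) < \<epsilon>/2"
        using g[OF p] half_gt_zero[OF \<open>\<epsilon> > 0\<close>] unfolding Q.limitin_metric by blast
      then obtain n0 where "\<And>n. n \<ge> n0 \<Longrightarrow> mdist Q (f (s p n)) (g p) < \<epsilon>/2"
        unfolding eventually_sequentially by auto
      then obtain n where n: "n \<ge> N" "mdist Q (f (s p n)) (g p) < \<epsilon>/2"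
        by (meson max.cobounded1 max.cobounded2)
      have "mdist Q (f (s p n)) (f x) < \<epsilon>/2"
      proof (intro \<delta>(2) near_s close)
        show "near \<delta> x"
          using d \<delta>(1) by (intro nearI[OF p]) linarith
      qed (use s(1)[OF p] x p d inv_mono[OF N n(1)] in auto)
      moreover have "mdist Q (f x) (g p) \<le> mdist Q (f x) (f (s p n)) + mdist Q (f (s p n)) (g p)"
        using f x s[OF p] gQ[OF p] by (intro mdist_triangle) auto
      ultimately show ?thesis
        using n(2) by (simp add: mdist_commute)
    qed
    then show "\<exists>\<delta>>0. \<forall>x\<in>mspace X. \<forall>p\<in>bd. mdist P (\<iota> x) p < \<delta> \<longrightarrow> mdist Q (f x) (g p) < \<epsilon>"
      using \<delta>(1) by (intro exI[of _ "\<delta>/2"]) auto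
  qed
  then show ?thesis using gQ by blast
qed

lemma boundary_limit_unique:
  assumes "boundary_limit Q f g" "boundary_limit Q f h"
    and "f \<in> mspace X \<rightarrow> mspace Q" "g \<in> bd \<rightarrow> mspace Q" "h \<in> bd \<rightarrow> mspace Q" and p: "p \<in> bd"
  shows "g p = h p"
proof (rule ccontr)
  assume "g p \<noteq> h p"
  moreover have in_Q: "g p \<in> mspace Q" "h p \<in> mspace Q" using assms by auto
  ultimately have pos: "mdist Q (g p) (h p) / 2 > 0"
    using mdist_nonneg[of Q "g p" "h p"] mdist_zero[of "g p" Q "h p"] by linarith
  obtain \<delta> where \<delta>: "\<delta> > 0" "\<And>x. x \<in> mspace X \<Longrightarrow> mdist P (\<iota> x) p < \<delta> \<Longrightarrow>
      mdist Q (f x) (g p) < mdist Q (g p) (h p) / 2"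
    using boundary_limitD[OF assms(1) pos] p by metis
  obtain \<delta>' where \<delta>': "\<delta>' > 0" "\<And>x. x \<in> mspace X \<Longrightarrow> mdist P (\<iota> x) p < \<delta>' \<Longrightarrow>
      mdist Q (f x) (h p) < mdist Q (g p) (h p) / 2"
    using boundary_limitD[OF assms(2) pos] p by metis
  obtain x where x: "x \<in> mspace X" "mdist P (\<iota> x) p < min \<delta> \<delta>'"
    using dense[OF bd_mspace[OF p], of "min \<delta> \<delta>'"] \<delta> \<delta>' by auto
  have "mdist Q (g p) (h p) \<le> mdist Q (f x) (g p) + mdist Q (f x) (h p)"
    using mdist_triangle[of "g p" Q "f x" "h p"] in_Q x assms by (auto simp: mdist_commute)
  then show False
    using \<delta>(2)[of x] \<delta>'(2)[of x] x by auto
qed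

text \<open>A discontinuous \<open>f\<close> still has a continuous limit: by density some
  \<open>x\<close> lies close to \<open>q\<close>, hence close to every boundary point near
  \<open>q\<close>, and the single value \<open>f x\<close> approximates \<open>g\<close> at all of
  them.\<close>

lemma boundary_limit_continuous:
  assumes lim: "boundary_limit Q f g" and f: "f \<in> mspace X \<rightarrow> mspace Q" and g: "g \<in> bd \<rightarrow> mspace Q"
  shows "uniformly_continuous_map (submetric P bd) Q g"
  unfolding uniformly_continuous_map_def
proof (intro conjI allI impI)
  show "g \<in> mspace (submetric P bd) \<rightarrow> mspace Q" using g by auto
  fix \<epsilon> :: real assume "\<epsilon> > 0"
  then obtain \<delta> where \<delta>: "\<delta> > 0" "\<And>x p. x \<in> mspace X \<Longrightarrow> p \<in> bd \<Longrightarrow> mdist P (\<iota> x) p < \<delta> \<Longrightarrow> mdist Q (f x) (g p) < \<epsilon>/2"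
    using boundary_limitD[OF lim, of "\<epsilon>/2"] by auto
  have "mdist Q (g q) (g p) < \<epsilon>" if p: "p \<in> bd" and q: "q \<in> bd" and d: "mdist P q p < \<delta>/2" for p q
  proof -
    obtain x where x: "x \<in> mspace X" "mdist P (\<iota> x) q < \<delta>/2"
      using dense[OF bd_mspace[OF q], of "\<delta>/2"] \<delta> by auto
    have "mdist P (\<iota> x) p \<le> mdist P (\<iota> x) q + mdist P q p"
      using p q x by (intro mdist_triangle) (auto intro: emb bd_mspace)
    then have "mdist P (\<iota> x) q < \<delta>" "mdist P (\<iota> x) p < \<delta>"
      using x(2) d \<delta>(1) by linarith+
    then have "mdist Q (f x) (g q) < \<epsilon>/2" "mdist Q (f x) (g p) < \<epsilon>/2"
      using x(1) p q \<delta>(2) by blast+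
    moreover have "mdist Q (g q) (g p) \<le> mdist Q (g q) (f x) + mdist Q (f x) (g p)"
      using p q x f g by (intro mdist_triangle) auto
    ultimately show ?thesis by (simp add: mdist_commute)
  qed
  then show "\<exists>\<delta>>0. \<forall>x\<in>mspace (submetric P bd). \<forall>y\<in>mspace (submetric P bd).
      mdist (submetric P bd) y x < \<delta> \<longrightarrow> mdist Q (g y) (g x) < \<epsilon>"
    using \<delta>(1) by (intro exI[of _ "\<delta>/2"]) auto
qed

lemma boundary_limit_restrict_continuous:
  assumes "uniformly_continuous_map P Q F"
  shows "boundary_limit Q (\<lambda>x. F (\<iota> x)) F"
  using assms unfolding boundary_limit_def uniformly_continuous_map_def
  by (metis bd_mspace emb)

text \<open>The hypothesis gives a separate \<open>\<delta>\<close> for each controlled set. If no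
  \<open>\<delta>\<close> worked for all close pairs, one violating pair for each
  \<open>inverse (Suc n)\<close> could be collected into one controlled set, which would violate the
  hypothesis. In the applications \<open>r x y\<close> is the distance between the values at
  \<open>x\<close> and \<open>y\<close> of a Higson function or of a coarse map.\<close>

lemma controlled_imp_uniform:
  fixes r :: "'a \<Rightarrow> 'a \<Rightarrow> real"
  assumes r: "\<And>E. E \<in> C0_coarse X \<Longrightarrow>
      \<exists>\<delta>>0. \<forall>x y. (x, y) \<in> E \<longrightarrow> near \<delta> x \<longrightarrow> near \<delta> y \<longrightarrow> r x y < \<epsilon>"
  shows "\<exists>\<delta>>0. \<forall>x\<in>mspace X. \<forall>y\<in>mspace X. near \<delta> x \<longrightarrow> near \<delta> y \<longrightarrow> mdist X x y < \<delta> \<longrightarrow> r x y < \<epsilon>"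
proof (rule ccontr)
  assume neg: "\<not> ?thesis"
  have "\<exists>x y. x \<in> mspace X \<and> y \<in> mspace X \<and> near (inverse (Suc n)) x \<and> near (inverse (Suc n)) y \<and>
      mdist X x y < inverse (Suc n) \<and> \<not> r x y < \<epsilon>" for n
  proof -
    have "inverse (real (Suc n)) > 0" by simp
    with neg show ?thesis by blast
  qed
  then obtain x y where xy: "\<And>n. x n \<in> mspace X" "\<And>n. y n \<in> mspace X"
    "\<And>n. near (inverse (Suc n)) (x n)" "\<And>n. near (inverse (Suc n)) (y n)"
    "\<And>n. mdist X (x n) (y n) < inverse (Suc n)" "\<And>n. \<not> r (x n) (y n) < \<epsilon>"
    by metis
  obtain \<delta> where \<delta>: "\<delta> > 0"
    "\<And>n. near \<delta> (x n) \<Longrightarrow> near \<delta> (y n) \<Longrightarrow> r (x n) (y n) < \<epsilon>"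
    using r[OF controlled_sequence[OF xy(1,2,5)]] by blast
  obtain n where "inverse (Suc n) < \<delta>"
    using reals_Archimedean[OF \<delta>(1)] by blast
  then show False
    using \<delta>(2)[of n] xy(3,4,6)[of n] near_mono less_imp_le by blast
qed

section \<open>Higson functions as bounded functions with a boundary limit\<close>

lemma boundary_limit_real_unique:
  assumes "boundary_limit euclidean_metric f (g :: 'b \<Rightarrow> real)" "boundary_limit euclidean_metric f h" "p \<in> bd"
  shows "g p = h p"
  using boundary_limit_unique[OF assms(1,2) _ _ _ assms(3)] by simp

text \<open>The bounded set \<open>B\<close> allowed as an exception stays away from
  \<open>bd\<close>, so pairs near \<open>bd\<close> lie outside \<open>B \<times> B\<close>. This
  is the Cauchy condition on each controlled set.\<close>

lemma Bh_imp_boundary_limit: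
  assumes "\<phi> \<in> Bh X"
  shows "\<exists>g. boundary_limit euclidean_metric \<phi> g"
proof -
  have "\<exists>\<delta>>0. \<forall>x\<in>mspace X. \<forall>y\<in>mspace X.
      near \<delta> x \<longrightarrow> near \<delta> y \<longrightarrow> mdist X x y < \<delta> \<longrightarrow> dist (\<phi> x) (\<phi> y) < \<epsilon>" if "\<epsilon> > 0" for \<epsilon>
  proof (rule controlled_imp_uniform)
    fix E assume "E \<in> C0_coarse X"
    then obtain B where B: "coarse_bounded (C0_coarse X) B" "\<And>x y. (x, y) \<in> E - B \<times> B \<Longrightarrow> \<bar>\<phi> x - \<phi> y\<bar> < \<epsilon>"
      using assms \<open>\<epsilon> > 0\<close> unfolding Bh_def higson_functions_def by fastforce
    then show "\<exists>\<delta>>0. \<forall>x y. (x, y) \<in> E \<longrightarrow> near \<delta> x \<longrightarrow> near \<delta> y \<longrightarrow> dist (\<phi> x) (\<phi> y) < \<epsilon>"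
      unfolding coarse_bounded_iff_far dist_real_def by (metis DiffI mem_Sigma_iff)
  qed
  moreover have "mcomplete_of (euclidean_metric :: real metric)"
    by (simp add: mcomplete_of_def complete_UNIV)
  ultimately show ?thesis
    using boundary_limit_exists[of euclidean_metric \<phi>] by auto
qed

lemma boundary_limit_controlled:
  assumes lim: "boundary_limit Q f g" and f: "f \<in> mspace X \<rightarrow> mspace Q" and g: "g \<in> bd \<rightarrow> mspace Q"
    and E: "E \<in> C0_coarse X" and "\<epsilon> > 0"
  shows "\<exists>\<delta>>0. \<forall>x y. (x, y) \<in> E \<longrightarrow> near \<delta> x \<or> near \<delta> y \<longrightarrow> mdist Q (f x) (f y) < \<epsilon>"
proof -
  obtain \<delta> where \<delta>: "\<delta> > 0" "\<And>x p. x \<in> mspace X \<Longrightarrow> p \<in> bd \<Longrightarrow> mdist P (\<iota> x) p < \<delta> \<Longrightarrow> mdist Q (f x) (g p) < \<epsilon>/2"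
    using boundary_limitD[OF lim, of "\<epsilon>/2"] \<open>\<epsilon> > 0\<close> by auto
  obtain \<delta>' where \<delta>': "\<delta>' > 0"
    "\<And>x y. (x, y) \<in> E \<Longrightarrow> near \<delta>' x \<or> near \<delta>' y \<Longrightarrow> mdist X x y < \<delta>/2"
    using E half_gt_zero[OF \<delta>(1)] unfolding C0_coarse_iff_near by meson
  \<comment> \<open>Only one entry of a pair is known to be near \<open>bd\<close>. The bound
    \<open>\<delta>'\<close> forces the entries within \<open>\<delta>/2\<close> of each other, and
    \<open>\<delta>/2\<close> leaves room for the other entry to be within \<open>\<delta>\<close>
    of the same boundary point.\<close>
  define \<eta> where "\<eta> = min \<delta>' (\<delta>/2)"
  have \<eta>: "\<eta> > 0" using \<delta>(1) \<delta>'(1) by (simp add: \<eta>_def)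
  have one: "mdist Q (f x) (f y) < \<epsilon>"
    if near_x: "near \<eta> x" and "mdist X x y < \<delta>/2" "x \<in> mspace X" "y \<in> mspace X" for x y
  proof -
    obtain p where p: "p \<in> bd" "mdist P (\<iota> x) p < \<eta>"
      using near_x by (auto simp: near_def)
    have "mdist P (\<iota> y) p \<le> mdist P (\<iota> y) (\<iota> x) + mdist P (\<iota> x) p"
      using p that by (intro mdist_triangle) (auto intro: emb bd_mspace)
    then have "mdist P (\<iota> y) p < \<delta>" "mdist P (\<iota> x) p < \<delta>"
      using that p \<delta>(1) by (auto simp: isometric mdist_commute \<eta>_def)
    then have "mdist Q (f x) (g p) < \<epsilon>/2" "mdist Q (f y) (g p) < \<epsilon>/2"
      using \<delta>(2) that p by blast+
    moreover have "mdist Q (f x) (f y) \<le> mdist Q (f x) (g p) + mdist Q (f y) (g p)"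
      using f g that p by (intro mtriangle_le) auto
    ultimately show ?thesis by linarith
  qed
  have "mdist Q (f x) (f y) < \<epsilon>" if "(x, y) \<in> E" "near \<eta> x \<or> near \<eta> y" for x y
  proof -
    have xy: "x \<in> mspace X" "y \<in> mspace X"
      using E that unfolding C0_coarse_iff by auto
    moreover have "mdist X x y < \<delta>/2"
      using \<delta>'(2)[OF that(1)] that(2) near_mono by (auto simp: \<eta>_def)
    ultimately show ?thesis
      using one[of x y] one[of y x] that(2) by (auto simp: mdist_commute)
  qed
  then show ?thesis using \<eta> by blast
qed

lemma Bh_iff_boundary_limit:
  "\<phi> \<in> Bh X \<longleftrightarrow> \<phi> \<in> extensional (mspace X) \<and> bounded (\<phi> ` mspace X) \<and>
    (\<exists>g. boundary_limit euclidean_metric \<phi> g)" (is "_ \<longleftrightarrow> ?R")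
proof
  assume "\<phi> \<in> Bh X"
  with Bh_imp_boundary_limit show ?R
    by (auto simp: Bh_def higson_functions_def)
next
  assume ?R
  then obtain g where g: "boundary_limit euclidean_metric \<phi> g" by blast
  have "\<exists>B. B \<subseteq> mspace X \<and> coarse_bounded (C0_coarse X) B \<and> (\<forall>(x, y) \<in> E - B \<times> B. \<bar>\<phi> x - \<phi> y\<bar> < \<epsilon>)"
    if E: "E \<in> C0_coarse X" and "\<epsilon> > 0" for E \<epsilon>
  proof -
    obtain \<eta> where \<eta>: "\<eta> > 0" "\<And>x y. (x, y) \<in> E \<Longrightarrow> near \<eta> x \<or> near \<eta> y \<Longrightarrow> \<bar>\<phi> x - \<phi> y\<bar> < \<epsilon>"
      using boundary_limit_controlled[OF g _ _ E \<open>\<epsilon> > 0\<close>] by (auto simp: dist_real_def)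
    moreover have "(x, y) \<in> E \<Longrightarrow> x \<in> mspace X \<and> y \<in> mspace X" for x y
      using E unfolding C0_coarse_iff by auto
    ultimately show ?thesis
      by (intro exI[of _ "{x \<in> mspace X. \<not> near \<eta> x}"]) (auto simp: coarse_bounded_iff_far)
  qed
  with \<open>?R\<close> show "\<phi> \<in> Bh X"
    unfolding Bh_def higson_functions_def by blast
qed

text \<open>This makes \<open>B0 X\<close> the kernel of the passage from Higson functions to their
  boundary limits.\<close>

lemma B0_iff_boundary_limit:
  "\<phi> \<in> B0 X \<longleftrightarrow> \<phi> \<in> extensional (mspace X) \<and> bounded (\<phi> ` mspace X) \<and>
    boundary_limit euclidean_metric \<phi> (\<lambda>_. 0)"
proof -
  have "(\<forall>\<epsilon>>0. \<exists>K. compactin (mtopology_of X) K \<and> (\<forall>x \<in> mspace X - K. \<bar>\<phi> x\<bar> < \<epsilon>)) \<longleftrightarrow>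
      boundary_limit euclidean_metric \<phi> (\<lambda>_. 0)"
  proof (intro iffI allI impI)
    assume L: "\<forall>\<epsilon>>0. \<exists>K. compactin (mtopology_of X) K \<and> (\<forall>x \<in> mspace X - K. \<bar>\<phi> x\<bar> < \<epsilon>)"
    show "boundary_limit euclidean_metric \<phi> (\<lambda>_. 0)"
      unfolding boundary_limit_def
    proof (intro allI impI)
      fix \<epsilon> :: real assume "\<epsilon> > 0"
      then obtain K where "compactin (mtopology_of X) K" and K: "\<And>x. x \<in> mspace X - K \<Longrightarrow> \<bar>\<phi> x\<bar> < \<epsilon>"
        using L by blast
      then obtain \<delta> where "\<delta> > 0" "\<forall>x\<in>K. \<not> near \<delta> x"
        using compactin_imp_far by blast
      then show "\<exists>\<delta>>0. \<forall>x\<in>mspace X. \<forall>p\<in>bd. mdist P (\<iota> x) p < \<delta> \<longrightarrow> mdist euclidean_metric (\<phi> x) 0 < \<epsilon>"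
        using K nearI by (intro exI[of _ \<delta>] conjI ballI impI) (auto, blast)
    qed
  next
    fix \<epsilon> :: real
    assume L: "boundary_limit euclidean_metric \<phi> (\<lambda>_. 0)" and "\<epsilon> > 0"
    then obtain \<delta> where \<delta>: "\<delta> > 0" "\<And>x p. x \<in> mspace X \<Longrightarrow> p \<in> bd \<Longrightarrow> mdist P (\<iota> x) p < \<delta> \<Longrightarrow> dist (\<phi> x) 0 < \<epsilon>"
      using boundary_limitD[OF L] by auto
    then show "\<exists>K. compactin (mtopology_of X) K \<and> (\<forall>x \<in> mspace X - K. \<bar>\<phi> x\<bar> < \<epsilon>)"
      using compactin_far[OF \<delta>(1)]
      by (intro exI[of _ "{x \<in> mspace X. \<not> near \<delta> x}"]) (auto simp: near_def)
  qed
  then show ?thesis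
    unfolding B0_def by blast
qed

section \<open>Continuous Higson functions as continuous functions on \<open>P\<close>\<close>

lemma continuous_map_P_uniform:
  "continuous_map (mtopology_of P) (mtopology_of Q) F \<Longrightarrow> uniformly_continuous_map P Q F"
  using compact continuous_imp_uniformly_continuous_map by blast

lemma bounded_image_P:
  "continuous_map (mtopology_of P) euclideanreal F \<Longrightarrow> bounded (F ` mspace P)"
  using image_compactin[of "mtopology_of P" "mspace P" euclideanreal F] compact
  by (simp add: compact_space_def compact_imp_bounded)

lemma restrict_in_Ch:
  assumes F: "continuous_map (mtopology_of P) euclideanreal F"
  shows "(\<lambda>x\<in>mspace X. F (\<iota> x)) \<in> Ch X"
    and "boundary_limit euclidean_metric (\<lambda>x\<in>mspace X. F (\<iota> x)) F"
proof -
  have "uniformly_continuous_map P euclidean_metric F"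
    by (rule continuous_map_P_uniform) (simp add: F)
  then have "boundary_limit euclidean_metric (\<lambda>x. F (\<iota> x)) F"
    by (rule boundary_limit_restrict_continuous)
  then show lim: "boundary_limit euclidean_metric (\<lambda>x\<in>mspace X. F (\<iota> x)) F"
    by (rule boundary_limit_cong) auto
  have "bounded ((\<lambda>x\<in>mspace X. F (\<iota> x)) ` mspace X)"
    using bounded_image_P[OF F] by (rule bounded_subset) (use emb in auto)
  moreover have "continuous_map (mtopology_of X) euclideanreal (\<lambda>x\<in>mspace X. F (\<iota> x))"
    by (rule continuous_map_eq[OF continuous_map_compose[OF continuous_map_iota F]]) auto
  ultimately show "(\<lambda>x\<in>mspace X. F (\<iota> x)) \<in> Ch X"
    unfolding Ch_def Bh_iff_boundary_limit using lim by auto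
qed

text \<open>Glue \<open>\<psi>\<close> to its boundary limit \<open>g\<close>. At a point of
  \<open>bd\<close>, arguments from \<open>X\<close> are handled by the limit and arguments from
  \<open>bd\<close> by continuity of \<open>g\<close>; at a point of \<open>X\<close>, openness of
  the image keeps nearby arguments inside \<open>X\<close>.\<close>

lemma Ch_extends:
  assumes "\<psi> \<in> Ch X"
  shows "\<exists>F. continuous_map (mtopology_of P) euclideanreal F \<and> (\<forall>x\<in>mspace X. F (\<iota> x) = \<psi> x)"
proof -
  interpret X: Metric_space "mspace X" "mdist X" by simp
  interpret P: Metric_space "mspace P" "mdist P" by simp
  obtain g where g: "boundary_limit euclidean_metric \<psi> g"
    using assms Bh_imp_boundary_limit by (auto simp: Ch_def)
  have inj: "inj_on \<iota> (mspace X)"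
    by (metis inj_onI isometric mdist_zero)
  define F where "F q = (if q \<in> bd then g q else \<psi> (inv_into (mspace X) \<iota> q))" for q
  have F_iota: "F (\<iota> x) = \<psi> x" if "x \<in> mspace X" for x
    using that inj by (simp add: F_def bd_def)
  have "\<exists>\<delta>>0. \<forall>q. q \<in> mspace P \<and> mdist P a q < \<delta> \<longrightarrow> dist (F a) (F q) < \<epsilon>"
    if a: "a \<in> mspace P" and "\<epsilon> > 0" for a \<epsilon>
  proof (cases "a \<in> bd")
    case True
    obtain \<delta>1 where \<delta>1: "\<delta>1 > 0" "\<And>x p. x \<in> mspace X \<Longrightarrow> p \<in> bd \<Longrightarrow> mdist P (\<iota> x) p < \<delta>1 \<Longrightarrow> dist (\<psi> x) (g p) < \<epsilon>"
      using boundary_limitD[OF g \<open>\<epsilon> > 0\<close>] by auto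
    obtain \<delta>2 where \<delta>2: "\<delta>2 > 0" "\<And>q. q \<in> bd \<Longrightarrow> mdist P a q < \<delta>2 \<Longrightarrow> dist (g a) (g q) < \<epsilon>"
      using boundary_limit_continuous[OF g] True \<open>\<epsilon> > 0\<close> bd_mspace
      unfolding uniformly_continuous_map_def by (fastforce simp: Int_absorb2)
    have "dist (F a) (F q) < \<epsilon>" if q: "q \<in> mspace P" "mdist P a q < min \<delta>1 \<delta>2" for q
    proof (cases "q \<in> bd")
      case True
      then show ?thesis using \<delta>2(2) q \<open>a \<in> bd\<close> by (simp add: F_def)
    next
      case False
      then obtain x where x: "x \<in> mspace X" "q = \<iota> x" using q by (auto simp: bd_def)
      then have "dist (\<psi> x) (g a) < \<epsilon>"
        using \<delta>1(2)[OF x(1) \<open>a \<in> bd\<close>] q by (simp add: mdist_commute)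
      then show ?thesis
        using F_iota[OF x(1)] x \<open>a \<in> bd\<close> by (simp add: F_def dist_commute)
    qed
    then show ?thesis using \<delta>1(1) \<delta>2(1) by (intro exI[of _ "min \<delta>1 \<delta>2"]) auto
  next
    case False
    then obtain x where x: "x \<in> mspace X" "a = \<iota> x" using a by (auto simp: bd_def)
    have "continuous_map X.mtopology Met_TC.mtopology \<psi>"
      using assms by (simp add: Ch_def mtopology_of_def)
    then obtain \<delta>1 where \<delta>1: "\<delta>1 > 0" "\<And>y. y \<in> mspace X \<Longrightarrow> mdist X x y < \<delta>1 \<Longrightarrow> dist (\<psi> x) (\<psi> y) < \<epsilon>"
      unfolding X.metric_continuous_map[OF Met_TC.Metric_space_axioms] using x \<open>\<epsilon> > 0\<close> by meson
    obtain \<delta>2 where \<delta>2: "\<delta>2 > 0" "P.mball a \<delta>2 \<subseteq> \<iota> ` mspace X"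
      using open_image x unfolding mtopology_of_def P.openin_mtopology by blast
    have "dist (F a) (F q) < \<epsilon>" if q: "q \<in> mspace P" "mdist P a q < min \<delta>1 \<delta>2" for q
    proof -
      have "q \<in> P.mball a \<delta>2" using q a by simp
      then obtain y where y: "y \<in> mspace X" "q = \<iota> y" using \<delta>2 by blast
      then have "mdist X x y < \<delta>1" using q x by (simp add: isometric)
      then show ?thesis
        using \<delta>1(2)[OF y(1)] x y F_iota by simp
    qed
    then show ?thesis using \<delta>1(1) \<delta>2(1) by (intro exI[of _ "min \<delta>1 \<delta>2"]) auto
  qed
  then have "continuous_map P.mtopology Met_TC.mtopology F"
    unfolding P.metric_continuous_map[OF Met_TC.Metric_space_axioms] by auto
  then show ?thesis
    using F_iota by (intro exI[of _ F]) (simp add: mtopology_of_def)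
qed

section \<open>Identification of the Higson compactification with \<open>P\<close>\<close>

lemma closure_of_image: "mtopology_of P closure_of (\<iota> ` mspace X) = mspace P"
proof -
  interpret P: Metric_space "mspace P" "mdist P" by simp
  show ?thesis
    unfolding mtopology_of_def P.metric_closure_of using dense emb
    by (auto simp: mdist_commute)
qed

text \<open>On \<open>mspace P\<close> the choice is forced because \<open>X\<close> is dense there;
  \<open>extension_restrict\<close> uses this.\<close>

definition extension :: "('a \<Rightarrow> real) \<Rightarrow> 'b \<Rightarrow> real" where
  "extension \<psi> = (SOME F. continuous_map (mtopology_of P) euclideanreal F \<and> (\<forall>x\<in>mspace X. F (\<iota> x) = \<psi> x))"

lemma extension:
  assumes "\<psi> \<in> Ch X"
  shows "continuous_map (mtopology_of P) euclideanreal (extension \<psi>)"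
    and "x \<in> mspace X \<Longrightarrow> extension \<psi> (\<iota> x) = \<psi> x"
  using someI_ex[OF Ch_extends[OF assms]] unfolding extension_def by blast+

lemma extension_restrict:
  assumes F: "continuous_map (mtopology_of P) euclideanreal F" and q: "q \<in> mspace P"
  shows "extension (\<lambda>x\<in>mspace X. F (\<iota> x)) q = F q"
  using forall_in_closure_of_eq[of q "mtopology_of P" "\<iota> ` mspace X" euclideanreal
      "extension (\<lambda>x\<in>mspace X. F (\<iota> x))" F]
    extension[OF restrict_in_Ch(1)[OF F]] F q closure_of_image by auto

definition to_higson :: "'b \<Rightarrow> ('a \<Rightarrow> real) \<Rightarrow> real" where
  "to_higson q = (\<lambda>\<psi>\<in>Ch X. extension \<psi> q)"

lemma to_higson_iota: "x \<in> mspace X \<Longrightarrow> to_higson (\<iota> x) = higson_embedding X x"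
  unfolding to_higson_def higson_embedding_def by (rule restrict_ext) (simp add: extension)

text \<open>A continuous injection of a compact space into a Hausdorff space is an embedding. The
  image is compact, hence closed, and \<open>X\<close> is dense in \<open>P\<close>, so the image is
  exactly the closure that defines hX.\<close>

lemma homeomorphic_map_to_higson:
  "homeomorphic_map (mtopology_of P) (higson_compactification X) to_higson"
proof -
  have Haus: "Hausdorff_space (higson_ambient X)"
    unfolding higson_ambient_def by (simp add: Hausdorff_space_product_topology)
  have cont: "continuous_map (mtopology_of P) (higson_ambient X) to_higson"
    unfolding higson_ambient_def continuous_map_componentwise to_higson_def
    by (auto simp: extension)
  have emb_eq: "higson_embedding X ` mspace X = to_higson ` \<iota> ` mspace X"
    by (auto simp: to_higson_iota image_image)
  have "to_higson ` mspace P = higson_ambient X closure_of (higson_embedding X ` mspace X)"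
  proof (rule equalityI)
    show "to_higson ` mspace P \<subseteq> higson_ambient X closure_of (higson_embedding X ` mspace X)"
      unfolding emb_eq closure_of_image[symmetric]
      by (rule continuous_map_image_closure_subset[OF cont])
    have "compactin (higson_ambient X) (to_higson ` mspace P)"
      using image_compactin[OF _ cont] compact by (simp add: compact_space_def)
    then have "closedin (higson_ambient X) (to_higson ` mspace P)"
      by (rule compactin_imp_closedin[OF Haus])
    then show "higson_ambient X closure_of (higson_embedding X ` mspace X) \<subseteq> to_higson ` mspace P"
      unfolding emb_eq using emb by (intro closure_of_minimal) auto
  qed
  moreover have "higson_ambient X closure_of (higson_embedding X ` mspace X) \<subseteq> topspace (higson_ambient X)"
    by (rule closure_of_subset_topspace)
  ultimately have im: "to_higson ` mspace P = topspace (higson_compactification X)"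
    by (simp add: higson_compactification_def Int_absorb1)
  have "inj_on to_higson (mspace P)"
  proof (rule inj_onI)
    fix p q assume p: "p \<in> mspace P" and q: "q \<in> mspace P" and eq: "to_higson p = to_higson q"
    \<comment> \<open>The distance from \<open>p\<close> vanishes only at \<open>p\<close>;
      restricted to \<open>X\<close> it is a member of \<open>Ch X\<close>, and the coordinate it
      indexes separates \<open>p\<close> from \<open>q\<close>.\<close>
    have cont: "continuous_map (mtopology_of P) euclideanreal (mdist P p)"
      using p by (rule continuous_on_mdist)
    have "to_higson p (\<lambda>x\<in>mspace X. mdist P p (\<iota> x)) = mdist P p p"
      "to_higson q (\<lambda>x\<in>mspace X. mdist P p (\<iota> x)) = mdist P p q"
      using restrict_in_Ch(1)[OF cont] extension_restrict[OF cont] p q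
      by (simp_all add: to_higson_def)
    then have "mdist P p q = 0"
      using eq p by simp
    then show "p = q" using p q by simp
  qed
  then show ?thesis
    using im cont Haus compact
    by (intro continuous_imp_homeomorphic_map)
      (auto simp: higson_compactification_def continuous_map_in_subtopology Hausdorff_space_subtopology)
qed

lemma homeomorphic_map_to_higson_corona:
  "homeomorphic_map (subtopology (mtopology_of P) bd) (higson_corona X) to_higson"
  unfolding higson_corona_def
proof (rule homeomorphic_map_subtopologies_alt[OF homeomorphic_map_to_higson])
  fix q assume q: "q \<in> topspace (mtopology_of P)" and h: "to_higson q \<in> topspace (higson_compactification X)"
  have inj: "inj_on to_higson (mspace P)"
    using homeomorphic_imp_injective_map[OF homeomorphic_map_to_higson] by simp
  have "to_higson q \<in> higson_embedding X ` mspace X \<longleftrightarrow> q \<in> \<iota> ` mspace X"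
    using inj_onD[OF inj] q emb by (auto simp: to_higson_iota[symmetric])
  with q h show "to_higson q \<in> topspace (higson_compactification X) - higson_embedding X ` mspace X \<longleftrightarrow> q \<in> bd"
    by (simp add: bd_def)
qed

lemma coarse_bounded_far:
  "\<delta> > 0 \<Longrightarrow> coarse_bounded (C0_coarse X) {x \<in> mspace X. \<not> near \<delta> x}"
  by (auto simp: coarse_bounded_iff_far)

lemma boundary_limit_diff:
  fixes f f' :: "'a \<Rightarrow> real"
  assumes "boundary_limit euclidean_metric f g" "boundary_limit euclidean_metric f' g'"
  shows "boundary_limit euclidean_metric (\<lambda>x. f x - f' x) (\<lambda>p. g p - g' p)"
  unfolding boundary_limit_def
proof (intro allI impI)
  fix \<epsilon> :: real assume "\<epsilon> > 0"
  then have "\<epsilon>/2 > 0" by simp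
  obtain \<delta> where \<delta>: "\<delta> > 0" "\<And>x p. x \<in> mspace X \<Longrightarrow> p \<in> bd \<Longrightarrow> mdist P (\<iota> x) p < \<delta> \<Longrightarrow> dist (f x) (g p) < \<epsilon>/2"
    using boundary_limitD[OF assms(1) \<open>\<epsilon>/2 > 0\<close>] by auto
  obtain \<delta>' where \<delta>': "\<delta>' > 0" "\<And>x p. x \<in> mspace X \<Longrightarrow> p \<in> bd \<Longrightarrow> mdist P (\<iota> x) p < \<delta>' \<Longrightarrow> dist (f' x) (g' p) < \<epsilon>/2"
    using boundary_limitD[OF assms(2) \<open>\<epsilon>/2 > 0\<close>] by auto
  have "dist (f x - f' x) (g p - g' p) < \<epsilon>"
    if "x \<in> mspace X" "p \<in> bd" "mdist P (\<iota> x) p < min \<delta> \<delta>'" for x p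
  proof -
    have "dist (f x) (g p) < \<epsilon>/2" "dist (f' x) (g' p) < \<epsilon>/2"
      using \<delta>(2) \<delta>'(2) that by auto
    then show ?thesis unfolding dist_real_def by linarith
  qed
  then show "\<exists>\<delta>>0. \<forall>x\<in>mspace X. \<forall>p\<in>bd. mdist P (\<iota> x) p < \<delta> \<longrightarrow>
      mdist euclidean_metric (f x - f' x) (g p - g' p) < \<epsilon>"
    using \<delta>(1) \<delta>'(1) by (intro exI[of _ "min \<delta> \<delta>'"]) auto
qed

lemma Tietze_bd:
  assumes "continuous_map (subtopology (mtopology_of P) bd) euclideanreal h"
  shows "\<exists>F. continuous_map (mtopology_of P) euclideanreal F \<and> (\<forall>p\<in>bd. F p = h p)"
proof -
  interpret P: Metric_space "mspace P" "mdist P" by simp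
  have norm: "normal_space (mtopology_of P)"
    unfolding mtopology_of_def by (rule P.normal_space_mtopology)
  show ?thesis
    using Tietze_extension_realinterval[OF norm closedin_bd is_interval_univ UNIV_not_empty assms subset_UNIV]
    by metis
qed

end

section \<open>The Higson corona as a boundary\<close>

text \<open>The metric lives on hX itself rather than on a homeomorphic copy. Then \<open>bd\<close>
  is literally the point set of \<open>higson_corona X\<close>, and no homeomorphism has to be
  carried through \<open>corona_hom\<close> and \<open>corona_map\<close>.\<close>

locale higson_metric = metric_compactification X P "higson_embedding X"
  for X :: "'a metric" and P :: "(('a \<Rightarrow> real) \<Rightarrow> real) metric" +
  assumes topology: "mtopology_of P = higson_compactification X"

lemma (in metric_compactification) higson_metric_exists: "\<exists>D. higson_metric X D"
proof -
  let ?h = to_higson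
  define D where "D = image_metric P ?h"
  have inj: "inj_on ?h (mspace P)"
    using homeomorphic_imp_injective_map[OF homeomorphic_map_to_higson] by simp
  have mspace_D: "mspace D = ?h ` mspace P"
    and iso: "\<And>p q. p \<in> mspace P \<Longrightarrow> q \<in> mspace P \<Longrightarrow> mdist D (?h p) (?h q) = mdist P p q"
    unfolding D_def using mspace_image_metric[OF inj] mdist_image_metric[OF inj] by auto
  interpret PD: Metric_space12 "mspace P" "mdist P" "mspace D" "mdist D"
    by (rule Metric_space12_mspace_mdist)
  have hom: "homeomorphic_map (mtopology_of P) (mtopology_of D) ?h"
    unfolding mtopology_of_def by (rule PD.isometry_imp_homeomorphic_map) (use iso mspace_D in auto)
  \<comment> \<open>Both are the quotient topology of \<open>P\<close> under the same map onto the
    same set.\<close>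
  have top: "mtopology_of D = higson_compactification X"
  proof (rule topology_eq[THEN iffD2], rule allI)
    fix U
    have ts: "topspace (higson_compactification X) = ?h ` mspace P"
      using homeomorphic_imp_surjective_map[OF homeomorphic_map_to_higson] by simp
    have "openin (mtopology_of D) U \<longleftrightarrow> U \<subseteq> ?h ` mspace P \<and> openin (mtopology_of P) {q \<in> mspace P. ?h q \<in> U}"
      using hom openin_subset[of "mtopology_of D" U]
      unfolding homeomorphic_map_def quotient_map_def by (auto simp: mspace_D)
    moreover have "openin (higson_compactification X) U \<longleftrightarrow>
        U \<subseteq> ?h ` mspace P \<and> openin (mtopology_of P) {q \<in> mspace P. ?h q \<in> U}"
      using homeomorphic_map_to_higson openin_subset[of "higson_compactification X" U]
      unfolding homeomorphic_map_def quotient_map_def ts by auto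
    ultimately show "openin (mtopology_of D) U \<longleftrightarrow> openin (higson_compactification X) U" by blast
  qed
  have "metric_compactification X D (higson_embedding X)"
  proof
    fix x y assume x: "x \<in> mspace X"
    then show "higson_embedding X x \<in> mspace D"
      using emb mspace_D by (auto simp: to_higson_iota[symmetric])
    assume "y \<in> mspace X"
    with x show "mdist D (higson_embedding X x) (higson_embedding X y) = mdist X x y"
      using iso emb isometric by (simp add: to_higson_iota[symmetric])
  next
    show "compact_space (mtopology_of D)"
      using compact hom homeomorphic_compact_space homeomorphic_map_imp_homeomorphic_space by blast
  next
    fix p and \<epsilon> :: real assume "p \<in> mspace D" "\<epsilon> > 0"
    then obtain q where q: "q \<in> mspace P" "p = ?h q" by (auto simp: mspace_D)
    then obtain x where "x \<in> mspace X" "mdist P (\<iota> x) q < \<epsilon>"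
      using dense \<open>\<epsilon> > 0\<close> by blast
    then show "\<exists>x\<in>mspace X. mdist D (higson_embedding X x) p < \<epsilon>"
      using iso emb q by (intro bexI[of _ x]) (simp_all add: to_higson_iota[symmetric])
  next
    have "higson_embedding X ` mspace X = ?h ` \<iota> ` mspace X"
      by (auto simp: to_higson_iota image_image)
    then show "openin (mtopology_of D) (higson_embedding X ` mspace X)"
      using homeomorphic_map_openness[OF hom, of "\<iota> ` mspace X"] open_image emb by auto
  qed
  then have "higson_metric X D"
    unfolding higson_metric_def higson_metric_axioms_def top by simp
  then show ?thesis ..
qed

context higson_metric
begin

lemma corona_topology: "higson_corona X = subtopology (mtopology_of P) bd"
  unfolding higson_corona_def bd_def topology[symmetric] by simp

lemma topspace_corona: "topspace (higson_corona X) = bd"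
  unfolding corona_topology using bd_mspace by auto

lemma corona_metric: "higson_corona X = mtopology_of (submetric P bd)"
  unfolding corona_topology by (simp add: mtopology_of_submetric)

text \<open>Points of \<open>P\<close> are now functions on \<open>Ch X\<close>, and the
  \<open>\<psi>\<close>-th projection restricts to \<open>\<psi>\<close> on the embedded copy of
  \<open>X\<close>.\<close>

lemma boundary_limit_coordinate:
  assumes "\<psi> \<in> Ch X"
  shows "continuous_map (mtopology_of P) euclideanreal (\<lambda>p. p \<psi>)"
    and "boundary_limit euclidean_metric \<psi> (\<lambda>p. p \<psi>)"
proof -
  show cont: "continuous_map (mtopology_of P) euclideanreal (\<lambda>p. p \<psi>)"
    unfolding topology higson_compactification_def higson_ambient_def
    using assms by (intro continuous_map_from_subtopology continuous_map_product_projection)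
  show "boundary_limit euclidean_metric \<psi> (\<lambda>p. p \<psi>)"
    by (rule boundary_limit_cong[OF restrict_in_Ch(2)[OF cont]])
      (use assms in \<open>auto simp: higson_embedding_def\<close>)
qed

text \<open>Existence: Tietze extends \<open>g\<close> from the closed set \<open>bd\<close> to
  \<open>P\<close>, and restricting the extension to \<open>X\<close> gives a continuous Higson
  function with the same limit as \<open>\<phi>\<close>. Uniqueness: any admissible
  \<open>\<psi>\<close> differs from \<open>\<phi>\<close> by a function with limit zero, so its
  coordinate agrees with \<open>g\<close> on \<open>bd\<close>.\<close>

lemma corona_function_eq:
  assumes \<phi>: "\<phi> \<in> Bh X" and g: "boundary_limit euclidean_metric \<phi> g"
  shows "corona_function X \<phi> = restrict g bd"
  unfolding corona_function_def topspace_corona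
proof (rule the_equality)
  have "continuous_map (subtopology (mtopology_of P) bd) euclideanreal g"
    using boundary_limit_continuous[OF g] uniformly_continuous_imp_continuous_map[of "submetric P bd" euclidean_metric g]
    by (simp add: mtopology_of_submetric)
  then obtain F where F: "continuous_map (mtopology_of P) euclideanreal F" "\<And>p. p \<in> bd \<Longrightarrow> F p = g p"
    using Tietze_bd by blast
  define \<psi> where "\<psi> = (\<lambda>x\<in>mspace X. F (higson_embedding X x))"
  have \<psi>: "\<psi> \<in> Ch X" "boundary_limit euclidean_metric \<psi> F"
    unfolding \<psi>_def using restrict_in_Ch[OF F(1)] by auto
  have "boundary_limit euclidean_metric (\<lambda>x. \<phi> x - \<psi> x) (\<lambda>p. g p - F p)"
    using boundary_limit_diff[OF g \<psi>(2)] .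
  then have "boundary_limit euclidean_metric (\<lambda>x\<in>mspace X. \<phi> x - \<psi> x) (\<lambda>_. 0)"
    by (rule boundary_limit_cong) (auto simp: F(2))
  moreover have "bounded ((\<lambda>x. \<phi> x - \<psi> x) ` mspace X)"
    using \<phi> \<psi>(1) bounded_minus_comp[of \<phi> "mspace X" \<psi>] by (auto simp: Ch_def Bh_def higson_functions_def)
  ultimately have "(\<lambda>x\<in>mspace X. \<phi> x - \<psi> x) \<in> B0 X"
    unfolding B0_iff_boundary_limit by auto
  moreover have "restrict g bd = (\<lambda>p\<in>bd. p \<psi>)"
    using boundary_limit_real_unique[OF boundary_limit_coordinate(2)[OF \<psi>(1)] \<psi>(2)] F(2)
    by (intro restrict_ext) simp
  ultimately show "\<exists>\<psi>\<in>Ch X. (\<lambda>x\<in>mspace X. \<phi> x - \<psi> x) \<in> B0 X \<and> restrict g bd = (\<lambda>p\<in>bd. p \<psi>)"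
    using \<psi>(1) by blast
next
  fix h assume "\<exists>\<psi>\<in>Ch X. (\<lambda>x\<in>mspace X. \<phi> x - \<psi> x) \<in> B0 X \<and> h = (\<lambda>p\<in>bd. p \<psi>)"
  then obtain \<psi> where \<psi>: "\<psi> \<in> Ch X" "(\<lambda>x\<in>mspace X. \<phi> x - \<psi> x) \<in> B0 X" "h = (\<lambda>p\<in>bd. p \<psi>)" by blast
  have "boundary_limit euclidean_metric (\<lambda>x. \<phi> x - \<psi> x) (\<lambda>p. g p - p \<psi>)"
    using boundary_limit_diff[OF g boundary_limit_coordinate(2)[OF \<psi>(1)]] .
  moreover have "boundary_limit euclidean_metric (\<lambda>x. \<phi> x - \<psi> x) (\<lambda>_. 0)"
    by (rule boundary_limit_cong[of _ "\<lambda>x\<in>mspace X. \<phi> x - \<psi> x" "\<lambda>_. 0"])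
      (use \<psi>(2) in \<open>auto simp: B0_iff_boundary_limit\<close>)
  ultimately have "g p - p \<psi> = 0" if "p \<in> bd" for p
    using boundary_limit_real_unique[of "\<lambda>x. \<phi> x - \<psi> x"] that by blast
  then show "h = restrict g bd"
    unfolding \<psi>(3) by (intro restrict_ext) simp
qed

lemma corona_function_continuous:
  assumes "\<phi> \<in> Bh X"
  shows "corona_function X \<phi> \<in> continuous_functions (higson_corona X)"
proof -
  obtain g where g: "boundary_limit euclidean_metric \<phi> g"
    using Bh_imp_boundary_limit[OF assms] ..
  have "continuous_map (higson_corona X) euclideanreal g"
    using boundary_limit_continuous[OF g] uniformly_continuous_imp_continuous_map[of "submetric P bd" euclidean_metric g]
    by (simp add: corona_metric)
  then have "continuous_map (higson_corona X) euclideanreal (restrict g bd)"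
    by (rule continuous_map_eq) (simp add: topspace_corona)
  then show ?thesis
    by (simp add: corona_function_eq[OF assms g] continuous_functions_def topspace_corona)
qed

text \<open>Tietze again: a function on the corona extends to \<open>P\<close>. Since every element
  of C(\<nu>X) arises from a Higson function, a map defined on C(\<nu>X) is determined by its values
  there; this is the source of uniqueness for \<open>corona_hom\<close>.\<close>

lemma corona_function_surj:
  assumes "h \<in> continuous_functions (higson_corona X)"
  obtains \<phi> where "\<phi> \<in> Bh X" "corona_function X \<phi> = h"
proof -
  obtain F where F: "continuous_map (mtopology_of P) euclideanreal F" "\<And>p. p \<in> bd \<Longrightarrow> F p = h p"
    using Tietze_bd[of h] assms unfolding continuous_functions_def corona_topology by blast
  have *: "(\<lambda>x\<in>mspace X. F (higson_embedding X x)) \<in> Bh X"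
    using restrict_in_Ch(1)[OF F(1)] by (simp add: Ch_def)
  have "corona_function X (\<lambda>x\<in>mspace X. F (higson_embedding X x)) = restrict F bd"
    by (rule corona_function_eq[OF * restrict_in_Ch(2)[OF F(1)]])
  also have "\<dots> = restrict h bd"
    using F(2) by (intro restrict_ext) simp
  also have "\<dots> = h"
    using assms by (simp add: continuous_functions_def topspace_corona extensional_restrict)
  finally show ?thesis using * that by blast
qed

lemma coordinate_continuous_functions:
  "\<psi> \<in> Ch X \<Longrightarrow> (\<lambda>p\<in>bd. p \<psi>) \<in> continuous_functions (higson_corona X)"
  using corona_function_eq[OF _ boundary_limit_coordinate(2)[of \<psi>]] corona_function_continuous[of \<psi>]
  by (auto simp: Ch_def)

text \<open>Lets points of the corona be compared coordinate by coordinate.\<close>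

lemma corona_extensional: "p \<in> bd \<Longrightarrow> p \<in> extensional (Ch X)"
proof -
  assume "p \<in> bd"
  then have "p \<in> topspace (higson_compactification X)"
    using bd_mspace topology by (metis topspace_mtopology_of)
  then show ?thesis
    unfolding higson_compactification_def higson_ambient_def by (auto simp: PiE_def)
qed

end

section \<open>Boundary limits of coarse maps\<close>

locale compactification_pair =
  X: metric_compactification X P \<iota> + Y: metric_compactification Y Q \<kappa>
  for X :: "'a metric" and P :: "'p metric" and \<iota> and Y :: "'b metric" and Q :: "'q metric" and \<kappa>
begin

abbreviation coarse :: "('a \<Rightarrow> 'b) set" where
  "coarse \<equiv> coarse_maps (mspace X) (C0_coarse X) (mspace Y) (C0_coarse Y)"

text \<open>Only the values of \<open>g\<close> on \<open>X.bd\<close> are determined. It is left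
  unrestricted so that limits compose freely; \<open>corona_map_eq\<close> restricts it at the
  end.\<close>

definition corona_limit :: "('a \<Rightarrow> 'b) \<Rightarrow> ('p \<Rightarrow> 'q) \<Rightarrow> bool" where
  "corona_limit f g \<longleftrightarrow> g \<in> X.bd \<rightarrow> Y.bd \<and> X.boundary_limit Q (\<lambda>x. \<kappa> (f x)) g"

lemma coarse_funcset: "f \<in> coarse \<Longrightarrow> f \<in> mspace X \<rightarrow> mspace Y"
  by (auto simp: coarse_maps_def)

text \<open>A bornologous map sends bounded sets to bounded sets; this is applied to the set of
  points that are not \<open>\<delta>\<close>-near.\<close>

lemma coarse_near:
  assumes f: "f \<in> coarse" and "\<delta> > 0"
  shows "\<exists>\<delta>'>0. \<forall>x\<in>mspace X. Y.near \<delta>' (f x) \<longrightarrow> X.near \<delta> x"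
proof -
  let ?B = "{x \<in> mspace X. \<not> X.near \<delta> x}"
  have "map_prod f f ` (?B \<times> ?B) \<in> C0_coarse Y"
    using f X.coarse_bounded_far[OF \<open>\<delta> > 0\<close>]
    by (auto simp: coarse_maps_def bornologous_def coarse_bounded_def)
  then have "coarse_bounded (C0_coarse Y) (f ` ?B)"
    by (simp add: coarse_bounded_def map_prod_surj_on)
  then show ?thesis
    unfolding Y.coarse_bounded_iff_far by blast
qed

text \<open>Properness, applied to the bounded set of points of \<open>Y\<close> that are not
  \<open>\<epsilon>\<close>-near.\<close>

lemma near_coarse:
  assumes f: "f \<in> coarse" and "\<epsilon> > 0"
  shows "\<exists>\<delta>>0. \<forall>x\<in>mspace X. X.near \<delta> x \<longrightarrow> Y.near \<epsilon> (f x)"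
proof -
  have "coarse_bounded (C0_coarse X) (mspace X \<inter> f -` {y \<in> mspace Y. \<not> Y.near \<epsilon> y})"
    using f Y.coarse_bounded_far[OF \<open>\<epsilon> > 0\<close>]
    by (auto simp: coarse_maps_def coarse_proper_def)
  then show ?thesis
    unfolding X.coarse_bounded_iff_far using coarse_funcset[OF f] by blast
qed

text \<open>A controlled image bounds the distance of \<open>f x\<close> and \<open>f y\<close> only
  near \<open>Y.bd\<close>. Properness, in the form of \<open>near_coarse\<close>, puts
  \<open>f x\<close> there when \<open>x\<close> is near \<open>X.bd\<close>, and this yields the
  Cauchy condition.\<close>

lemma corona_limit_exists:
  assumes f: "f \<in> coarse"
  shows "\<exists>g. corona_limit f g"
proof -
  have fim: "f \<in> mspace X \<rightarrow> mspace Y"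
    using coarse_funcset[OF f] .
  have "\<exists>g\<in>X.bd \<rightarrow> mspace Q. X.boundary_limit Q (\<lambda>x. \<kappa> (f x)) g"
  proof (rule X.boundary_limit_exists)
    show "mcomplete_of Q"
      using Y.compact Metric_space.compact_space_imp_mcomplete[OF Metric_space_mspace_mdist, of Q]
      by (simp add: mcomplete_of_def mtopology_of_def)
    show "(\<lambda>x. \<kappa> (f x)) \<in> mspace X \<rightarrow> mspace Q"
      using fim Y.emb by auto
    show "\<exists>\<delta>>0. \<forall>x\<in>mspace X. \<forall>y\<in>mspace X. X.near \<delta> x \<longrightarrow> X.near \<delta> y \<longrightarrow>
        mdist X x y < \<delta> \<longrightarrow> mdist Q (\<kappa> (f x)) (\<kappa> (f y)) < \<epsilon>" if "\<epsilon> > 0" for \<epsilon>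
    proof (rule X.controlled_imp_uniform)
      fix E assume E: "E \<in> C0_coarse X"
      then have "map_prod f f ` E \<in> C0_coarse Y"
        using f by (auto simp: coarse_maps_def bornologous_def)
      then obtain \<delta>' where \<delta>': "\<delta>' > 0" "\<And>x y. (x, y) \<in> E \<Longrightarrow> Y.near \<delta>' (f x) \<Longrightarrow> mdist Y (f x) (f y) < \<epsilon>"
        unfolding Y.C0_coarse_iff_near using \<open>\<epsilon> > 0\<close> by (force simp: map_prod_def)
      obtain \<delta> where \<delta>: "\<delta> > 0" "\<And>x. x \<in> mspace X \<Longrightarrow> X.near \<delta> x \<Longrightarrow> Y.near \<delta>' (f x)"
        using near_coarse[OF f \<delta>'(1)] by blast
      have "mdist Q (\<kappa> (f x)) (\<kappa> (f y)) < \<epsilon>" if "(x, y) \<in> E" "X.near \<delta> x" for x y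
      proof -
        have "x \<in> mspace X" "y \<in> mspace X" using E that unfolding C0_coarse_iff by auto
        moreover from this have "f x \<in> mspace Y" "f y \<in> mspace Y" using fim by auto
        ultimately show ?thesis
          using \<delta>'(2)[OF that(1) \<delta>(2)[OF _ that(2)]] Y.isometric[of "f x" "f y"] by simp
      qed
      then show "\<exists>\<delta>>0. \<forall>x y. (x, y) \<in> E \<longrightarrow> X.near \<delta> x \<longrightarrow> X.near \<delta> y \<longrightarrow> mdist Q (\<kappa> (f x)) (\<kappa> (f y)) < \<epsilon>"
        using \<delta>(1) by blast
    qed
  qed
  then obtain g where g: "g \<in> X.bd \<rightarrow> mspace Q" "X.boundary_limit Q (\<lambda>x. \<kappa> (f x)) g" by blast
  \<comment> \<open>If the limit were a point \<open>y\<close> of \<open>Y\<close>, the values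
    \<open>f x\<close> for \<open>x\<close> tending to \<open>p\<close> would approach both
    \<open>y\<close> and \<open>Y.bd\<close>, and \<open>y\<close> would be arbitrarily near
    \<open>Y.bd\<close>.\<close>
  have "g p \<in> Y.bd" if p: "p \<in> X.bd" for p
  proof (rule ccontr)
    assume "g p \<notin> Y.bd"
    then obtain y where y: "y \<in> mspace Y" "g p = \<kappa> y"
      using g(1) p by (auto simp: Y.bd_def)
    have "Y.near \<epsilon> y" if "\<epsilon> > 0" for \<epsilon>
    proof -
      have "\<epsilon>/2 > 0" using \<open>\<epsilon> > 0\<close> by simp
      obtain \<delta> where \<delta>: "\<delta> > 0" "\<And>x. x \<in> mspace X \<Longrightarrow> mdist P (\<iota> x) p < \<delta> \<Longrightarrow> mdist Q (\<kappa> (f x)) (g p) < \<epsilon>/2"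
        using X.boundary_limitD[OF g(2) \<open>\<epsilon>/2 > 0\<close>] p by metis
      obtain \<delta>' where \<delta>': "\<delta>' > 0" "\<And>x. x \<in> mspace X \<Longrightarrow> X.near \<delta>' x \<Longrightarrow> Y.near (\<epsilon>/2) (f x)"
        using near_coarse[OF f \<open>\<epsilon>/2 > 0\<close>] by blast
      obtain x where x: "x \<in> mspace X" "mdist P (\<iota> x) p < min \<delta> \<delta>'"
        using X.dense[OF X.bd_mspace[OF p], of "min \<delta> \<delta>'"] \<delta>(1) \<delta>'(1) by auto
      have "f x \<in> mspace Y" using fim x by auto
      moreover have "Y.near (\<epsilon>/2) (f x)"
        using \<delta>'(2)[OF x(1)] X.nearI[OF p] x(2) by simp
      moreover have "mdist Y (f x) y < \<epsilon>/2"
        using \<delta>(2)[OF x(1)] x(2) y Y.isometric[OF \<open>f x \<in> mspace Y\<close> y(1)] by simp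
      ultimately show ?thesis
        using Y.near_dist[of "\<epsilon>/2" "f x" y "\<epsilon>/2"] y(1) by simp
    qed
    moreover have "compactin (mtopology_of Y) {y}"
      using y by (intro finite_imp_compactin) auto
    ultimately show False
      using Y.compactin_imp_far by blast
  qed
  then show ?thesis
    unfolding corona_limit_def using g(2) by blast
qed

text \<open>A limit with values in \<open>Y.bd\<close> gives properness, and it makes
  \<open>f\<close> vary little along controlled pairs near \<open>X.bd\<close>. About the rest of
  \<open>X\<close> it says nothing; there \<open>near\<close> keeps values away from
  \<open>Y.bd\<close>, so that nearness of \<open>f x\<close> can be traced back to nearness of
  \<open>x\<close>.\<close>

lemma coarseI:
  assumes f: "f \<in> mspace X \<rightarrow>\<^sub>E mspace Y" and g: "corona_limit f g"
    and near: "\<And>\<delta>. \<delta> > 0 \<Longrightarrow> \<exists>\<delta>'>0. \<forall>x\<in>mspace X. Y.near \<delta>' (f x) \<longrightarrow> X.near \<delta> x"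
  shows "f \<in> coarse"
proof -
  have lim: "X.boundary_limit Q (\<lambda>x. \<kappa> (f x)) g" and gim: "g \<in> X.bd \<rightarrow> Y.bd"
    using g by (auto simp: corona_limit_def)
  have "coarse_bounded (C0_coarse X) (mspace X \<inter> f -` B)" if "coarse_bounded (C0_coarse Y) B" for B
  proof -
    obtain \<epsilon> where \<epsilon>: "\<epsilon> > 0" "\<And>y. y \<in> B \<Longrightarrow> \<not> Y.near \<epsilon> y"
      using \<open>coarse_bounded (C0_coarse Y) B\<close> unfolding Y.coarse_bounded_iff_far by blast
    obtain \<delta> where \<delta>: "\<delta> > 0" "\<And>x p. x \<in> mspace X \<Longrightarrow> p \<in> X.bd \<Longrightarrow> mdist P (\<iota> x) p < \<delta> \<Longrightarrow>
        mdist Q (\<kappa> (f x)) (g p) < \<epsilon>"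
      using X.boundary_limitD[OF lim \<epsilon>(1)] by metis
    have "\<not> X.near \<delta> x" if "x \<in> mspace X" "f x \<in> B" for x
      using \<delta>(2)[OF that(1)] \<epsilon>(2)[OF that(2)] gim unfolding X.near_def Y.near_def by blast
    then show ?thesis
      unfolding X.coarse_bounded_iff_far using \<delta>(1) by blast
  qed
  moreover have "map_prod f f ` E \<in> C0_coarse Y" if E: "E \<in> C0_coarse X" for E
    unfolding Y.C0_coarse_iff_near
  proof (intro conjI allI impI)
    have sub: "E \<subseteq> mspace X \<times> mspace X" using E unfolding C0_coarse_iff by blast
    then show "map_prod f f ` E \<subseteq> mspace Y \<times> mspace Y" using f by fastforce
    fix \<epsilon> :: real assume "\<epsilon> > 0"
    obtain \<delta> where \<delta>: "\<delta> > 0" "\<And>x y. (x, y) \<in> E \<Longrightarrow> X.near \<delta> x \<or> X.near \<delta> y \<Longrightarrow>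
        mdist Q (\<kappa> (f x)) (\<kappa> (f y)) < \<epsilon>"
      using X.boundary_limit_controlled[OF lim _ _ E \<open>\<epsilon> > 0\<close>] f gim Y.emb Y.bd_mspace by (force simp: PiE_def Pi_def)
    obtain \<delta>' where \<delta>': "\<delta>' > 0" "\<And>x. x \<in> mspace X \<Longrightarrow> Y.near \<delta>' (f x) \<Longrightarrow> X.near \<delta> x"
      using near[OF \<delta>(1)] by blast
    have "mdist Y (f x) (f y) < \<epsilon>" if "(x, y) \<in> E" "Y.near \<delta>' (f x) \<or> Y.near \<delta>' (f y)" for x y
    proof -
      have xy: "x \<in> mspace X" "y \<in> mspace X" "f x \<in> mspace Y" "f y \<in> mspace Y"
        using sub that f by auto
      then show ?thesis
        using \<delta>(2)[OF that(1)] \<delta>'(2)[OF xy(1)] \<delta>'(2)[OF xy(2)] that(2) Y.isometric[OF xy(3,4)] by auto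
    qed
    then show "\<exists>\<delta>>0. \<forall>u v. (u, v) \<in> map_prod f f ` E \<longrightarrow> Y.near \<delta> u \<or> Y.near \<delta> v \<longrightarrow> mdist Y u v < \<epsilon>"
      using \<delta>'(1) by (intro exI[of _ \<delta>']) auto
  qed
  ultimately show ?thesis
    using f by (auto simp: coarse_maps_def coarse_proper_def bornologous_def)
qed

lemma corona_limit_compose:
  assumes "corona_limit f g" and f: "f \<in> mspace X \<rightarrow> mspace Y" and "Y.boundary_limit R \<phi> \<psi>"
  shows "X.boundary_limit R (\<lambda>x. \<phi> (f x)) (\<lambda>p. \<psi> (g p))"
  unfolding X.boundary_limit_def
proof (intro allI impI)
  fix \<epsilon> :: real assume "\<epsilon> > 0"
  obtain \<delta>' where \<delta>': "\<delta>' > 0" "\<And>y q. y \<in> mspace Y \<Longrightarrow> q \<in> Y.bd \<Longrightarrow> mdist Q (\<kappa> y) q < \<delta>' \<Longrightarrow> mdist R (\<phi> y) (\<psi> q) < \<epsilon>"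
    using Y.boundary_limitD[OF assms(3) \<open>\<epsilon> > 0\<close>] by metis
  have lim: "X.boundary_limit Q (\<lambda>x. \<kappa> (f x)) g" and gim: "g \<in> X.bd \<rightarrow> Y.bd"
    using assms(1) by (auto simp: corona_limit_def)
  obtain \<delta> where \<delta>: "\<delta> > 0" "\<And>x p. x \<in> mspace X \<Longrightarrow> p \<in> X.bd \<Longrightarrow> mdist P (\<iota> x) p < \<delta> \<Longrightarrow> mdist Q (\<kappa> (f x)) (g p) < \<delta>'"
    using X.boundary_limitD[OF lim \<delta>'(1)] by metis
  have "mdist R (\<phi> (f x)) (\<psi> (g p)) < \<epsilon>" if "x \<in> mspace X" "p \<in> X.bd" "mdist P (\<iota> x) p < \<delta>" for x p
    using that f gim by (intro \<delta>'(2) \<delta>(2)) auto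
  then show "\<exists>\<delta>>0. \<forall>x\<in>mspace X. \<forall>p\<in>X.bd. mdist P (\<iota> x) p < \<delta> \<longrightarrow> mdist R (\<phi> (f x)) (\<psi> (g p)) < \<epsilon>"
    using \<delta>(1) by blast
qed

lemma corona_limit_unique:
  assumes "corona_limit f g" "corona_limit f g'" "f \<in> mspace X \<rightarrow> mspace Y" "p \<in> X.bd"
  shows "g p = g' p"
proof (rule X.boundary_limit_unique)
  show "X.boundary_limit Q (\<lambda>x. \<kappa> (f x)) g" "X.boundary_limit Q (\<lambda>x. \<kappa> (f x)) g'"
    using assms by (auto simp: corona_limit_def)
qed (use assms Y.emb Y.bd_mspace in \<open>auto simp: corona_limit_def Pi_def\<close>)

text \<open>Closeness yields estimates when \<open>f x\<close> or \<open>f' x\<close> is near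
  \<open>Y.bd\<close>, limits yield them when \<open>x\<close> is near \<open>X.bd\<close>. One
  direction translates by the fact that the limits lie in \<open>Y.bd\<close>, the other by
  \<open>coarse_near\<close>.\<close>

lemma close_iff_corona_limit:
  assumes f: "f \<in> coarse" "f' \<in> coarse" and g: "corona_limit f g" "corona_limit f' g'"
  shows "close_maps (mspace X) (C0_coarse Y) f f' \<longleftrightarrow> (\<forall>p\<in>X.bd. g p = g' p)"
proof
  have fim: "f \<in> mspace X \<rightarrow> mspace Y" "f' \<in> mspace X \<rightarrow> mspace Y"
    using f coarse_funcset by blast+
  have lim: "X.boundary_limit Q (\<lambda>x. \<kappa> (f x)) g" "X.boundary_limit Q (\<lambda>x. \<kappa> (f' x)) g'"
    and gim: "g \<in> X.bd \<rightarrow> Y.bd" "g' \<in> X.bd \<rightarrow> Y.bd"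
    using g by (auto simp: corona_limit_def)
  {
    assume close: "close_maps (mspace X) (C0_coarse Y) f f'"
    have "X.boundary_limit Q (\<lambda>x. \<kappa> (f x)) g'"
      unfolding X.boundary_limit_def
    proof (intro allI impI)
      fix \<epsilon> :: real assume "\<epsilon> > 0"
      then have "\<epsilon>/2 > 0" by simp
      obtain \<delta>' where \<delta>': "\<delta>' > 0" "\<And>x. x \<in> mspace X \<Longrightarrow> Y.near \<delta>' (f' x) \<Longrightarrow> mdist Y (f x) (f' x) < \<epsilon>/2"
        using close \<open>\<epsilon>/2 > 0\<close> unfolding close_maps_def Y.C0_coarse_iff_near by (meson image_eqI)
      have "min \<delta>' (\<epsilon>/2) > 0" using \<open>\<epsilon>/2 > 0\<close> \<delta>'(1) by simp
      then obtain \<delta> where \<delta>: "\<delta> > 0" "\<And>x p. x \<in> mspace X \<Longrightarrow> p \<in> X.bd \<Longrightarrow> mdist P (\<iota> x) p < \<delta> \<Longrightarrow>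
          mdist Q (\<kappa> (f' x)) (g' p) < min \<delta>' (\<epsilon>/2)"
        using X.boundary_limitD[OF lim(2)] by metis
      have "mdist Q (\<kappa> (f x)) (g' p) < \<epsilon>" if x: "x \<in> mspace X" and p: "p \<in> X.bd" and d: "mdist P (\<iota> x) p < \<delta>" for x p
      proof -
        have fx: "f x \<in> mspace Y" "f' x \<in> mspace Y" and gp: "g' p \<in> Y.bd" using fim gim x p by auto
        have "Y.near \<delta>' (f' x)" using \<delta>(2)[OF x p d] gp by (intro Y.nearI[of "g' p"]) auto
        then have "mdist Q (\<kappa> (f x)) (\<kappa> (f' x)) < \<epsilon>/2"
          using \<delta>'(2)[OF x] Y.isometric[OF fx] by simp
        moreover have "mdist Q (\<kappa> (f x)) (g' p) \<le> mdist Q (\<kappa> (f x)) (\<kappa> (f' x)) + mdist Q (\<kappa> (f' x)) (g' p)"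
          using fx gp by (intro mdist_triangle) (auto intro: Y.emb Y.bd_mspace)
        ultimately show ?thesis using \<delta>(2)[OF x p d] by auto
      qed
      then show "\<exists>\<delta>>0. \<forall>x\<in>mspace X. \<forall>p\<in>X.bd. mdist P (\<iota> x) p < \<delta> \<longrightarrow> mdist Q (\<kappa> (f x)) (g' p) < \<epsilon>"
        using \<delta>(1) by blast
    qed
    then show "\<forall>p\<in>X.bd. g p = g' p"
      using corona_limit_unique[OF g(1) _ fim(1)] gim by (auto simp: corona_limit_def)
  next
    assume eq: "\<forall>p\<in>X.bd. g p = g' p"
    show "close_maps (mspace X) (C0_coarse Y) f f'"
      unfolding close_maps_def Y.C0_coarse_iff_near
    proof (intro conjI allI impI)
      show "(\<lambda>s. (f s, f' s)) ` mspace X \<subseteq> mspace Y \<times> mspace Y" using fim by auto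
      fix \<epsilon> :: real assume "\<epsilon> > 0"
      then have "\<epsilon>/2 > 0" by simp
      obtain \<delta>1 where \<delta>1: "\<delta>1 > 0" "\<And>x p. x \<in> mspace X \<Longrightarrow> p \<in> X.bd \<Longrightarrow> mdist P (\<iota> x) p < \<delta>1 \<Longrightarrow>
          mdist Q (\<kappa> (f x)) (g p) < \<epsilon>/2"
        using X.boundary_limitD[OF lim(1) \<open>\<epsilon>/2 > 0\<close>] by metis
      obtain \<delta>2 where \<delta>2: "\<delta>2 > 0" "\<And>x p. x \<in> mspace X \<Longrightarrow> p \<in> X.bd \<Longrightarrow> mdist P (\<iota> x) p < \<delta>2 \<Longrightarrow>
          mdist Q (\<kappa> (f' x)) (g' p) < \<epsilon>/2"
        using X.boundary_limitD[OF lim(2) \<open>\<epsilon>/2 > 0\<close>] by metis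
      have dist: "mdist Y (f x) (f' x) < \<epsilon>" if x: "x \<in> mspace X" "X.near (min \<delta>1 \<delta>2) x" for x
      proof -
        obtain p where p: "p \<in> X.bd" "mdist P (\<iota> x) p < \<delta>1" "mdist P (\<iota> x) p < \<delta>2"
          using x(2) by (auto simp: X.near_def)
        have fx: "f x \<in> mspace Y" "f' x \<in> mspace Y" and gp: "g p \<in> Y.bd" using fim gim x p by auto
        have "mdist Q (\<kappa> (f x)) (\<kappa> (f' x)) \<le> mdist Q (\<kappa> (f x)) (g p) + mdist Q (\<kappa> (f' x)) (g p)"
          using fx gp by (intro mtriangle_le) (auto intro: Y.emb Y.bd_mspace)
        moreover have "mdist Q (\<kappa> (f x)) (g p) < \<epsilon>/2" "mdist Q (\<kappa> (f' x)) (g p) < \<epsilon>/2"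
          using \<delta>1(2)[OF x(1) p(1,2)] \<delta>2(2)[OF x(1) p(1,3)] eq p(1) by auto
        ultimately show ?thesis using Y.isometric[OF fx] by linarith
      qed
      have pos: "min \<delta>1 \<delta>2 > 0" using \<delta>1 \<delta>2 by simp
      obtain \<eta>1 where \<eta>1: "\<eta>1 > 0" "\<And>x. x \<in> mspace X \<Longrightarrow> Y.near \<eta>1 (f x) \<Longrightarrow> X.near (min \<delta>1 \<delta>2) x"
        using coarse_near[OF f(1) pos] by blast
      obtain \<eta>2 where \<eta>2: "\<eta>2 > 0" "\<And>x. x \<in> mspace X \<Longrightarrow> Y.near \<eta>2 (f' x) \<Longrightarrow> X.near (min \<delta>1 \<delta>2) x"
        using coarse_near[OF f(2) pos] by blast
      have "mdist Y (f x) (f' x) < \<epsilon>"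
        if "x \<in> mspace X" "Y.near (min \<eta>1 \<eta>2) (f x) \<or> Y.near (min \<eta>1 \<eta>2) (f' x)" for x
        using that dist \<eta>1(2) \<eta>2(2) Y.near_mono by (meson min.cobounded1 min.cobounded2)
      then show "\<exists>\<delta>>0. \<forall>u v. (u, v) \<in> (\<lambda>s. (f s, f' s)) ` mspace X \<longrightarrow> Y.near \<delta> u \<or> Y.near \<delta> v \<longrightarrow> mdist Y u v < \<epsilon>"
        using \<eta>1(1) \<eta>2(1) by (intro exI[of _ "min \<eta>1 \<eta>2"]) auto
    qed
  }
qed

end

section \<open>Finite nets, and existence of the compactification\<close>

context metric_compactification
begin

lemma finite_net:
  assumes "\<epsilon> > 0"
  shows "\<exists>A. finite A \<and> A \<subseteq> mspace X \<and> (\<forall>q\<in>mspace P. \<exists>x\<in>A. mdist P (\<iota> x) q < \<epsilon>)"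
proof -
  interpret P: Metric_space "mspace P" "mdist P" by simp
  have tb: "P.mtotally_bounded (mspace P)"
    using compact P.compact_space_eq_mcomplete_mtotally_bounded by (simp add: mtopology_of_def)
  obtain K where K: "finite K" "K \<subseteq> mspace P" "mspace P \<subseteq> (\<Union>k\<in>K. P.mball k (\<epsilon>/2))"
    using tb[unfolded P.mtotally_bounded_def, rule_format, OF half_gt_zero[OF assms]] by metis
  have "\<forall>k\<in>K. \<exists>x. x \<in> mspace X \<and> mdist P (\<iota> x) k < \<epsilon>/2"
    using dense K(2) half_gt_zero[OF assms] by blast
  then obtain s where s: "\<And>k. k \<in> K \<Longrightarrow> s k \<in> mspace X \<and> mdist P (\<iota> (s k)) k < \<epsilon>/2"
    by metis
  have "\<exists>x\<in>s ` K. mdist P (\<iota> x) q < \<epsilon>" if q: "q \<in> mspace P" for q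
  proof -
    obtain k where k: "k \<in> K" "mdist P k q < \<epsilon>/2"
      using K(3) q by auto
    moreover have "mdist P (\<iota> (s k)) q \<le> mdist P (\<iota> (s k)) k + mdist P k q"
      using k s q K(2) by (intro mdist_triangle) (auto intro: emb)
    ultimately have "mdist P (\<iota> (s k)) q < \<epsilon>" using s[OF k(1)] by linarith
    then show ?thesis using k(1) by blast
  qed
  moreover have "finite (s ` K)" "s ` K \<subseteq> mspace X"
    using K(1) s by auto
  ultimately show ?thesis by blast
qed

lemma totally_bounded: "Metric_space.mtotally_bounded (mspace X) (mdist X) (mspace X)"
proof -
  interpret X: Metric_space "mspace X" "mdist X" by simp
  show ?thesis
    unfolding X.mtotally_bounded_def
  proof (intro allI impI)
    fix \<epsilon> :: real assume "\<epsilon> > 0"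
    then obtain A where A: "finite A" "A \<subseteq> mspace X" "\<And>q. q \<in> mspace P \<Longrightarrow> \<exists>x\<in>A. mdist P (\<iota> x) q < \<epsilon>"
      using finite_net by metis
    have "\<exists>a\<in>A. x \<in> X.mball a \<epsilon>" if "x \<in> mspace X" for x
      using A(3)[OF emb[OF that]] A(2) that by (auto simp: isometric subset_iff)
    then show "\<exists>K. finite K \<and> K \<subseteq> mspace X \<and> mspace X \<subseteq> (\<Union>x\<in>K. X.mball x \<epsilon>)"
      using A by (intro exI[of _ A]) auto
  qed
qed

lemma locally_compact: "locally_compact_space (mtopology_of X)"
proof -
  interpret P: Metric_space "mspace P" "mdist P" by simp
  have "Hausdorff_space (mtopology_of P)"
    unfolding mtopology_of_def by (rule P.Hausdorff_space_mtopology)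
  then have "locally_compact_space (subtopology (mtopology_of P) (\<iota> ` mspace X))"
    using compact open_image
    by (intro locally_compact_space_open_subset compact_imp_locally_compact_space) auto
  moreover have "mtopology_of X homeomorphic_space subtopology (mtopology_of P) (\<iota> ` mspace X)"
    using embedding_map_imp_homeomorphic_space[OF embedding_map_iota] by simp
  ultimately show ?thesis
    using homeomorphic_locally_compact_space by blast
qed

end

lemma metric_compactification_exists:
  fixes X :: "'a metric"
  assumes tb: "Metric_space.mtotally_bounded (mspace X) (mdist X) (mspace X)"
    and lc: "locally_compact_space (mtopology_of X)"
  shows "\<exists>(P :: ('a \<Rightarrow> real) metric) \<iota>. metric_compactification X P \<iota>"
proof -
  interpret X: Metric_space "mspace X" "mdist X" by simp
  obtain f :: "'a \<Rightarrow> 'a \<Rightarrow> real" and P where P: "mcomplete_of P" "f \<in> mspace X \<rightarrow> mspace P"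
    "mtopology_of P closure_of f ` mspace X = mspace P"
    "\<And>x y. x \<in> mspace X \<Longrightarrow> y \<in> mspace X \<Longrightarrow> mdist P (f x) (f y) = mdist X x y"
    using X.metric_completion by metis
  interpret P: Metric_space "mspace P" "mdist P" by simp
  interpret XP: Metric_space12 "mspace X" "mdist X" "mspace P" "mdist P" ..
  have "Lipschitz_continuous_map X P f"
    unfolding Lipschitz_continuous_map_def using P(2,4) by (auto intro!: exI[of _ 1])
  then have "P.mtotally_bounded (f ` mspace X)"
    using mtotally_bounded_Cauchy_continuous_image[OF Lipschitz_imp_Cauchy_continuous_map] tb by blast
  then have "P.mtotally_bounded (mspace P)"
    using P.mtotally_bounded_closure_of P(3) by (fastforce simp: mtopology_of_def)
  then have compact: "compact_space (mtopology_of P)"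
    using P(1) P.compact_space_eq_mcomplete_mtotally_bounded by (simp add: mtopology_of_def mcomplete_of_def)
  have emb: "embedding_map (mtopology_of X) (mtopology_of P) f"
    unfolding mtopology_of_def by (rule XP.isometry_imp_embedding_map) (use P in auto)
  have "locally_compact_space (subtopology (mtopology_of P) (f ` mspace X))"
    using embedding_map_imp_homeomorphic_space[OF emb] homeomorphic_locally_compact_space lc by fastforce
  \<comment> \<open>Here local compactness enters: a dense locally compact subspace of a Hausdorff
    space is open.\<close>
  then have op: "openin (mtopology_of P) (f ` mspace X)"
    using P.Hausdorff_space_mtopology P(2,3)
    by (intro dense_locally_compact_openin_Hausdorff_space) (auto simp: mtopology_of_def)
  have "metric_compactification X P f"
  proof
    fix p and \<epsilon> :: real assume "p \<in> mspace P" "\<epsilon> > 0"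
    then have "p \<in> P.mtopology closure_of f ` mspace X"
      using P(3) by (simp add: mtopology_of_def)
    then show "\<exists>x\<in>mspace X. mdist P (f x) p < \<epsilon>"
      unfolding P.metric_closure_of using \<open>\<epsilon> > 0\<close> by (auto simp: mdist_commute)
  qed (use P compact op in auto)
  then show ?thesis by blast
qed

section \<open>Every continuous map of boundaries is the limit of a coarse map\<close>

context compactification_pair
begin

lemma corona_limit_surj:
  assumes g: "uniformly_continuous_map (submetric P X.bd) (submetric Q Y.bd) g" and "mspace Y \<noteq> {}"
  shows "\<exists>f\<in>coarse. corona_limit f g"
proof (cases "X.bd = {}")
  \<comment> \<open>Here \<open>X\<close> is compact and the limit condition is vacuous, so a
    constant map will do; its value comes from \<open>mspace Y \<noteq> {}\<close>.\<close>
  case True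
  obtain y where y: "y \<in> mspace Y" using \<open>mspace Y \<noteq> {}\<close> by blast
  have lim: "corona_limit (\<lambda>x\<in>mspace X. y) g"
    using True by (auto simp: corona_limit_def X.boundary_limit_def intro: exI[of _ 1])
  have "compactin (mtopology_of Y) {y}"
    using y by (intro finite_imp_compactin) auto
  then obtain \<delta> where "\<delta> > 0" "\<not> Y.near \<delta> y"
    using Y.compactin_imp_far by blast
  then have "(\<lambda>x\<in>mspace X. y) \<in> coarse"
    using y by (intro coarseI[OF _ lim]) auto
  then show ?thesis using lim by blast
next
  case False
  have gim: "g \<in> X.bd \<rightarrow> Y.bd"
    using uniformly_continuous_map_funspace[OF g] X.bd_mspace by auto
  have inv_mono: "inverse (real (Suc m)) \<le> inverse (Suc k)" if "k \<le> m" for k m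
    using that by (simp add: field_simps)
  \<comment> \<open>\<open>N x\<close> measures closeness to \<open>X.bd\<close>: by
    \<open>near_N\<close>, \<open>k < N x\<close> means that \<open>x\<close> is
    \<open>inverse (Suc k)\<close>-near. So if \<open>N x = Suc m\<close>, some boundary point lies
    within \<open>inverse (Suc m)\<close> of \<open>x\<close>; if \<open>N x = 0\<close>, any
    boundary point may serve as \<open>p x\<close>.\<close>
  define N where "N x = (LEAST n. \<not> X.near (inverse (Suc n)) x)" for x
  have N: "\<not> X.near (inverse (Suc (N x))) x" if "x \<in> mspace X" for x
  proof -
    have "compactin (mtopology_of X) {x}"
      using that by (intro finite_imp_compactin) auto
    then obtain \<delta> where \<delta>: "\<delta> > 0" "\<not> X.near \<delta> x"
      using X.compactin_imp_far by blast
    obtain n where "inverse (Suc n) < \<delta>"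
      using reals_Archimedean[OF \<delta>(1)] by blast
    then have "\<not> X.near (inverse (Suc n)) x"
      using \<delta>(2) X.near_mono less_imp_le by blast
    then show ?thesis unfolding N_def by (rule LeastI)
  qed
  have near_N: "X.near (inverse (Suc k)) x \<longleftrightarrow> k < N x" if x: "x \<in> mspace X" for x k
  proof
    show "X.near (inverse (Suc k)) x" if "k < N x"
      using not_less_Least[OF that[unfolded N_def]] by blast
    show "k < N x" if "X.near (inverse (Suc k)) x"
      using N[OF x] X.near_mono[OF that inv_mono] not_less by blast
  qed
  have "\<exists>p. p \<in> X.bd \<and> (\<forall>m. N x = Suc m \<longrightarrow> mdist P (\<iota> x) p < inverse (Suc m))" if x: "x \<in> mspace X" for x
    using near_N[OF x] False by (cases "N x") (auto simp: X.near_def)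
  then obtain p where p: "\<And>x. x \<in> mspace X \<Longrightarrow> p x \<in> X.bd"
    "\<And>x m. x \<in> mspace X \<Longrightarrow> N x = Suc m \<Longrightarrow> mdist P (\<iota> x) (p x) < inverse (Suc m)"
    by metis
  text \<open>The values at level \<open>n\<close> are taken from a finite set, so that \<open>f\<close> maps sets away from \<open>X.bd\<close> to
    bounded sets.\<close>
  have "\<exists>A. finite A \<and> A \<subseteq> mspace Y \<and> (\<forall>q\<in>mspace Q. \<exists>y\<in>A. mdist Q (\<kappa> y) q < inverse (Suc n))" for n
    by (rule Y.finite_net) simp
  then obtain A where A: "\<And>n. finite (A n)" "\<And>n. A n \<subseteq> mspace Y"
    "\<And>n q. q \<in> mspace Q \<Longrightarrow> \<exists>y\<in>A n. mdist Q (\<kappa> y) q < inverse (Suc n)"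
    by metis
  have "\<exists>y. y \<in> A (N x) \<and> mdist Q (\<kappa> y) (g (p x)) < inverse (Suc (N x))" if "x \<in> mspace X" for x
    using A(3)[of "g (p x)" "N x"] p(1)[OF that] gim Y.bd_mspace by blast
  then obtain f0 where f0: "\<And>x. x \<in> mspace X \<Longrightarrow> f0 x \<in> A (N x)"
    "\<And>x. x \<in> mspace X \<Longrightarrow> mdist Q (\<kappa> (f0 x)) (g (p x)) < inverse (Suc (N x))"
    by metis
  define f where "f = restrict f0 (mspace X)"
  have f: "f x \<in> A (N x)" "mdist Q (\<kappa> (f x)) (g (p x)) < inverse (Suc (N x))" if "x \<in> mspace X" for x
    using f0 that by (auto simp: f_def)
  have fim: "f \<in> mspace X \<rightarrow>\<^sub>E mspace Y"
    using f0(1) A(2) by (auto simp: f_def)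
  have "X.boundary_limit Q (\<lambda>x. \<kappa> (f x)) g"
    unfolding X.boundary_limit_def
  proof (intro allI impI)
    fix \<epsilon> :: real assume "\<epsilon> > 0"
    then have "\<epsilon>/2 > 0" by simp
    have "X.bd \<inter> mspace P = X.bd"
      using X.bd_mspace by blast
    with g \<open>\<epsilon>/2 > 0\<close> obtain \<delta> where \<delta>: "\<delta> > 0" "\<And>q p. q \<in> X.bd \<Longrightarrow> p \<in> X.bd \<Longrightarrow> mdist P q p < \<delta> \<Longrightarrow> mdist Q (g q) (g p) < \<epsilon>/2"
      unfolding uniformly_continuous_map_def mspace_submetric mdist_submetric by metis
    \<comment> \<open>The term \<open>\<delta>/2\<close> brings \<open>p x\<close> within
      \<open>\<delta>\<close> of \<open>q\<close> by way of \<open>x\<close>, so that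
      \<open>g (p x)\<close> and \<open>g q\<close> differ by less than \<open>\<epsilon>/2\<close>;
      the term \<open>\<epsilon>/2\<close> bounds the mesh of the net at level
      \<open>N x\<close>.\<close>
    have "min (\<epsilon>/2) (\<delta>/2) > 0" using \<delta>(1) \<open>\<epsilon>/2 > 0\<close> by simp
    then obtain k where k: "inverse (Suc k) < min (\<epsilon>/2) (\<delta>/2)"
      using reals_Archimedean by blast
    have "mdist Q (\<kappa> (f x)) (g q) < \<epsilon>" if x: "x \<in> mspace X" and q: "q \<in> X.bd" and d: "mdist P (\<iota> x) q < inverse (Suc k)" for x q
    proof -
      have "k < N x"
        using X.nearI[OF q d] near_N[OF x] by blast
      then obtain m where m: "N x = Suc m" "k \<le> m" by (cases "N x") auto
      have "mdist P (\<iota> x) (p x) < \<delta>/2" "mdist P (\<iota> x) q < \<delta>/2" "inverse (Suc (N x)) < \<epsilon>/2"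
        using p(2)[OF x m(1)] inv_mono[OF m(2)] inv_mono[of k "N x"] \<open>k < N x\<close> d k by linarith+
      moreover have "mdist P (p x) q \<le> mdist P (p x) (\<iota> x) + mdist P (\<iota> x) q"
        using x q p(1)[OF x] by (intro mdist_triangle) (auto intro: X.emb X.bd_mspace)
      ultimately have "mdist P (p x) q < \<delta>" "mdist Q (\<kappa> (f x)) (g (p x)) < \<epsilon>/2"
        using f(2)[OF x] mdist_commute[of P "p x" "\<iota> x"] by linarith+
      moreover from this have "mdist Q (g (p x)) (g q) < \<epsilon>/2"
        using q p(1)[OF x] by (intro \<delta>(2))
      moreover have "mdist Q (\<kappa> (f x)) (g q) \<le> mdist Q (\<kappa> (f x)) (g (p x)) + mdist Q (g (p x)) (g q)"
        using x q p(1)[OF x] gim fim Y.bd_mspace by (intro mdist_triangle Y.emb) auto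
      ultimately show ?thesis by linarith
    qed
    then show "\<exists>\<delta>>0. \<forall>x\<in>mspace X. \<forall>p\<in>X.bd. mdist P (\<iota> x) p < \<delta> \<longrightarrow> mdist Q (\<kappa> (f x)) (g p) < \<epsilon>"
      by (intro exI[of _ "inverse (Suc k)"]) auto
  qed
  then have lim: "corona_limit f g"
    using gim by (simp add: corona_limit_def)
  have "\<exists>\<delta>'>0. \<forall>x\<in>mspace X. Y.near \<delta>' (f x) \<longrightarrow> X.near \<delta> x" if "\<delta> > 0" for \<delta>
  proof -
    obtain k where k: "inverse (Suc k) < \<delta>"
      using reals_Archimedean[OF \<open>\<delta> > 0\<close>] by blast
    have comp: "compactin (mtopology_of Y) (\<Union>n\<le>k. A n)"
      by (rule finite_imp_compactin) (use A(1,2) in fastforce, simp add: A(1))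
    obtain \<delta>' where \<delta>': "\<delta>' > 0" "\<And>y. y \<in> (\<Union>n\<le>k. A n) \<Longrightarrow> \<not> Y.near \<delta>' y"
      using Y.compactin_imp_far[OF comp] by metis
    have "X.near \<delta> x" if x: "x \<in> mspace X" and near: "Y.near \<delta>' (f x)" for x
    proof -
      have "k < N x"
        using \<delta>'(2)[of "f x"] f(1)[OF x] near by (meson UN_I atMost_iff not_less)
      then show ?thesis
        using near_N[OF x] X.near_mono k less_imp_le by blast
    qed
    then show ?thesis using \<delta>'(1) by blast
  qed
  then have "f \<in> coarse"
    by (rule coarseI[OF fim lim])
  then show ?thesis using lim by blast
qed

end

section \<open>The homomorphism and the map of coronas induced by a coarse map\<close>

locale higson_pair = X: higson_metric X P + Y: higson_metric Y Q
  for X :: "'a metric" and P and Y :: "'b metric" and Q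
begin

sublocale compactification_pair X P "higson_embedding X" Y Q "higson_embedding Y" ..

lemma corona_limit_continuous:
  assumes "f \<in> coarse" and "corona_limit f g"
  shows "uniformly_continuous_map (submetric P X.bd) (submetric Q Y.bd) g"
proof -
  have "(\<lambda>x. higson_embedding Y (f x)) \<in> mspace X \<rightarrow> mspace Q"
    using coarse_funcset[OF assms(1)] Y.emb by auto
  then show ?thesis
    using X.boundary_limit_continuous[of Q "\<lambda>x. higson_embedding Y (f x)" g] assms(2) X.bd_mspace Y.bd_mspace
    by (force simp: uniformly_continuous_map_into_submetric corona_limit_def)
qed

lemma restrict_continuous_maps:
  assumes "f \<in> coarse" and "corona_limit f g"
  shows "restrict g X.bd \<in> continuous_maps (higson_corona X) (higson_corona Y)"
proof -
  have "continuous_map (higson_corona X) (higson_corona Y) g"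
    unfolding X.corona_metric Y.corona_metric
    by (rule uniformly_continuous_imp_continuous_map[OF corona_limit_continuous[OF assms]])
  then have "continuous_map (higson_corona X) (higson_corona Y) (restrict g X.bd)"
    by (rule continuous_map_eq) (simp add: X.topspace_corona)
  then show ?thesis
    by (simp add: continuous_maps_def X.topspace_corona)
qed

text \<open>Since limits compose, \<open>\<phi> \<circ> f\<close> has as boundary limit the limit of
  \<open>\<phi>\<close> composed with \<open>g\<close>. The functions
  \<open>corona_function Y \<phi>\<close> exhaust C(\<nu>Y), which leaves only one
  candidate.\<close>

lemma corona_hom_eq:
  assumes f: "f \<in> coarse" and g: "corona_limit f g"
  shows "corona_hom X Y f = (\<lambda>h\<in>continuous_functions (higson_corona Y). compose X.bd h g)"
  unfolding corona_hom_def
proof (rule the_equality)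
  let ?T = "\<lambda>h\<in>continuous_functions (higson_corona Y). compose X.bd h g"
  have gim: "g \<in> X.bd \<rightarrow> Y.bd" using g by (simp add: corona_limit_def)
  have T: "?T (corona_function Y \<phi>) = corona_function X (compose (mspace X) \<phi> f)"
    "corona_function X (compose (mspace X) \<phi> f) \<in> continuous_functions (higson_corona X)"
    if \<phi>: "\<phi> \<in> Bh Y" for \<phi>
  proof -
    obtain \<psi> where \<psi>: "Y.boundary_limit euclidean_metric \<phi> \<psi>"
      using Y.Bh_imp_boundary_limit[OF \<phi>] ..
    have "X.boundary_limit euclidean_metric (\<lambda>x. \<phi> (f x)) (\<lambda>p. \<psi> (g p))"
      by (rule corona_limit_compose[OF g coarse_funcset[OF f] \<psi>])
    then have lim: "X.boundary_limit euclidean_metric (compose (mspace X) \<phi> f) (\<lambda>p. \<psi> (g p))"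
      by (rule X.boundary_limit_cong) (auto simp: compose_def)
    have "compose (mspace X) \<phi> f ` mspace X \<subseteq> \<phi> ` mspace Y"
      using coarse_funcset[OF f] by (auto simp: compose_def)
    then have "bounded (compose (mspace X) \<phi> f ` mspace X)"
      using \<phi> by (auto simp: Bh_def higson_functions_def intro: bounded_subset)
    then have Bh: "compose (mspace X) \<phi> f \<in> Bh X"
      unfolding X.Bh_iff_boundary_limit using lim by auto
    show "corona_function X (compose (mspace X) \<phi> f) \<in> continuous_functions (higson_corona X)"
      by (rule X.corona_function_continuous[OF Bh])
    have "compose X.bd (corona_function Y \<phi>) g = (\<lambda>p\<in>X.bd. \<psi> (g p))"
      unfolding Y.corona_function_eq[OF \<phi> \<psi>] compose_def using gim by (intro restrict_ext) auto
    then show "?T (corona_function Y \<phi>) = corona_function X (compose (mspace X) \<phi> f)"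
      using Y.corona_function_continuous[OF \<phi>] X.corona_function_eq[OF Bh lim] by simp
  qed
  show "?T \<in> continuous_functions (higson_corona Y) \<rightarrow>\<^sub>E continuous_functions (higson_corona X) \<and>
      (\<forall>\<phi>\<in>Bh Y. ?T (corona_function Y \<phi>) = corona_function X (compose (mspace X) \<phi> f))"
  proof (intro conjI ballI PiE_I)
    fix h assume "h \<in> continuous_functions (higson_corona Y)"
    then obtain \<phi> where "\<phi> \<in> Bh Y" "corona_function Y \<phi> = h"
      by (rule Y.corona_function_surj)
    then show "?T h \<in> continuous_functions (higson_corona X)"
      using T by metis
  qed (use T in auto)
  fix S assume S: "S \<in> continuous_functions (higson_corona Y) \<rightarrow>\<^sub>E continuous_functions (higson_corona X) \<and>
      (\<forall>\<phi>\<in>Bh Y. S (corona_function Y \<phi>) = corona_function X (compose (mspace X) \<phi> f))"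
  show "S = ?T"
  proof (rule extensionalityI)
    show "S \<in> extensional (continuous_functions (higson_corona Y))"
      using S by (simp add: PiE_iff)
    fix h assume "h \<in> continuous_functions (higson_corona Y)"
    then obtain \<phi> where "\<phi> \<in> Bh Y" "corona_function Y \<phi> = h"
      by (rule Y.corona_function_surj)
    then show "S h = ?T h"
      using T(1) S by metis
  qed simp
qed

text \<open>Uniqueness is tested on the functions \<open>\<lambda>p\<in>Y.bd. p \<psi>\<close> with
  \<open>\<psi> \<in> Ch Y\<close>: these are the coordinates of hY, and a point of the corona is
  determined by its coordinates.\<close>

lemma corona_map_eq:
  assumes f: "f \<in> coarse" and g: "corona_limit f g"
  shows "corona_map X Y f = restrict g X.bd"
  unfolding corona_map_def corona_hom_eq[OF f g] X.topspace_corona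
proof (rule the_equality)
  show "restrict g X.bd \<in> continuous_maps (higson_corona X) (higson_corona Y) \<and>
    (\<forall>h\<in>continuous_functions (higson_corona Y). compose X.bd h (restrict g X.bd) =
      (\<lambda>h\<in>continuous_functions (higson_corona Y). compose X.bd h g) h)"
    using restrict_continuous_maps[OF f g] by (auto simp: compose_def)
next
  have gim: "g \<in> X.bd \<rightarrow> Y.bd" using g by (simp add: corona_limit_def)
  fix k assume k: "k \<in> continuous_maps (higson_corona X) (higson_corona Y) \<and>
    (\<forall>h\<in>continuous_functions (higson_corona Y). compose X.bd h k =
      (\<lambda>h\<in>continuous_functions (higson_corona Y). compose X.bd h g) h)"
  have kim: "k \<in> X.bd \<rightarrow> Y.bd"
    using k continuous_map_funspace[of "higson_corona X" "higson_corona Y" k]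
    by (auto simp: continuous_maps_def X.topspace_corona Y.topspace_corona)
  have "k p = g p" if p: "p \<in> X.bd" for p
  proof (rule extensionalityI)
    show "k p \<in> extensional (Ch Y)" "g p \<in> extensional (Ch Y)"
      using Y.corona_extensional kim gim p by auto
    fix \<psi> assume "\<psi> \<in> Ch Y"
    then have "compose X.bd (\<lambda>p\<in>Y.bd. p \<psi>) k = compose X.bd (\<lambda>p\<in>Y.bd. p \<psi>) g"
      using k Y.coordinate_continuous_functions by simp
    then have "compose X.bd (\<lambda>p\<in>Y.bd. p \<psi>) k p = compose X.bd (\<lambda>p\<in>Y.bd. p \<psi>) g p"
      by (rule fun_cong)
    then show "k p \<psi> = g p \<psi>"
      using p kim gim by (auto simp: compose_def Pi_iff)
  qed
  moreover have "k \<in> extensional X.bd"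
    using k by (simp add: continuous_maps_def X.topspace_corona)
  ultimately show "k = restrict g X.bd"
    by (intro extensionalityI[of _ X.bd]) auto
qed

end

section \<open>Realizing compact metrizable spaces as coronas\<close>

text \<open>The level at height \<open>inverse (Suc n)\<close> is a finite net of the same mesh. The
  levels accumulate only at height 0, where they approach every point of \<open>m\<close>. Their
  union is countable and therefore fits into any infinite type \<open>'a\<close>.\<close>

lemma dense_discrete_compactification:
  fixes m :: "'k metric"
  assumes compact: "compact_space (mtopology_of m)" and ne: "mspace m \<noteq> {}"
    and inf: "infinite (UNIV :: 'a set)"
  shows "\<exists>(X :: 'a metric) (P :: ('k \<times> real) metric) \<iota>. mspace X \<noteq> {} \<and> metric_compactification X P \<iota> \<and>
    subtopology (mtopology_of P) (metric_compactification.bd X P \<iota>) homeomorphic_space mtopology_of m"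
proof -
  interpret m: Metric_space "mspace m" "mdist m" by simp
  let ?M = "mspace m" and ?T = "mtopology_of m"
  have Haus: "Hausdorff_space ?T"
    unfolding mtopology_of_def by (rule m.Hausdorff_space_mtopology)
  have tb: "m.mtotally_bounded ?M"
    using compact m.compact_space_eq_mcomplete_mtotally_bounded by (simp add: mtopology_of_def)
  have "\<exists>A. finite A \<and> A \<subseteq> ?M \<and> ?M \<subseteq> (\<Union>a\<in>A. m.mball a (inverse (Suc n)))" for n
    using tb[unfolded m.mtotally_bounded_def, rule_format, of "inverse (real (Suc n))"] by simp
  then obtain A where A: "\<And>n. finite (A n)" "\<And>n. A n \<subseteq> ?M"
    "\<And>n. ?M \<subseteq> (\<Union>a\<in>A n. m.mball a (inverse (Suc n)))"
    by metis
  define L where "L n = A n \<times> {inverse (real (Suc n))}" for n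
  define U where "U = (\<Union>n. L n)"
  define S where "S = U \<union> ?M \<times> {0}"
  define PM where "PM = prod_metric m (euclidean_metric :: real metric)"
  define P where "P = submetric PM S"
  have U_M: "U \<subseteq> ?M \<times> {0<..}"
    using A(2) by (auto simp: U_def L_def)
  have mspace_PM: "mspace PM = ?M \<times> UNIV"
    by (simp add: PM_def)
  have mspace_P: "mspace P = S"
    using U_M by (auto simp: P_def mspace_PM S_def)
  have mdist_P: "mdist P = mdist PM"
    by (simp add: P_def)
  have top_P: "mtopology_of P = subtopology (prod_topology ?T euclideanreal) S"
    by (simp add: P_def mtopology_of_submetric PM_def)
  have inv_mono: "inverse (real (Suc m)) \<le> inverse (Suc k)" if "k \<le> m" for k m
    using that by (simp add: field_simps)

  \<comment> \<open>Closedness of \<open>S\<close> is read off from this: above height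
    \<open>inverse (Suc N)\<close> only points of the finitely many levels below \<open>N\<close>
    occur, so each set in the intersection is a closed slab together with a finite set.\<close>
  have S_Inter: "S = (\<Inter>N. ?M \<times> {0..inverse (Suc N)} \<union> (\<Union>n<N. L n))" (is "S = ?I")
  proof (intro equalityI subsetI)
    fix z assume "z \<in> S"
    then consider "z \<in> ?M \<times> {0}" | n where "z \<in> L n" by (auto simp: S_def U_def)
    then show "z \<in> ?I"
    proof cases
      case 2
      have "z \<in> ?M \<times> {0..inverse (Suc N)}" if "N \<le> n" for N
        using 2 A(2)[of n] inv_mono[OF that] by (auto simp: L_def)
      then show ?thesis using 2 not_le by blast
    qed auto
  next
    fix z assume z: "z \<in> ?I"
    obtain t s where ts: "z = (t, s)" by (cases z)
    have ts0: "t \<in> ?M" "s \<ge> 0"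
      using z ts INT_D[OF z, of 0] by auto
    show "z \<in> S"
    proof (cases "s = 0")
      case True
      then show ?thesis using ts ts0 by (simp add: S_def)
    next
      case False
      then obtain N where "inverse (Suc N) < s"
        using reals_Archimedean[of s] ts0 by auto
      then show ?thesis
        using INT_D[OF z, of N] ts by (auto simp: S_def U_def)
    qed
  qed
  have "closedin (prod_topology ?T euclideanreal) (?M \<times> {0..inverse (Suc N)} \<union> (\<Union>n<N. L n))" for N
  proof (intro closedin_Un)
    have "closedin ?T ?M" using closedin_topspace[of ?T] by simp
    then show "closedin (prod_topology ?T euclideanreal) (?M \<times> {0..inverse (Suc N)})"
      by (auto simp: closedin_prod_Times_iff)
    have "finite (\<Union>n<N. L n)" "(\<Union>n<N. L n) \<subseteq> ?M \<times> UNIV"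
      using A(1,2) by (auto simp: L_def)
    then show "closedin (prod_topology ?T euclideanreal) (\<Union>n<N. L n)"
      using Haus by (intro compactin_imp_closedin finite_imp_compactin)
        (auto simp: Hausdorff_space_prod_topology)
  qed
  then have "closedin (prod_topology ?T euclideanreal) S"
    unfolding S_Inter by (intro closedin_INT) auto
  moreover have "compactin (prod_topology ?T euclideanreal) (?M \<times> {0..1})"
    using compact by (simp add: compactin_Times compact_space_def)
  moreover have "S \<subseteq> ?M \<times> {0..1}"
    using INT_lower[of 0 UNIV "\<lambda>N. ?M \<times> {0..inverse (real (Suc N))} \<union> (\<Union>n<N. L n)"] S_Inter by simp
  ultimately have "compactin (prod_topology ?T euclideanreal) S"
    using closed_compactin by blast
  then have compact_P: "compact_space (mtopology_of P)"
    unfolding top_P by (simp add: compact_space_subtopology)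

  have "countable U"
    unfolding U_def L_def
    by (intro countable_UN countableI_type countable_finite finite_cartesian_product A(1)) auto
  \<comment> \<open>The carrier of \<open>X\<close> must lie in the universe \<open>'a\<close>, so
    \<open>U\<close> is enumerated and then moved along an injection of \<open>nat\<close>.\<close>
  obtain e :: "nat \<Rightarrow> 'a" where "inj e"
    using infinite_countable_subset[OF inf] by blast
  define j where "j = e \<circ> to_nat_on U"
  have inj: "inj_on j U"
    unfolding j_def using \<open>inj e\<close> \<open>countable U\<close> by (intro comp_inj_on) (auto intro: inj_on_subset)
  have mspace_U: "mspace (submetric PM U) = U"
    using U_M by (auto simp: mspace_PM)
  define X where "X = image_metric (submetric PM U) j"
  define \<iota> where "\<iota> = inv_into U j"
  have mspace_X: "mspace X = j ` U"
    using mspace_image_metric[of j "submetric PM U"] inj mspace_U by (simp add: X_def)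
  have mdist_X: "mdist X (j u) (j v) = mdist PM u v" if "u \<in> U" "v \<in> U" for u v
    using mdist_image_metric[of j "submetric PM U" u v] that unfolding mspace_U by (simp add: X_def inj)
  have \<iota>_j: "\<iota> (j u) = u" if "u \<in> U" for u
    using inj that by (simp add: \<iota>_def)
  have \<iota>_image: "\<iota> ` mspace X = U"
    using \<iota>_j by (force simp: mspace_X)
  have comp: "metric_compactification X P \<iota>"
  proof
    fix x y assume "x \<in> mspace X"
    then show "\<iota> x \<in> mspace P" using \<iota>_image by (auto simp: mspace_P S_def)
    assume "y \<in> mspace X"
    with \<open>x \<in> mspace X\<close> show "mdist P (\<iota> x) (\<iota> y) = mdist X x y"
      by (auto simp: mspace_X mdist_X \<iota>_j mdist_P)
  next
    fix p and \<epsilon> :: real assume p: "p \<in> mspace P" and "\<epsilon> > 0"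
    have "\<exists>u\<in>U. mdist P u p < \<epsilon>"
    proof (cases "p \<in> U")
      case True
      then show ?thesis
        using p \<open>\<epsilon> > 0\<close> by (intro bexI[of _ p]) (auto simp: Metric_space.mdist_zero[OF Metric_space_mspace_mdist])
    next
      case False
      then obtain t where t: "p = (t, 0)" "t \<in> ?M" using p by (auto simp: mspace_P S_def)
      \<comment> \<open>One half of \<open>\<epsilon>\<close> pays for the mesh of level
        \<open>n\<close>, the other for its height.\<close>
      obtain n where n: "inverse (Suc n) < \<epsilon>/2" using reals_Archimedean[of "\<epsilon>/2"] \<open>\<epsilon> > 0\<close> by auto
      obtain a where a: "a \<in> A n" "mdist m a t < inverse (Suc n)" using A(3)[of n] t(2) by auto
      let ?u = "(a, inverse (real (Suc n)))"
      have "mdist P ?u p \<le> mdist m a t + dist (inverse (real (Suc n))) 0"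
        using a t A(2)[of n] Metric_space12.prod_metric_le_components
            [OF Metric_space12_mspace_mdist, of a m t "inverse (real (Suc n))" euclidean_metric 0]
        by (auto simp: mdist_P PM_def)
      also have "\<dots> < \<epsilon>" using a(2) n by (simp add: dist_real_def)
      finally show ?thesis using a(1) by (intro bexI[of _ ?u]) (auto simp: U_def L_def)
    qed
    then show "\<exists>x\<in>mspace X. mdist P (\<iota> x) p < \<epsilon>"
      using \<iota>_image by (metis imageE)
  next
    have "openin (prod_topology ?T euclideanreal) (?M \<times> {0<..})"
      using openin_topspace[of ?T] by (simp add: openin_prod_Times_iff)
    moreover have "U = S \<inter> (?M \<times> {0<..})"
      using U_M by (auto simp: S_def)
    ultimately show "openin (mtopology_of P) (\<iota> ` mspace X)"
      unfolding \<iota>_image top_P openin_subtopology by blast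
  qed (rule compact_P)
  have bd: "metric_compactification.bd X P \<iota> = ?M \<times> {0}"
    unfolding metric_compactification.bd_def[OF comp] \<iota>_image mspace_P using U_M by (auto simp: S_def)
  have "homeomorphic_maps (subtopology (mtopology_of P) (?M \<times> {0})) ?T fst (\<lambda>t. (t, 0))"
    unfolding homeomorphic_maps_def top_P subtopology_subtopology
  proof (intro conjI ballI)
    show "continuous_map (subtopology (prod_topology ?T euclideanreal) (S \<inter> ?M \<times> {0})) ?T fst"
      by (rule continuous_map_from_subtopology[OF continuous_map_fst])
    have "continuous_map ?T (prod_topology ?T euclideanreal) (\<lambda>t. (t, 0))"
      by (simp add: continuous_map_paired)
    then show "continuous_map ?T (subtopology (prod_topology ?T euclideanreal) (S \<inter> ?M \<times> {0})) (\<lambda>t. (t, 0))"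
      by (rule continuous_map_into_subtopology) (auto simp: S_def)
  qed auto
  then have "subtopology (mtopology_of P) (metric_compactification.bd X P \<iota>) homeomorphic_space ?T"
    unfolding bd by (rule homeomorphic_maps_imp_homeomorphic_space)
  moreover have "A 0 \<noteq> {}" using A(3)[of 0] ne by auto
  then have "mspace X \<noteq> {}" by (auto simp: mspace_X U_def L_def)
  ultimately show ?thesis using comp by blast
qed

lemma realize_corona:
  fixes T :: "'k topology"
  assumes T: "compact_space T" "metrizable_space T" and inf: "infinite (UNIV :: 'a set)"
  shows "\<exists>X :: 'a metric. mspace X \<noteq> {} \<and> Metric_space.mtotally_bounded (mspace X) (mdist X) (mspace X) \<and>
    locally_compact_space (mtopology_of X) \<and> higson_corona X homeomorphic_space T"
proof (cases "topspace T = {}")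
  \<comment> \<open>The construction by nets requires a nonempty space. The empty corona comes from
    a one-point space, which is its own compactification.\<close>
  case True
  fix a :: 'a
  let ?X = "image_metric (submetric euclidean_metric {0 :: real}) (\<lambda>_. a)"
  have X: "mspace ?X = {a}" by (subst mspace_image_metric) auto
  interpret metric_compactification ?X ?X id
  proof
    show "compact_space (mtopology_of ?X)"
      unfolding compact_space_def using X by (intro finite_imp_compactin) auto
    show "openin (mtopology_of ?X) (id ` mspace ?X)"
      using openin_topspace[of "mtopology_of ?X"] by simp
    show "\<exists>x\<in>mspace ?X. mdist ?X (id x) p < \<epsilon>" if "p \<in> mspace ?X" "\<epsilon> > 0" for p \<epsilon>
      using that by (intro bexI[of _ p]) (auto simp: Metric_space.mdist_zero[OF Metric_space_mspace_mdist])
  qed auto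
  have "topspace (higson_corona ?X) = {}"
    using homeomorphic_imp_surjective_map[OF homeomorphic_map_to_higson_corona] by (auto simp: bd_def)
  then have "higson_corona ?X homeomorphic_space T"
    using True homeomorphic_empty_space_eq by (metis null_topspace_iff_trivial)
  then show ?thesis
    using totally_bounded locally_compact X by blast
next
  case False
  obtain M d where "Metric_space M d" and Td: "T = Metric_space.mtopology M d"
    using T(2) unfolding metrizable_space_def by blast
  interpret Metric_space M d by fact
  have T_m: "mtopology_of (metric (M, d)) = T" by (simp add: Td)
  have "mspace (metric (M, d)) \<noteq> {}" using False by (simp add: Td)
  then obtain X :: "'a metric" and P :: "('k \<times> real) metric" and \<iota> where X: "mspace X \<noteq> {}" "metric_compactification X P \<iota>"
    and hom: "subtopology (mtopology_of P) (metric_compactification.bd X P \<iota>) homeomorphic_space T"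
    using dense_discrete_compactification[of "metric (M, d)", where 'a='a] inf T(1) unfolding T_m by blast
  interpret X: metric_compactification X P \<iota> by fact
  have "higson_corona X homeomorphic_space T"
    using homeomorphic_map_imp_homeomorphic_space[OF X.homeomorphic_map_to_higson_corona] hom
      homeomorphic_space_sym homeomorphic_space_trans by blast
  then show ?thesis
    using X.totally_bounded X.locally_compact X(1) by blast
qed

section \<open>The equivalence of categories\<close>

lemma coarse_maps_id: "(\<lambda>x\<in>mspace X. x) \<in> coarse_maps (mspace X) (C0_coarse X) (mspace X) (C0_coarse X)"
proof -
  have "mspace X \<inter> (\<lambda>x\<in>mspace X. x) -` B = B" if "coarse_bounded (C0_coarse X) B" for B
    using that by (auto simp: coarse_bounded_def C0_coarse_iff)
  moreover have "map_prod (\<lambda>x\<in>mspace X. x) (\<lambda>x\<in>mspace X. x) ` E = id ` E"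
    if "E \<in> C0_coarse X" for E
    by (rule image_cong) (use that in \<open>auto simp: C0_coarse_iff\<close>)
  ultimately show ?thesis
    by (auto simp: coarse_maps_def coarse_proper_def bornologous_def)
qed

lemma coarse_maps_compose:
  assumes f: "f \<in> coarse_maps (mspace X) (C0_coarse X) (mspace Y) (C0_coarse Y)"
    and g: "g \<in> coarse_maps (mspace Y) (C0_coarse Y) (mspace Z) (C0_coarse Z)"
  shows "compose (mspace X) g f \<in> coarse_maps (mspace X) (C0_coarse X) (mspace Z) (C0_coarse Z)"
proof -
  let ?c = "compose (mspace X) g f"
  have fim: "f \<in> mspace X \<rightarrow> mspace Y" and gim: "g \<in> mspace Y \<rightarrow> mspace Z"
    using f g by (auto simp: coarse_maps_def)
  have "coarse_bounded (C0_coarse X) (mspace X \<inter> ?c -` B)" if "coarse_bounded (C0_coarse Z) B" for B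
  proof -
    have "coarse_bounded (C0_coarse X) (mspace X \<inter> f -` (mspace Y \<inter> g -` B))"
      using f g that by (auto simp: coarse_maps_def coarse_proper_def)
    moreover have "mspace X \<inter> f -` (mspace Y \<inter> g -` B) = mspace X \<inter> ?c -` B"
      using fim by (auto simp: compose_def)
    ultimately show ?thesis by simp
  qed
  moreover have "map_prod ?c ?c ` E \<in> C0_coarse Z" if E: "E \<in> C0_coarse X" for E
  proof -
    have "map_prod g g ` map_prod f f ` E \<in> C0_coarse Z"
      using f g that by (auto simp: coarse_maps_def bornologous_def)
    moreover have "map_prod g g ` map_prod f f ` E = map_prod ?c ?c ` E"
      unfolding image_image by (rule image_cong) (use E in \<open>auto simp: C0_coarse_iff compose_def\<close>)
    ultimately show ?thesis by simp
  qed
  moreover have "?c \<in> mspace X \<rightarrow>\<^sub>E mspace Z"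
    using fim gim by (auto simp: compose_def)
  ultimately show ?thesis
    by (auto simp: coarse_maps_def coarse_proper_def bornologous_def)
qed

text \<open>Reflexivity, symmetry and transitivity come from the diagonal, inverses and compositions
  of controlled sets; local compactness of \<open>Y\<close> is what makes \<open>C0_coarse Y\<close>
  a coarse structure.\<close>

lemma equiv_closeness:
  assumes "locally_compact_space (mtopology_of Y)"
  shows "equiv (coarse_maps (mspace X) (C0_coarse X) (mspace Y) (C0_coarse Y)) (closeness X Y)"
    (is "equiv ?C _")
proof -
  have cs: "coarse_structure (mspace Y) (C0_coarse Y)"
    by (rule coarse_structure_C0_coarse[OF assms])
  have down: "E \<in> C0_coarse Y \<Longrightarrow> D \<subseteq> E \<Longrightarrow> D \<in> C0_coarse Y"
    and conv: "E \<in> C0_coarse Y \<Longrightarrow> E\<inverse> \<in> C0_coarse Y"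
    and comp: "E \<in> C0_coarse Y \<Longrightarrow> F \<in> C0_coarse Y \<Longrightarrow> E O F \<in> C0_coarse Y"
    and diag: "Id_on (mspace Y) \<in> C0_coarse Y" for D E F
    using cs unfolding coarse_structure_def by blast+
  have refl: "close_maps (mspace X) (C0_coarse Y) f f" if "f \<in> ?C" for f
    unfolding close_maps_def by (rule down[OF diag]) (use that in \<open>auto simp: coarse_maps_def Id_on_def\<close>)
  have sym: "close_maps (mspace X) (C0_coarse Y) g f" if "close_maps (mspace X) (C0_coarse Y) f g" for f g
    using conv[OF that[unfolded close_maps_def]] unfolding close_maps_def by (rule down) auto
  have trans: "close_maps (mspace X) (C0_coarse Y) f h"
    if "close_maps (mspace X) (C0_coarse Y) f g" "close_maps (mspace X) (C0_coarse Y) g h" for f g h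
    using comp[OF that[unfolded close_maps_def]] unfolding close_maps_def by (rule down) auto
  show ?thesis
  proof (intro equivI)
    show "closeness X Y \<subseteq> ?C \<times> ?C" "refl_on ?C (closeness X Y)"
      using refl by (auto simp: closeness_def refl_on_def)
    show "sym (closeness X Y)"
      using sym by (auto simp: closeness_def sym_def)
    show "trans (closeness X Y)"
      using trans unfolding closeness_def trans_def by blast
  qed
qed

lemma close_maps_compose:
  assumes lc: "locally_compact_space (mtopology_of Z)"
    and f: "(f, f') \<in> closeness X Y" and g: "(g, g') \<in> closeness Y Z"
  shows "(compose (mspace X) g f, compose (mspace X) g' f') \<in> closeness X Z"
proof -
  have fim: "f \<in> mspace X \<rightarrow> mspace Y" "f' \<in> mspace X \<rightarrow> mspace Y"
    using f by (auto simp: closeness_def coarse_maps_def)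
  have "map_prod g g ` (\<lambda>s. (f s, f' s)) ` mspace X \<in> C0_coarse Z"
    using f g by (auto simp: closeness_def close_maps_def coarse_maps_def bornologous_def)
  \<comment> \<open>Pass from \<open>g \<circ> f\<close> to \<open>g \<circ> f'\<close> because
    \<open>g\<close> is bornologous, then to \<open>g' \<circ> f'\<close> because \<open>g\<close>
    and \<open>g'\<close> are close.\<close>
  then have "(map_prod g g ` (\<lambda>s. (f s, f' s)) ` mspace X) O ((\<lambda>s. (g s, g' s)) ` mspace Y) \<in> C0_coarse Z"
    using g by (intro C0_coarse_comp[OF lc]) (auto simp: closeness_def close_maps_def)
  moreover have "(\<lambda>s. (compose (mspace X) g f s, compose (mspace X) g' f' s)) ` mspace X \<subseteq>
      (map_prod g g ` (\<lambda>s. (f s, f' s)) ` mspace X) O ((\<lambda>s. (g s, g' s)) ` mspace Y)"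
    using fim by (auto simp: compose_def relcomp_unfold image_iff map_prod_def)
  ultimately have "close_maps (mspace X) (C0_coarse Z) (compose (mspace X) g f) (compose (mspace X) g' f')"
    unfolding close_maps_def
    using coarse_structure_C0_coarse[OF lc] unfolding coarse_structure_def by blast
  then show ?thesis
    using f g coarse_maps_compose by (auto simp: closeness_def)
qed

section \<open>The categories and the objects of the corona functor\<close>

lemma TB_cat_ob: "X \<in> ob TB_cat \<longleftrightarrow> mspace X \<noteq> {} \<and>
    Metric_space.mtotally_bounded (mspace X) (mdist X) (mspace X) \<and> locally_compact_space (mtopology_of X)"
  by (simp add: TB_cat_def)

lemma TB_cat_homE:
  assumes "F \<in> hom TB_cat X Y"
  obtains f where "f \<in> coarse_maps (mspace X) (C0_coarse X) (mspace Y) (C0_coarse Y)" "F = closeness X Y `` {f}"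
  using assms by (auto simp: TB_cat_def elim: quotientE)

lemma TB_cat_homI:
  "f \<in> coarse_maps (mspace X) (C0_coarse X) (mspace Y) (C0_coarse Y) \<Longrightarrow> closeness X Y `` {f} \<in> hom TB_cat X Y"
  by (auto simp: TB_cat_def intro: quotientI)

text \<open>Composition is defined as a union over all representatives; it collapses to one class
  because other representatives give a close composite.\<close>

lemma TB_cat_cmp:
  assumes XYZ: "X \<in> ob TB_cat" "Y \<in> ob TB_cat" "Z \<in> ob TB_cat"
    and f: "f \<in> coarse_maps (mspace X) (C0_coarse X) (mspace Y) (C0_coarse Y)"
    and g: "g \<in> coarse_maps (mspace Y) (C0_coarse Y) (mspace Z) (C0_coarse Z)"
  shows "cmp TB_cat X Y Z (closeness Y Z `` {g}) (closeness X Y `` {f}) =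
    closeness X Z `` {compose (mspace X) g f}"
proof -
  have eq: "closeness X Z `` {compose (mspace X) g' f'} = closeness X Z `` {compose (mspace X) g f}"
    if "f' \<in> closeness X Y `` {f}" "g' \<in> closeness Y Z `` {g}" for f' g'
    using close_maps_compose[of Z f f' X Y g g'] that XYZ equiv_class_eq[OF equiv_closeness]
    by (fastforce simp: TB_cat_ob)
  have "f \<in> closeness X Y `` {f}" "g \<in> closeness Y Z `` {g}"
    using equiv_class_self[OF equiv_closeness] XYZ f g by (auto simp: TB_cat_ob)
  then show ?thesis
    using eq unfolding TB_cat_def cat.simps by blast
qed

lemma category_TB_cat: "category TB_cat"
  unfolding category_def
proof (intro conjI ballI)
  have ident: "ident TB_cat X = closeness X X `` {\<lambda>x\<in>mspace X. x}" for X :: "'a metric"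
    by (simp add: TB_cat_def)
  {
    fix X :: "'a metric"
    show "ident TB_cat X \<in> hom TB_cat X X"
      unfolding ident by (rule TB_cat_homI[OF coarse_maps_id])
  next
    fix X Y Z :: "'a metric" and F G
    assume "X \<in> ob TB_cat" "Y \<in> ob TB_cat" "Z \<in> ob TB_cat" "F \<in> hom TB_cat X Y" "G \<in> hom TB_cat Y Z"
    then show "cmp TB_cat X Y Z G F \<in> hom TB_cat X Z"
      by (elim TB_cat_homE) (simp add: TB_cat_cmp TB_cat_homI coarse_maps_compose)
  next
    fix X Y :: "'a metric" and F
    assume XY: "X \<in> ob TB_cat" "Y \<in> ob TB_cat" and "F \<in> hom TB_cat X Y"
    then obtain f where f: "f \<in> coarse_maps (mspace X) (C0_coarse X) (mspace Y) (C0_coarse Y)"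
      "F = closeness X Y `` {f}" by (elim TB_cat_homE)
    then have ext: "f \<in> extensional (mspace X)" "f \<in> mspace X \<rightarrow> mspace Y" by (auto simp: coarse_maps_def PiE_def)
    show "cmp TB_cat X X Y F (ident TB_cat X) = F"
      using f ext by (simp add: ident TB_cat_cmp XY coarse_maps_id compose_Id)
    show "cmp TB_cat X Y Y (ident TB_cat Y) F = F"
      using f ext by (simp add: ident TB_cat_cmp XY coarse_maps_id Id_compose)
  next
    fix W X Y Z :: "'a metric" and F G H
    assume ob: "W \<in> ob TB_cat" "X \<in> ob TB_cat" "Y \<in> ob TB_cat" "Z \<in> ob TB_cat"
      and "F \<in> hom TB_cat W X" "G \<in> hom TB_cat X Y" "H \<in> hom TB_cat Y Z"
    then obtain f g h where f: "f \<in> coarse_maps (mspace W) (C0_coarse W) (mspace X) (C0_coarse X)"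
        "F = closeness W X `` {f}"
      and g: "g \<in> coarse_maps (mspace X) (C0_coarse X) (mspace Y) (C0_coarse Y)" "G = closeness X Y `` {g}"
      and h: "h \<in> coarse_maps (mspace Y) (C0_coarse Y) (mspace Z) (C0_coarse Z)" "H = closeness Y Z `` {h}"
      by (elim TB_cat_homE)
    have "f \<in> mspace W \<rightarrow> mspace X" using f by (auto simp: coarse_maps_def)
    then have "compose (mspace W) h (compose (mspace W) g f) = compose (mspace W) (compose (mspace X) h g) f"
      by (auto simp: compose_def Pi_iff)
    then show "cmp TB_cat W Y Z H (cmp TB_cat W X Y G F) = cmp TB_cat W X Z (cmp TB_cat X Y Z H G) F"
      using f g h by (simp add: TB_cat_cmp ob coarse_maps_compose)
  }
qed

lemma category_K_cat: "category (K_cat :: ('b topology, 'b \<Rightarrow> 'b) cat)"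
proof -
  have compose: "compose (topspace S) g f \<in> continuous_maps S U"
    if "f \<in> continuous_maps S T" "g \<in> continuous_maps T U" for S T U :: "'b topology" and f g
  proof -
    have "continuous_map S U (g \<circ> f)"
      using that by (auto simp: continuous_maps_def intro: continuous_map_compose)
    then have "continuous_map S U (compose (topspace S) g f)"
      by (rule continuous_map_eq) (simp add: compose_def)
    then show ?thesis by (simp add: continuous_maps_def)
  qed
  have ident: "(\<lambda>x\<in>topspace T. x) \<in> continuous_maps T T" for T :: "'b topology"
    using continuous_map_eq[OF continuous_map_id, of T "\<lambda>x\<in>topspace T. x"]
    by (simp add: continuous_maps_def)
  have funcset: "f \<in> topspace S \<rightarrow> topspace T" if "f \<in> continuous_maps S T" for S T :: "'b topology" and f
    using that continuous_map_funspace by (auto simp: continuous_maps_def)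
  have ext: "f \<in> extensional (topspace S)" if "f \<in> continuous_maps S T" for S T :: "'b topology" and f
    using that by (simp add: continuous_maps_def)
  show ?thesis
    unfolding category_def K_cat_def cat.simps
  proof (intro conjI ballI ident)
    fix S T U V :: "'b topology" and f g h
    assume f: "f \<in> continuous_maps S T"
    show "compose (topspace S) f (\<lambda>x\<in>topspace S. x) = f"
      by (rule compose_Id[OF funcset[OF f] ext[OF f]])
    show "compose (topspace S) (\<lambda>x\<in>topspace T. x) f = f"
      by (rule Id_compose[OF funcset[OF f] ext[OF f]])
    show "compose (topspace S) g f \<in> continuous_maps S U" if "g \<in> continuous_maps T U"
      by (rule compose[OF f that])
    show "compose (topspace S) h (compose (topspace S) g f) = compose (topspace S) (compose (topspace T) h g) f"
      by (rule compose_assoc[OF funcset[OF f]])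
  qed
qed

lemma TB_cat_higson_metric: "X \<in> ob TB_cat \<Longrightarrow> \<exists>D. higson_metric X D"
  using metric_compactification_exists metric_compactification.higson_metric_exists
  unfolding TB_cat_ob by blast

lemma higson_corona_in_K_cat:
  assumes "X \<in> ob TB_cat"
  shows "higson_corona X \<in> ob K_cat"
proof -
  obtain P where "higson_metric X P" using TB_cat_higson_metric[OF assms] ..
  then interpret higson_metric X P .
  have "compactin (mtopology_of P) bd"
    by (rule closedin_compact_space[OF compact closedin_bd])
  then have "compact_space (higson_corona X)"
    unfolding corona_topology by (rule compact_space_subtopology)
  moreover have "metrizable_space (higson_corona X)"
    unfolding corona_metric mtopology_of_def
    by (rule Metric_space.metrizable_space_mtopology[OF Metric_space_mspace_mdist])
  ultimately show ?thesis by (simp add: K_cat_def)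
qed

lemma is_iso_K_cat:
  assumes "S homeomorphic_space T"
  shows "\<exists>e. is_iso K_cat S T e"
proof -
  obtain f g where fg: "homeomorphic_maps S T f g"
    using assms unfolding homeomorphic_space_def by blast
  let ?f = "restrict f (topspace S)" and ?g = "restrict g (topspace T)"
  have f: "continuous_map S T f" "continuous_map T S g"
    and inv: "\<And>x. x \<in> topspace S \<Longrightarrow> g (f x) = x" "\<And>y. y \<in> topspace T \<Longrightarrow> f (g y) = y"
    using fg by (auto simp: homeomorphic_maps_def)
  have im: "f \<in> topspace S \<rightarrow> topspace T" "g \<in> topspace T \<rightarrow> topspace S"
    using f continuous_map_funspace by blast+
  have "continuous_map S T ?f" "continuous_map T S ?g"
    using f by (auto intro: continuous_map_eq)
  moreover have "compose (topspace S) ?g ?f = (\<lambda>x\<in>topspace S. x)"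
    "compose (topspace T) ?f ?g = (\<lambda>x\<in>topspace T. x)"
    using im inv by (auto simp: compose_def Pi_iff intro!: restrict_ext)
  ultimately have "is_iso K_cat S T ?f"
    unfolding is_iso_def K_cat_def cat.simps continuous_maps_def by (intro conjI bexI[of _ ?g]) auto
  then show ?thesis by blast
qed

section \<open>Functoriality\<close>

lemma corona_map_id:
  assumes "X \<in> ob TB_cat"
  shows "corona_map X X (\<lambda>x\<in>mspace X. x) = (\<lambda>p\<in>topspace (higson_corona X). p)"
proof -
  obtain P where "higson_metric X P" using TB_cat_higson_metric[OF assms] ..
  then interpret higson_metric X P .
  interpret higson_pair X P X P ..
  have "corona_limit (\<lambda>x\<in>mspace X. x) (\<lambda>p. p)"
    unfolding corona_limit_def boundary_limit_def by auto
  then show ?thesis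
    using corona_map_eq[OF coarse_maps_id] topspace_corona by simp
qed

lemma corona_map_compose:
  assumes "X \<in> ob TB_cat" "Y \<in> ob TB_cat" "Z \<in> ob TB_cat"
    and f: "f \<in> coarse_maps (mspace X) (C0_coarse X) (mspace Y) (C0_coarse Y)"
    and g: "g \<in> coarse_maps (mspace Y) (C0_coarse Y) (mspace Z) (C0_coarse Z)"
  shows "corona_map X Z (compose (mspace X) g f) =
    compose (topspace (higson_corona X)) (corona_map Y Z g) (corona_map X Y f)"
proof -
  obtain P Q R where "higson_metric X P" "higson_metric Y Q" "higson_metric Z R"
    using assms TB_cat_higson_metric by meson
  then interpret X: higson_metric X P + Y: higson_metric Y Q + Z: higson_metric Z R by simp_all
  interpret XY: higson_pair X P Y Q ..
  interpret YZ: higson_pair Y Q Z R ..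
  interpret XZ: higson_pair X P Z R ..
  obtain f' g' where f': "XY.corona_limit f f'" and g': "YZ.corona_limit g g'"
    using XY.corona_limit_exists[OF f] YZ.corona_limit_exists[OF g] by blast
  have "X.boundary_limit R (\<lambda>x. higson_embedding Z (g (f x))) (\<lambda>p. g' (f' p))"
    using g' unfolding YZ.corona_limit_def
    by (intro XY.corona_limit_compose[OF f' XY.coarse_funcset[OF f],
          where \<phi> = "\<lambda>y. higson_embedding Z (g y)"]) simp
  then have "X.boundary_limit R (\<lambda>x. higson_embedding Z (compose (mspace X) g f x)) (\<lambda>p. g' (f' p))"
    by (rule X.boundary_limit_cong) (auto simp: compose_def)
  moreover have f'_im: "f' \<in> X.bd \<rightarrow> Y.bd" "g' \<in> Y.bd \<rightarrow> Z.bd"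
    using f' g' by (auto simp: XY.corona_limit_def YZ.corona_limit_def)
  ultimately have "XZ.corona_limit (compose (mspace X) g f) (\<lambda>p. g' (f' p))"
    by (auto simp: XZ.corona_limit_def)
  then have "corona_map X Z (compose (mspace X) g f) = (\<lambda>p\<in>X.bd. g' (f' p))"
    by (rule XZ.corona_map_eq[OF coarse_maps_compose[OF f g]])
  then show ?thesis
    using f'_im unfolding XY.corona_map_eq[OF f f'] YZ.corona_map_eq[OF g g'] X.topspace_corona
    by (auto simp: compose_def Pi_iff intro!: restrict_ext)
qed

text \<open>The description in the functor quantifies over the whole class: close maps have the same
  boundary limit, hence the same \<open>corona_map\<close>.\<close>

lemma on_hom_eq_corona_map:
  assumes "X \<in> ob TB_cat" "Y \<in> ob TB_cat"
    and f: "f \<in> coarse_maps (mspace X) (C0_coarse X) (mspace Y) (C0_coarse Y)"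
  shows "on_hom higson_corona_functor X Y (closeness X Y `` {f}) = corona_map X Y f"
proof -
  obtain P Q where "higson_metric X P" "higson_metric Y Q"
    using assms TB_cat_higson_metric by meson
  then interpret higson_pair X P Y Q
    by (simp add: higson_pair_def)
  have "corona_map X Y f' = corona_map X Y f" if f': "f' \<in> closeness X Y `` {f}" for f'
  proof -
    have coarse': "f' \<in> coarse" and close: "close_maps (mspace X) (C0_coarse Y) f f'"
      using f' by (auto simp: closeness_def)
    obtain g g' where g: "corona_limit f g" "corona_limit f' g'"
      using corona_limit_exists f coarse' by meson
    then have "\<forall>p\<in>X.bd. g p = g' p"
      using close_iff_corona_limit[OF f coarse'] close by blast
    then show ?thesis
      using corona_map_eq[OF f g(1)] corona_map_eq[OF coarse' g(2)] by (metis restrict_ext)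
  qed
  moreover have "f \<in> closeness X Y `` {f}"
    using equiv_class_self[OF equiv_closeness[OF Y.locally_compact] f] .
  ultimately show ?thesis
    unfolding higson_corona_functor_def ftr.simps by (intro the_equality) (blast, metis)
qed

lemma is_functor_higson_corona: "is_functor TB_cat K_cat higson_corona_functor"
  unfolding is_functor_def
proof (intro conjI ballI category_TB_cat category_K_cat)
  have on_ob [simp]: "on_ob higson_corona_functor = higson_corona"
    by (simp add: higson_corona_functor_def)
  {
    fix X :: "'a metric" assume "X \<in> ob TB_cat"
    then show "on_ob higson_corona_functor X \<in> ob K_cat"
      by (simp add: higson_corona_in_K_cat)
  next
    fix X Y :: "'a metric" and F assume XY: "X \<in> ob TB_cat" "Y \<in> ob TB_cat" and "F \<in> hom TB_cat X Y"
    then obtain f where f: "f \<in> coarse_maps (mspace X) (C0_coarse X) (mspace Y) (C0_coarse Y)"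
      "F = closeness X Y `` {f}" by (elim TB_cat_homE)
    obtain P Q where "higson_metric X P" "higson_metric Y Q"
      using XY TB_cat_higson_metric by meson
    then interpret higson_pair X P Y Q
      by (simp add: higson_pair_def)
    obtain g where g: "corona_limit f g" using corona_limit_exists[OF f(1)] ..
    show "on_hom higson_corona_functor X Y F \<in> hom K_cat (on_ob higson_corona_functor X) (on_ob higson_corona_functor Y)"
      unfolding f(2) on_hom_eq_corona_map[OF XY f(1)] corona_map_eq[OF f(1) g]
      using restrict_continuous_maps[OF f(1) g] by (simp add: K_cat_def)
  next
    fix X :: "'a metric" assume X: "X \<in> ob TB_cat"
    show "on_hom higson_corona_functor X X (ident TB_cat X) = ident K_cat (on_ob higson_corona_functor X)"
      using on_hom_eq_corona_map[OF X X coarse_maps_id] corona_map_id[OF X]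
      by (simp add: TB_cat_def K_cat_def)
  next
    fix X Y Z :: "'a metric" and F G
    assume ob: "X \<in> ob TB_cat" "Y \<in> ob TB_cat" "Z \<in> ob TB_cat"
      and "F \<in> hom TB_cat X Y" "G \<in> hom TB_cat Y Z"
    then obtain f g where f: "f \<in> coarse_maps (mspace X) (C0_coarse X) (mspace Y) (C0_coarse Y)"
        "F = closeness X Y `` {f}"
      and g: "g \<in> coarse_maps (mspace Y) (C0_coarse Y) (mspace Z) (C0_coarse Z)" "G = closeness Y Z `` {g}"
      by (elim TB_cat_homE)
    show "on_hom higson_corona_functor X Z (cmp TB_cat X Y Z G F) =
        cmp K_cat (on_ob higson_corona_functor X) (on_ob higson_corona_functor Y) (on_ob higson_corona_functor Z)
          (on_hom higson_corona_functor Y Z G) (on_hom higson_corona_functor X Y F)"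
      unfolding f(2) g(2) TB_cat_cmp[OF ob f(1) g(1)]
      using ob f(1) g(1) by (simp add: on_hom_eq_corona_map coarse_maps_compose corona_map_compose K_cat_def)
  }
qed

theorem theorem4p5:
  assumes "infinite (UNIV :: 'a set)"
  shows "equivalence_of_categories
    (TB_cat :: ('a metric, ('a \<Rightarrow> 'a) set) cat)
    (K_cat :: ((('a \<Rightarrow> real) \<Rightarrow> real) topology, (('a \<Rightarrow> real) \<Rightarrow> real) \<Rightarrow> (('a \<Rightarrow> real) \<Rightarrow> real)) cat)
    higson_corona_functor"
proof (rule equivalence_of_categoriesI[OF is_functor_higson_corona])
  have on_ob [simp]: "on_ob higson_corona_functor = higson_corona"
    by (simp add: higson_corona_functor_def)
  {
    fix X Y :: "'a metric" and g
    assume XY: "X \<in> ob TB_cat" "Y \<in> ob TB_cat"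
      and "g \<in> hom K_cat (on_ob higson_corona_functor X) (on_ob higson_corona_functor Y)"
    then have g: "g \<in> continuous_maps (higson_corona X) (higson_corona Y)"
      by (simp add: K_cat_def)
    obtain P Q where "higson_metric X P" "higson_metric Y Q"
      using XY TB_cat_higson_metric by meson
    then interpret higson_pair X P Y Q
      by (simp add: higson_pair_def)
    have "compact_space (higson_corona X)"
      using higson_corona_in_K_cat[OF XY(1)] by (simp add: K_cat_def)
    \<comment> \<open>Compactness of the corona upgrades continuity to the uniform continuity that
      \<open>corona_limit_surj\<close> asks for.\<close>
    then have "uniformly_continuous_map (submetric P X.bd) (submetric Q Y.bd) g"
      using g unfolding X.corona_metric Y.corona_metric continuous_maps_def
      by (intro continuous_imp_uniformly_continuous_map) simp
    then obtain f where f: "f \<in> coarse" "corona_limit f g"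
      using corona_limit_surj XY(2) by (auto simp: TB_cat_ob)
    have "on_hom higson_corona_functor X Y (closeness X Y `` {f}) = restrict g X.bd"
      unfolding on_hom_eq_corona_map[OF XY f(1)] by (rule corona_map_eq[OF f])
    also have "\<dots> = g"
      using g by (simp add: continuous_maps_def X.topspace_corona extensional_restrict)
    finally show "\<exists>F\<in>hom TB_cat X Y. on_hom higson_corona_functor X Y F = g"
      using TB_cat_homI[OF f(1)] by blast
  next
    fix X Y :: "'a metric" and F G
    assume XY: "X \<in> ob TB_cat" "Y \<in> ob TB_cat" and "F \<in> hom TB_cat X Y" "G \<in> hom TB_cat X Y"
      and eq: "on_hom higson_corona_functor X Y F = on_hom higson_corona_functor X Y G"
    then obtain f g where f: "f \<in> coarse_maps (mspace X) (C0_coarse X) (mspace Y) (C0_coarse Y)"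
        "F = closeness X Y `` {f}"
      and g: "g \<in> coarse_maps (mspace X) (C0_coarse X) (mspace Y) (C0_coarse Y)" "G = closeness X Y `` {g}"
      by (elim TB_cat_homE)
    obtain P Q where "higson_metric X P" "higson_metric Y Q"
      using XY TB_cat_higson_metric by meson
    then interpret higson_pair X P Y Q
      by (simp add: higson_pair_def)
    obtain f' g' where lim: "corona_limit f f'" "corona_limit g g'"
      using corona_limit_exists[OF f(1)] corona_limit_exists[OF g(1)] by blast
    have "restrict f' X.bd = restrict g' X.bd"
      using eq unfolding f(2) g(2) on_hom_eq_corona_map[OF XY f(1)] on_hom_eq_corona_map[OF XY g(1)]
        corona_map_eq[OF f(1) lim(1)] corona_map_eq[OF g(1) lim(2)] .
    then have "\<forall>p\<in>X.bd. f' p = g' p" by (metis restrict_apply')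
    then have "(f, g) \<in> closeness X Y"
      using close_iff_corona_limit[OF f(1) g(1) lim] f(1) g(1) by (simp add: closeness_def)
    then show "F = G"
      unfolding f(2) g(2) by (rule equiv_class_eq[OF equiv_closeness[OF Y.locally_compact]])
  next
    fix T :: "(('a \<Rightarrow> real) \<Rightarrow> real) topology" assume "T \<in> ob K_cat"
    then obtain X :: "'a metric" where "X \<in> ob TB_cat" "higson_corona X homeomorphic_space T"
      using realize_corona[of T] assms by (auto simp: K_cat_def TB_cat_ob)
    then show "\<exists>X\<in>ob TB_cat. \<exists>e. is_iso K_cat (on_ob higson_corona_functor X) T e"
      using is_iso_K_cat by (metis on_ob)
  }
qed

end
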